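(* Let $X$ be a based $C_2$-space of the homotopy type of a $C_2$-CW complex. Then there is a natural weak equivalence $$\Sigma^\sigma\,\mathrm{Map}(C_2,X)\simeq(C_{2+}\wedge\Sigma X)\vee\Sigma^\sigma N_e^{C_2}X.$$
   Context: $\sigma$ is the real sign representation of $C_2$, $S^\sigma$ its one-point compactification, and $\Sigma^\sigma Z=S^\sigma\wedge Z$. $\mathrm{Map}(C_2,X)$ is the space of all maps $C_2\to X$ with the conjugation $C_2$-action (homeomorphic to $X\times X$ with the swap action), based at the constant map to the basepoint. $N_e^{C_2}X$ is the quotient of $\mathrm{Map}(C_2,X)$ by the subspace of maps taking the basepoint as a value, i.e. $X\wedge X$ with $C_2$ swapping the factors. *)

theory Defs
  imports "HOL-Analysis.Analysis" "HOL-Library.Z2"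
begin

text \<open>
  The group \<open>C\<^sub>2\<close> is the additive group of the type \<^typ>\<open>bit\<close>. Spaces are arbitrary topological
  spaces with carrier \<open>topspace\<close>; products carry the ordinary product topology. Maps and actions
  are total functions of which only the values on \<open>topspace\<close> are meaningful.
\<close>

section \<open>Quotients and disjoint unions\<close>

definition quotient_topology :: "'a topology \<Rightarrow> ('a \<Rightarrow> 'b) \<Rightarrow> 'b topology" where
  "quotient_topology X q =
     topology (\<lambda>U. U \<subseteq> q ` topspace X \<and> openin X {x \<in> topspace X. q x \<in> U})"

lemma openin_quotient_topology:
  "openin (quotient_topology X q) U \<longleftrightarrow>
     U \<subseteq> q ` topspace X \<and> openin X {x \<in> topspace X. q x \<in> U}"
proof -
  have "istopology (\<lambda>U. U \<subseteq> q ` topspace X \<and> openin X {x \<in> topspace X. q x \<in> U})"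
    unfolding istopology_def
  proof (intro conjI allI impI)
    fix S T
    assume S: "S \<subseteq> q ` topspace X \<and> openin X {x \<in> topspace X. q x \<in> S}"
      and T: "T \<subseteq> q ` topspace X \<and> openin X {x \<in> topspace X. q x \<in> T}"
    have "{x \<in> topspace X. q x \<in> S \<inter> T} = {x \<in> topspace X. q x \<in> S} \<inter> {x \<in> topspace X. q x \<in> T}"
      by auto
    with S T show "openin X {x \<in> topspace X. q x \<in> S \<inter> T}"
      by (simp add: openin_Int)
    show "S \<inter> T \<subseteq> q ` topspace X"
      using S by auto
  next
    fix \<K>
    assume K: "\<forall>S\<in>\<K>. S \<subseteq> q ` topspace X \<and> openin X {x \<in> topspace X. q x \<in> S}"
    have "{x \<in> topspace X. q x \<in> \<Union>\<K>} = (\<Union>S\<in>\<K>. {x \<in> topspace X. q x \<in> S})"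
      by auto
    with K show "openin X {x \<in> topspace X. q x \<in> \<Union>\<K>}"
      by auto
    show "\<Union>\<K> \<subseteq> q ` topspace X"
      using K by auto
  qed
  then show ?thesis
    by (simp add: quotient_topology_def)
qed

lemma topspace_quotient_topology [simp]:
  "topspace (quotient_topology X q) = q ` topspace X"
proof -
  have "openin (quotient_topology X q) (q ` topspace X)"
    unfolding openin_quotient_topology by (auto intro: openin_subopen[THEN iffD2])
  then show ?thesis
    by (meson openin_quotient_topology openin_subset openin_topspace subset_antisym)
qed

lemma quotient_map_quotient_topology: "quotient_map X (quotient_topology X q) q"
  by (simp add: quotient_map_def openin_quotient_topology)

text \<open>
  A point of \<open>X / A\<close> is an equivalence class, i.e. either \<open>A\<close> itself or a singleton \<open>{x}\<close> with
  \<open>x \<notin> A\<close>. A map \<open>f\<close> from \<open>X\<close> to \<open>Y\<close> sending \<open>A\<close> into \<open>B\<close> induces \<open>collapse_map B f\<close> from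
  \<open>X / A\<close> to \<open>Y / B\<close>.
\<close>

definition collapse_proj :: "'a set \<Rightarrow> 'a \<Rightarrow> 'a set" where
  "collapse_proj A x = (if x \<in> A then A else {x})"

definition collapse :: "'a topology \<Rightarrow> 'a set \<Rightarrow> 'a set topology" where
  "collapse X A = quotient_topology X (collapse_proj A)"

definition collapse_map :: "'b set \<Rightarrow> ('a \<Rightarrow> 'b) \<Rightarrow> 'a set \<Rightarrow> 'b set" where
  "collapse_map B f c = (if f ` c \<subseteq> B then B else f ` c)"

lemma collapse_map_proj:
  assumes "f ` A \<subseteq> B"
  shows "collapse_map B f (collapse_proj A x) = collapse_proj B (f x)"
  using assms by (auto simp: collapse_map_def collapse_proj_def)

definition coproduct_topology :: "'a topology \<Rightarrow> 'b topology \<Rightarrow> ('a + 'b) topology" where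
  "coproduct_topology X Y = topology (\<lambda>U. openin X (Inl -` U) \<and> openin Y (Inr -` U))"

lemma openin_coproduct_topology:
  "openin (coproduct_topology X Y) U \<longleftrightarrow> openin X (Inl -` U) \<and> openin Y (Inr -` U)"
proof -
  have "istopology (\<lambda>U. openin X (Inl -` U) \<and> openin Y (Inr -` U))"
    by (auto simp: istopology_def vimage_Union)
  then show ?thesis
    by (simp add: coproduct_topology_def)
qed

lemma topspace_coproduct_topology [simp]:
  "topspace (coproduct_topology X Y) = topspace X <+> topspace Y"
proof
  show "topspace (coproduct_topology X Y) \<subseteq> topspace X <+> topspace Y"
  proof
    fix z assume z: "z \<in> topspace (coproduct_topology X Y)"
    have "openin X (Inl -` topspace (coproduct_topology X Y))"
      "openin Y (Inr -` topspace (coproduct_topology X Y))"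
      using openin_topspace[of "coproduct_topology X Y"]
      unfolding openin_coproduct_topology by auto
    with z show "z \<in> topspace X <+> topspace Y"
      by (cases z) (auto dest: openin_subset)
  qed
  have "Inl -` (topspace X <+> topspace Y) = topspace X"
    "Inr -` (topspace X <+> topspace Y) = topspace Y"
    by auto
  then have "openin (coproduct_topology X Y) (topspace X <+> topspace Y)"
    by (simp add: openin_coproduct_topology)
  then show "topspace X <+> topspace Y \<subseteq> topspace (coproduct_topology X Y)"
    by (rule openin_subset)
qed


section \<open>\<open>C\<^sub>2\<close>-spaces and based \<open>C\<^sub>2\<close>-spaces\<close>

record 'a c2_space =
  Top :: "'a topology"
  act :: "bit \<Rightarrow> 'a \<Rightarrow> 'a"

record 'a based_c2_space = "'a c2_space" +
  pt :: 'a

definition C2_space :: "('a, 'm) c2_space_scheme \<Rightarrow> bool" where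
  "C2_space X \<longleftrightarrow>
     (\<forall>g. continuous_map (Top X) (Top X) (act X g)) \<and>
     (\<forall>x\<in>topspace (Top X). act X 0 x = x) \<and>
     (\<forall>g h. \<forall>x\<in>topspace (Top X). act X (g + h) x = act X g (act X h x))"

definition based_C2_space :: "'a based_c2_space \<Rightarrow> bool" where
  "based_C2_space X \<longleftrightarrow>
     C2_space X \<and> pt X \<in> topspace (Top X) \<and> (\<forall>g. act X g (pt X) = pt X)"

definition equivariant ::
    "('a, 'm) c2_space_scheme \<Rightarrow> ('b, 'n) c2_space_scheme \<Rightarrow> ('a \<Rightarrow> 'b) \<Rightarrow> bool" where
  "equivariant X Y f \<longleftrightarrow> (\<forall>g. \<forall>x\<in>topspace (Top X). f (act X g x) = act Y g (f x))"

definition based_C2_map :: "'a based_c2_space \<Rightarrow> 'b based_c2_space \<Rightarrow> ('a \<Rightarrow> 'b) \<Rightarrow> bool" where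
  "based_C2_map X Y f \<longleftrightarrow>
     continuous_map (Top X) (Top Y) f \<and> equivariant X Y f \<and> f (pt X) = pt Y"

definition based_C2_homotopic ::
    "'a based_c2_space \<Rightarrow> 'b based_c2_space \<Rightarrow> ('a \<Rightarrow> 'b) \<Rightarrow> ('a \<Rightarrow> 'b) \<Rightarrow> bool" where
  "based_C2_homotopic X Y =
     homotopic_with (\<lambda>f. equivariant X Y f \<and> f (pt X) = pt Y) (Top X) (Top Y)"

definition based_C2_homotopy_equivalent ::
    "'a based_c2_space \<Rightarrow> 'b based_c2_space \<Rightarrow> bool" where
  "based_C2_homotopy_equivalent X Y \<longleftrightarrow>
     (\<exists>f g. based_C2_map X Y f \<and> based_C2_map Y X g \<and>
            based_C2_homotopic X X (g \<circ> f) id \<and> based_C2_homotopic Y Y (f \<circ> g) id)"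

definition C2_subgroup :: "bit set \<Rightarrow> bool" where
  "C2_subgroup H \<longleftrightarrow> 0 \<in> H \<and> (\<forall>g\<in>H. \<forall>h\<in>H. g + h \<in> H) \<and> (\<forall>g\<in>H. - g \<in> H)"

definition C2_fixed :: "bit set \<Rightarrow> ('a, 'm) c2_space_scheme \<Rightarrow> 'a topology" where
  "C2_fixed H X = subtopology (Top X) {x. \<forall>h\<in>H. act X h x = x}"


section \<open>\<open>C\<^sub>2\<close>-CW complexes\<close>

definition C2_orbit :: "bit set \<Rightarrow> bit set set" where
  "C2_orbit H = range (\<lambda>g. (+) g ` H)"

definition unit_disk :: "nat \<Rightarrow> (nat \<Rightarrow> real) topology" where
  "unit_disk n = subtopology (Euclidean_space n) {x. (\<Sum>i<n. (x i)\<^sup>2) \<le> 1}"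

definition C2_cell :: "bit set \<Rightarrow> nat \<Rightarrow> (bit set \<times> (nat \<Rightarrow> real)) topology" where
  "C2_cell H n = prod_topology (discrete_topology (C2_orbit H)) (unit_disk n)"

text \<open>For \<open>n = 0\<close> the boundary is empty, since the empty sum is not \<open>1\<close>.\<close>

definition C2_cell_boundary :: "bit set \<Rightarrow> nat \<Rightarrow> (bit set \<times> (nat \<Rightarrow> real)) set" where
  "C2_cell_boundary H n = {z \<in> topspace (C2_cell H n). (\<Sum>i<n. (snd z i)\<^sup>2) = 1}"

text \<open>
  \<open>attaches_cells K A B n \<C>\<close>: with the subspace topologies from \<open>K\<close>, the set \<open>B\<close> is the pushout
  of \<open>A\<close> and the \<open>n\<close>-cells \<open>C\<^sub>2/H \<times> D\<^sup>n\<close> in \<open>\<C>\<close> along equivariant attaching maps of their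
  boundaries. A member \<open>(H, \<Phi>)\<close> of \<open>\<C>\<close> consists of the orbit type and the characteristic map; the
  characteristic maps themselves serve as indices of the cells, as distinct cells have disjoint
  interiors.
\<close>

definition attaches_cells ::
    "('a, 'm) c2_space_scheme \<Rightarrow> 'a set \<Rightarrow> 'a set \<Rightarrow> nat \<Rightarrow>
     (bit set \<times> (bit set \<times> (nat \<Rightarrow> real) \<Rightarrow> 'a)) set \<Rightarrow> bool" where
  "attaches_cells K A B n \<C> \<longleftrightarrow>
     A \<subseteq> B \<and> B \<subseteq> topspace (Top K) \<and>
     (\<forall>(H, \<Phi>)\<in>\<C>.
        C2_subgroup H \<and>
        continuous_map (C2_cell H n) (subtopology (Top K) B) \<Phi> \<and>
        (\<forall>g. \<forall>(c, x)\<in>topspace (C2_cell H n). \<Phi> ((+) g ` c, x) = act K g (\<Phi> (c, x))) \<and>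
        \<Phi> ` C2_cell_boundary H n \<subseteq> A) \<and>
     bij_betw (\<lambda>((H, \<Phi>), z). \<Phi> z)
       (SIGMA (H, \<Phi>):\<C>. topspace (C2_cell H n) - C2_cell_boundary H n) (B - A) \<and>
     (\<forall>S\<subseteq>B. closedin (subtopology (Top K) B) S \<longleftrightarrow>
        closedin (subtopology (Top K) A) (S \<inter> A) \<and>
        (\<forall>(H, \<Phi>)\<in>\<C>. closedin (C2_cell H n) {z \<in> topspace (C2_cell H n). \<Phi> z \<in> S}))"

definition C2_CW_complex :: "('a, 'm) c2_space_scheme \<Rightarrow> bool" where
  "C2_CW_complex K \<longleftrightarrow>
     C2_space K \<and>
     (\<exists>sk \<C>.
        attaches_cells K {} (sk 0) 0 (\<C> 0) \<and>
        (\<forall>n. attaches_cells K (sk n) (sk (Suc n)) (Suc n) (\<C> (Suc n))) \<and>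
        topspace (Top K) = (\<Union>n. sk n) \<and>
        (\<forall>S\<subseteq>topspace (Top K). closedin (Top K) S \<longleftrightarrow>
           (\<forall>n. closedin (subtopology (Top K) (sk n)) (S \<inter> sk n))))"

text \<open>
  The homotopy type is taken in the category of based \<open>C\<^sub>2\<close>-spaces; the base point of the complex
  may be any fixed point. The type argument fixes the type of points of the complex.
\<close>

definition has_C2_CW_type :: "'k itself \<Rightarrow> 'a based_c2_space \<Rightarrow> bool" where
  "has_C2_CW_type (_ :: 'k itself) X \<longleftrightarrow>
     (\<exists>K :: 'k based_c2_space.
        based_C2_space K \<and> C2_CW_complex K \<and> based_C2_homotopy_equivalent X K)"


section \<open>Weak equivalences\<close>

text \<open>
  \<open>htpy_set n X x\<close> is the underlying set of \<open>\<pi>\<^sub>n(X, x)\<close>, the based homotopy classes of based maps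
  from the \<open>n\<close>-sphere; for \<open>n = 0\<close> it is the set of path components.
\<close>

definition sphere_pt :: "nat \<Rightarrow> real" where
  "sphere_pt = (\<lambda>i. if i = 0 then 1 else 0)"

definition sphere_maps :: "nat \<Rightarrow> 'a topology \<Rightarrow> 'a \<Rightarrow> ((nat \<Rightarrow> real) \<Rightarrow> 'a) set" where
  "sphere_maps n X x = {u. continuous_map (nsphere n) X u \<and> u sphere_pt = x}"

definition sphere_homotopy :: "nat \<Rightarrow> 'a topology \<Rightarrow> 'a \<Rightarrow> ((nat \<Rightarrow> real) \<Rightarrow> 'a) rel" where
  "sphere_homotopy n X x = {(u, v). homotopic_with (\<lambda>w. w sphere_pt = x) (nsphere n) X u v}"

definition htpy_set :: "nat \<Rightarrow> 'a topology \<Rightarrow> 'a \<Rightarrow> ((nat \<Rightarrow> real) \<Rightarrow> 'a) set set" where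
  "htpy_set n X x = sphere_maps n X x // sphere_homotopy n X x"

definition htpy_map ::
    "nat \<Rightarrow> 'b topology \<Rightarrow> 'b \<Rightarrow> ('a \<Rightarrow> 'b) \<Rightarrow>
     ((nat \<Rightarrow> real) \<Rightarrow> 'a) set \<Rightarrow> ((nat \<Rightarrow> real) \<Rightarrow> 'b) set" where
  "htpy_map n Y y f c = (\<Union>u\<in>c. sphere_homotopy n Y y `` {f \<circ> u})"

definition weak_equivalence :: "'a topology \<Rightarrow> 'b topology \<Rightarrow> ('a \<Rightarrow> 'b) \<Rightarrow> bool" where
  "weak_equivalence X Y f \<longleftrightarrow>
     continuous_map X Y f \<and> (topspace X = {} \<longrightarrow> topspace Y = {}) \<and>
     (\<forall>n. \<forall>x\<in>topspace X.
        bij_betw (htpy_map n Y (f x) f) (htpy_set n X x) (htpy_set n Y (f x)))"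

definition C2_weak_equivalence ::
    "'a based_c2_space \<Rightarrow> 'b based_c2_space \<Rightarrow> ('a \<Rightarrow> 'b) \<Rightarrow> bool" where
  "C2_weak_equivalence X Y f \<longleftrightarrow>
     based_C2_map X Y f \<and>
     (\<forall>H. C2_subgroup H \<longrightarrow> weak_equivalence (C2_fixed H X) (C2_fixed H Y) f)"


section \<open>Constructions on based \<open>C\<^sub>2\<close>-spaces\<close>

definition axes :: "'a based_c2_space \<Rightarrow> 'b based_c2_space \<Rightarrow> ('a \<times> 'b) set" where
  "axes X Y = topspace (Top X) \<times> {pt Y} \<union> {pt X} \<times> topspace (Top Y)"

definition smash ::
    "'a based_c2_space \<Rightarrow> 'b based_c2_space \<Rightarrow> ('a \<times> 'b) set based_c2_space" where
  "smash X Y =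
     \<lparr>Top = collapse (prod_topology (Top X) (Top Y)) (axes X Y),
      act = (\<lambda>g. collapse_map (axes X Y) (map_prod (act X g) (act Y g))),
      pt = axes X Y\<rparr>"

text \<open>In \<open>smash_map\<close>, \<open>wedge_map\<close> and \<open>norm_map\<close> the space arguments are the targets.\<close>

definition smash_map ::
    "'c based_c2_space \<Rightarrow> 'd based_c2_space \<Rightarrow> ('a \<Rightarrow> 'c) \<Rightarrow> ('b \<Rightarrow> 'd) \<Rightarrow>
     ('a \<times> 'b) set \<Rightarrow> ('c \<times> 'd) set" where
  "smash_map X' Y' f g = collapse_map (axes X' Y') (map_prod f g)"

definition wedge ::
    "'a based_c2_space \<Rightarrow> 'b based_c2_space \<Rightarrow> ('a + 'b) set based_c2_space" where
  "wedge X Y =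
     \<lparr>Top = collapse (coproduct_topology (Top X) (Top Y)) {Inl (pt X), Inr (pt Y)},
      act = (\<lambda>g. collapse_map {Inl (pt X), Inr (pt Y)} (map_sum (act X g) (act Y g))),
      pt = {Inl (pt X), Inr (pt Y)}\<rparr>"

definition wedge_map ::
    "'c based_c2_space \<Rightarrow> 'd based_c2_space \<Rightarrow> ('a \<Rightarrow> 'c) \<Rightarrow> ('b \<Rightarrow> 'd) \<Rightarrow>
     ('a + 'b) set \<Rightarrow> ('c + 'd) set" where
  "wedge_map X' Y' f g = collapse_map {Inl (pt X'), Inr (pt Y')} (map_sum f g)"

definition S_one :: "real option based_c2_space" where
  "S_one = \<lparr>Top = Alexandroff_compactification euclideanreal, act = (\<lambda>_. id), pt = None\<rparr>"

definition S_sigma :: "real option based_c2_space" where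
  "S_sigma =
     \<lparr>Top = Alexandroff_compactification euclideanreal,
      act = (\<lambda>g. map_option (\<lambda>t. if g = 0 then t else - t)), pt = None\<rparr>"

abbreviation Susp :: "'a based_c2_space \<Rightarrow> (real option \<times> 'a) set based_c2_space" where
  "Susp X \<equiv> smash S_one X"

abbreviation Susp_sigma :: "'a based_c2_space \<Rightarrow> (real option \<times> 'a) set based_c2_space" where
  "Susp_sigma X \<equiv> smash S_sigma X"

text \<open>\<open>C\<^sub>2\<close> with a disjoint base point \<open>None\<close>, acting on itself by translation.\<close>

definition C2_plus :: "bit option based_c2_space" where
  "C2_plus = \<lparr>Top = discrete_topology UNIV, act = (\<lambda>g. map_option ((+) g)), pt = None\<rparr>"

definition Map_C2 :: "'a based_c2_space \<Rightarrow> (bit \<Rightarrow> 'a) based_c2_space" where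
  "Map_C2 X =
     \<lparr>Top = product_topology (\<lambda>_. Top X) UNIV,
      act = (\<lambda>g u h. act X g (u (- g + h))), pt = (\<lambda>_. pt X)\<rparr>"

definition hits_pt :: "'a based_c2_space \<Rightarrow> (bit \<Rightarrow> 'a) set" where
  "hits_pt X = {u \<in> topspace (Top (Map_C2 X)). \<exists>h. u h = pt X}"

definition Norm_C2 :: "'a based_c2_space \<Rightarrow> (bit \<Rightarrow> 'a) set based_c2_space" where
  "Norm_C2 X =
     \<lparr>Top = collapse (Top (Map_C2 X)) (hits_pt X),
      act = (\<lambda>g. collapse_map (hits_pt X) (act (Map_C2 X) g)), pt = hits_pt X\<rparr>"

definition norm_map ::
    "'b based_c2_space \<Rightarrow> ('a \<Rightarrow> 'b) \<Rightarrow> (bit \<Rightarrow> 'a) set \<Rightarrow> (bit \<Rightarrow> 'b) set" where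
  "norm_map Y f = collapse_map (hits_pt Y) ((\<circ>) f)"


section \<open>The two functors\<close>

definition susp_Map :: "'a based_c2_space \<Rightarrow> (real option \<times> (bit \<Rightarrow> 'a)) set based_c2_space" where
  "susp_Map X = Susp_sigma (Map_C2 X)"

definition susp_Map_map ::
    "'b based_c2_space \<Rightarrow> ('a \<Rightarrow> 'b) \<Rightarrow>
     (real option \<times> (bit \<Rightarrow> 'a)) set \<Rightarrow> (real option \<times> (bit \<Rightarrow> 'b)) set" where
  "susp_Map_map Y f = smash_map S_sigma (Map_C2 Y) id ((\<circ>) f)"

type_synonym 'a splitting_point =
  "((bit option \<times> (real option \<times> 'a) set) set + (real option \<times> (bit \<Rightarrow> 'a) set) set) set"

definition splitting :: "'a based_c2_space \<Rightarrow> 'a splitting_point based_c2_space" where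
  "splitting X = wedge (smash C2_plus (Susp X)) (Susp_sigma (Norm_C2 X))"

definition splitting_map ::
    "'b based_c2_space \<Rightarrow> ('a \<Rightarrow> 'b) \<Rightarrow> 'a splitting_point \<Rightarrow> 'b splitting_point" where
  "splitting_map Y f =
     wedge_map (smash C2_plus (Susp Y)) (Susp_sigma (Norm_C2 Y))
       (smash_map C2_plus (Susp Y) id (smash_map S_one Y id f))
       (smash_map S_sigma (Norm_C2 Y) id (norm_map Y f))"

end

theory Submission
  imports Defs
begin

text \<open>
  Regard \<open>S\<^sup>\<sigma>\<close> as the interval \<open>[-1, 1]\<close> with its two ends glued to the base point, the generator of
  \<open>C\<^sub>2\<close> acting by \<open>v \<mapsto> -v\<close>. Pinching the two points \<open>1/3\<close> and \<open>-1/3\<close> to the base point breaks it into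
  a copy of \<open>S\<^sup>\<sigma>\<close>, the middle third, and two circles that are exchanged by the action. The natural
  map (\<open>pinch\<close>) sends a point \<open>(v, u)\<close> of \<open>\<Sigma>\<^sup>\<sigma> Map(C\<^sub>2, X)\<close> to the class of \<open>u\<close> in the norm if \<open>v\<close> lies
  in the middle third, and to the value of \<open>u\<close> at the element of \<open>C\<^sub>2\<close> that labels the circle if \<open>v\<close>
  lies in an outer third. Equivariance and naturality can be read off from this formula; it remains
  to see that the map is a weak equivalence on the fixed points of both subgroups.

  On \<open>C\<^sub>2\<close>-fixed points both sides are \<open>X\<close>: the circles contribute nothing, and what is left sits over
  the centre \<open>v = 0\<close>. The one thing to be checked is that \<open>x \<mapsto> (x, gx)\<close> embeds \<open>X\<close> into the quotient
  \<open>X \<and> X\<close> without a change of topology (\<open>norm_piece_diagonal_open\<close>).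

  Forgetting the action, the map is the classical splitting
  \<open>\<Sigma>(X \<times> X) \<simeq> \<Sigma>X \<or> \<Sigma>X \<or> \<Sigma>(X \<and> X)\<close>. As \<open>X\<close> may be disconnected, homology does not detect this
  equivalence; instead a homotopy inverse is written down. On the two circles it is the inclusion of
  the axes, and on \<open>\<Sigma>(X \<and> X)\<close> it should be the loop \<open>(x, *)\<^sup>-\<^sup>1 (x, y) (*, y)\<^sup>-\<^sup>1\<close>. This loop is only
  null-homotopic, not constant, when \<open>(x, y)\<close> lies on an axis. If a neighbourhood of the base point
  can be contracted to the base point (\<open>well_pointed\<close>), then replacing \<open>x\<close> and \<open>y\<close> by the ends \<open>x'\<close>
  and \<open>y'\<close> of the contraction makes \<open>(x', y')\<close> lie on an axis over a whole neighbourhood of the axes,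
  and there is room to carry out the null-homotopy, by retracing ever shorter pieces of the loops
  (\<open>unpinch_norm\<close>). Both composites with the pinch map are homotopic to the identity by sliding the
  points at which the loops turn back (\<open>unpinch_homotopic_E\<close>, \<open>\<eta>_unpinch_homotopic_G\<close>).

  The cell structure enters only through \<open>well_pointed\<close>, which is invariant under based homotopy
  equivalence and holds at every point of a CW complex (\<open>C2_CW_complex_well_pointed\<close>): a contraction
  is found inside the cell that contains the point and is extended over the cells of higher dimension
  without changing it on the lower skeleton. Finally, homotopy groups are taken at all base points,
  whereas the homotopies above move base points; \<open>homotopy_equivalence_imp_weak_equivalence\<close> deals
  with this by dragging spheres along paths.
\<close>

section \<open>Continuous maps and base points\<close>

abbreviation unit_interval :: "real topology" where "unit_interval \<equiv> top_of_set {0..1}"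

lemma continuous_map_compose2:
  assumes "continuous_map (prod_topology A B) T F" "continuous_map Z A f" "continuous_map Z B g"
  shows "continuous_map Z T (\<lambda>z. F (f z, g z))"
  using continuous_map_compose[OF continuous_map_pairedI[OF assms(2,3)] assms(1)] by (simp add: o_def)

lemma continuous_map_compose1:
  assumes "continuous_map B T F" "continuous_map Z B g"
  shows "continuous_map Z T (\<lambda>z. F (g z))"
  using continuous_map_compose[OF assms(2,1)] by (simp add: o_def)

lemma continuous_map_into_Icc:
  assumes "continuous_map Z euclideanreal f" "\<And>z. z \<in> topspace Z \<Longrightarrow> a \<le> f z \<and> f z \<le> b"
  shows "continuous_map Z (top_of_set {a..b::real}) f"
  using assms by (auto simp: continuous_map_in_subtopology)

definition clamp01 :: "real \<Rightarrow> real" where "clamp01 t = max 0 (min 1 t)"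

lemma clamp01_range: "0 \<le> clamp01 t" "clamp01 t \<le> 1" by (auto simp: clamp01_def)

lemma continuous_map_clamp01 [continuous_intros]:
  "continuous_map Z euclideanreal f \<Longrightarrow> continuous_map Z euclideanreal (\<lambda>z. clamp01 (f z))"
  unfolding clamp01_def by (intro continuous_intros) auto

text \<open>Nondegeneracy of the base point in a form that is invariant under based homotopy equivalence:
  unlike for a cofibration, \<open>\<phi>\<close> may vanish at other points than \<open>p\<close>.\<close>

definition well_pointed :: "'a topology \<Rightarrow> 'a \<Rightarrow> bool" where
  "well_pointed X p \<longleftrightarrow>
     (\<exists>\<phi> h. continuous_map X unit_interval \<phi> \<and> \<phi> p = 0 \<and>
        continuous_map (prod_topology unit_interval X) X h \<and>
        (\<forall>x\<in>topspace X. h (0, x) = x) \<and> (\<forall>t\<in>{0..1}. h (t, p) = p) \<and>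
        (\<forall>x\<in>topspace X. \<phi> x < 1 \<longrightarrow> h (1, x) = p))"

section \<open>Free homotopy equivalences are weak equivalences\<close>

text \<open>\<open>push n t\<close> deforms the sphere along great circles towards its base point: at time \<open>1\<close> the cap
  where the coordinate \<open>0\<close> is at least \<open>1/2\<close> has arrived there. Points with nonpositive coordinate \<open>0\<close>
  do not move, so that the unnormalised vector never vanishes.\<close>

definition push_vec :: "real \<Rightarrow> (nat \<Rightarrow> real) \<Rightarrow> nat \<Rightarrow> real" where
  "push_vec t z i = (1 - t * clamp01 (2 * z 0)) * z i + t * clamp01 (2 * z 0) * sphere_pt i"

definition push :: "nat \<Rightarrow> real \<Rightarrow> (nat \<Rightarrow> real) \<Rightarrow> nat \<Rightarrow> real" where
  "push n t z i = push_vec t z i / sqrt (\<Sum>j\<le>n. (push_vec t z j)\<^sup>2)"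

lemma topspace_nsphere: "z \<in> topspace (nsphere n) \<longleftrightarrow> (\<Sum>j\<le>n. (z j)\<^sup>2) = 1 \<and> (\<forall>i>n. z i = 0)"
  by (auto simp: nsphere)

lemma sphere_pt_in_nsphere [simp]: "sphere_pt \<in> topspace (nsphere n)"
  using in_topspace_nsphere by (simp add: sphere_pt_def)

lemma push_vec_pos:
  assumes z: "z \<in> topspace (nsphere n)" and t: "0 \<le> t" "t \<le> 1"
  shows "(\<Sum>j\<le>n. (push_vec t z j)\<^sup>2) > 0"
proof -
  define s where "s = t * clamp01 (2 * z 0)"
  have s: "0 \<le> s" "s \<le> 1" and z0: "z 0 \<le> 0 \<Longrightarrow> s = 0"
    using t clamp01_range by (auto simp: s_def clamp01_def intro: mult_le_one)
  show ?thesis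
  proof (cases "s = 0")
    case True
    then have "push_vec t z j = z j" for j by (simp add: push_vec_def flip: s_def)
    then show ?thesis using z by (simp add: topspace_nsphere)
  next
    case False
    then have "z 0 > 0" using z0 by force
    then have "push_vec t z 0 > 0"
      using s False by (auto simp: push_vec_def sphere_pt_def simp flip: s_def intro!: add_nonneg_pos)
    then have "(push_vec t z 0)\<^sup>2 > 0" by simp
    moreover have "(push_vec t z 0)\<^sup>2 \<le> (\<Sum>j\<le>n. (push_vec t z j)\<^sup>2)"
      by (rule member_le_sum) auto
    ultimately show ?thesis by linarith
  qed
qed

lemma push_continuous:
  "continuous_map (prod_topology unit_interval (nsphere n)) (nsphere n) (\<lambda>p. push n (fst p) (snd p))"
proof -
  let ?Z = "prod_topology unit_interval (nsphere n)"
  have fst: "continuous_map ?Z euclideanreal fst"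
    by (rule continuous_map_into_fulltopology[OF continuous_map_fst])
  have snd: "continuous_map ?Z euclideanreal (\<lambda>p. snd p i)" for i
    by (rule continuous_map_compose1[OF continuous_map_nsphere_projection continuous_map_snd])
  have v: "continuous_map ?Z euclideanreal (\<lambda>p. push_vec (fst p) (snd p) i)" for i
    unfolding push_vec_def by (intro continuous_intros fst snd) auto
  have pos: "(\<Sum>j\<le>n. (push_vec (fst p) (snd p) j)\<^sup>2) > 0" if "p \<in> topspace ?Z" for p
    using that push_vec_pos by auto
  have "continuous_map ?Z euclideanreal (\<lambda>p. push n (fst p) (snd p) i)" for i
    unfolding push_def using pos by (intro continuous_intros v) force+
  moreover have "(\<Sum>i\<le>n. (push n (fst p) (snd p) i)\<^sup>2) = 1" if "p \<in> topspace ?Z" for p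
    using pos[OF that] by (simp add: push_def power_divide flip: sum_divide_distrib)
  moreover have "push n (fst p) (snd p) i = 0" if "p \<in> topspace ?Z" "n < i" for p i
    using that by (auto simp: push_def push_vec_def sphere_pt_def topspace_nsphere)
  ultimately show ?thesis
    unfolding nsphere by (auto simp: continuous_map_in_subtopology continuous_map_componentwise_UNIV nsphere)
qed

lemma continuous_map_push:
  assumes "continuous_map Z unit_interval f" "continuous_map Z (nsphere n) g"
  shows "continuous_map Z (nsphere n) (\<lambda>z. push n (f z) (g z))"
  using continuous_map_compose2[OF push_continuous assms] by simp

lemma push_0: "z \<in> topspace (nsphere n) \<Longrightarrow> push n 0 z = z"
  by (auto simp: push_def push_vec_def topspace_nsphere)

lemma push_to_sphere_pt:
  assumes "\<And>j. push_vec t z j = sphere_pt j"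
  shows "push n t z = sphere_pt"
  using sphere_pt_in_nsphere[of n] unfolding topspace_nsphere by (auto simp: push_def assms)

lemma push_sphere_pt: "push n t sphere_pt = sphere_pt"
  by (rule push_to_sphere_pt) (simp add: push_vec_def algebra_simps)

lemma push_1_cap: "z 0 \<ge> 1/2 \<Longrightarrow> push n 1 z = sphere_pt"
  by (rule push_to_sphere_pt) (simp add: push_vec_def clamp01_def)

lemma homotopic_rel_pt:
  "(u, v) \<in> sphere_homotopy n X x \<longleftrightarrow>
     (\<exists>K. continuous_map (prod_topology unit_interval (nsphere n)) X K \<and>
       (\<forall>z\<in>topspace (nsphere n). K (0, z) = u z) \<and> (\<forall>z\<in>topspace (nsphere n). K (1, z) = v z) \<and>
       (\<forall>t\<in>{0..1}. K (t, sphere_pt) = x))"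
  unfolding sphere_homotopy_def mem_Collect_eq case_prod_conv by (rule homotopic_with) auto

definition homotopic_along ::
    "nat \<Rightarrow> 'a topology \<Rightarrow> (real \<Rightarrow> 'a) \<Rightarrow> ((nat \<Rightarrow> real) \<Rightarrow> 'a) \<Rightarrow> ((nat \<Rightarrow> real) \<Rightarrow> 'a) \<Rightarrow> bool" where
  "homotopic_along n X \<gamma> u v \<longleftrightarrow>
     (\<exists>K. continuous_map (prod_topology unit_interval (nsphere n)) X K \<and>
       (\<forall>z\<in>topspace (nsphere n). K (0, z) = u z) \<and> (\<forall>z\<in>topspace (nsphere n). K (1, z) = v z) \<and>
       (\<forall>t\<in>{0..1}. K (t, sphere_pt) = \<gamma> t))"

lemma homotopic_along_reverse:
  assumes "homotopic_along n X \<gamma> u v"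
  shows "homotopic_along n X (\<lambda>t. \<gamma> (1 - t)) v u"
proof -
  obtain K where K: "continuous_map (prod_topology unit_interval (nsphere n)) X K"
    "\<And>z. z\<in>topspace (nsphere n) \<Longrightarrow> K (0, z) = u z" "\<And>z. z\<in>topspace (nsphere n) \<Longrightarrow> K (1, z) = v z"
    "\<And>t. t\<in>{0..1} \<Longrightarrow> K (t, sphere_pt) = \<gamma> t"
    using assms by (auto simp: homotopic_along_def)
  have "continuous_map (prod_topology unit_interval (nsphere n)) X (\<lambda>p. K (1 - fst p, snd p))"
    by (intro continuous_map_compose2[OF K(1)] continuous_map_into_Icc continuous_intros
        continuous_map_into_fulltopology[OF continuous_map_fst]) auto
  then show ?thesis
    unfolding homotopic_along_def
    by (intro exI[of _ "\<lambda>p. K (1 - fst p, snd p)"]) (auto simp: K)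
qed

text \<open>The result of dragging the value of \<open>u\<close> at the base point along the path \<open>\<gamma>\<close>: the cap
  around the base point of the sphere runs through \<open>\<gamma>\<close>, its complement is stretched over the
  sphere.\<close>

definition drag :: "nat \<Rightarrow> (real \<Rightarrow> 'a) \<Rightarrow> ((nat \<Rightarrow> real) \<Rightarrow> 'a) \<Rightarrow> (nat \<Rightarrow> real) \<Rightarrow> 'a" where
  "drag n \<gamma> u z = (if z 0 \<le> 1/2 then u (push n 1 z) else \<gamma> (2 * z 0 - 1))"

lemma nsphere_coord_le_1: "z \<in> topspace (nsphere n) \<Longrightarrow> z 0 \<le> 1"
proof -
  assume "z \<in> topspace (nsphere n)"
  then have "(\<Sum>j\<le>n. (z j)\<^sup>2) = 1" by (simp add: topspace_nsphere)
  moreover have "(z 0)\<^sup>2 \<le> (\<Sum>j\<le>n. (z j)\<^sup>2)" by (rule member_le_sum) auto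
  ultimately show ?thesis using abs_square_le_1[of "z 0"] by linarith
qed

lemma push1_continuous: "continuous_map (nsphere n) (nsphere n) (push n 1)"
  by (rule continuous_map_push) auto

lemma drag_homotopy:
  assumes M: "continuous_map (prod_topology unit_interval (nsphere n)) X M"
    and Mpt: "\<And>t. t\<in>{0..1} \<Longrightarrow> M (t, sphere_pt) = \<gamma> 0"
    and \<Gamma>: "continuous_map (prod_topology unit_interval unit_interval) X \<Gamma>"
    and \<Gamma>0: "\<And>t. t\<in>{0..1} \<Longrightarrow> \<Gamma> (t, 0) = \<gamma> 0"
  shows "continuous_map (prod_topology unit_interval (nsphere n)) X
    (\<lambda>p. drag n (\<lambda>s. \<Gamma> (fst p, s)) (\<lambda>z. M (fst p, z)) (snd p))"
proof -
  let ?Z = "prod_topology unit_interval (nsphere n)"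
  have fst: "continuous_map ?Z euclideanreal fst"
    by (rule continuous_map_into_fulltopology[OF continuous_map_fst])
  have snd: "continuous_map ?Z euclideanreal (\<lambda>p. snd p i)" for i
    by (rule continuous_map_compose1[OF continuous_map_nsphere_projection continuous_map_snd])
  show ?thesis
    unfolding drag_def
  proof (rule continuous_map_cases_le)
    show "continuous_map ?Z euclideanreal (\<lambda>p. snd p 0)" by (rule snd)
    show "continuous_map ?Z euclideanreal (\<lambda>p. 1/2 :: real)" by simp
    show "continuous_map (subtopology ?Z {p \<in> topspace ?Z. snd p 0 \<le> 1/2}) X (\<lambda>p. M (fst p, push n 1 (snd p)))"
      by (rule continuous_map_from_subtopology, intro continuous_map_compose2[OF M] continuous_map_fst
         continuous_map_compose1[OF push1_continuous] continuous_map_snd)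
    show "continuous_map (subtopology ?Z {p \<in> topspace ?Z. 1/2 \<le> snd p 0}) X (\<lambda>p. \<Gamma> (fst p, 2 * snd p 0 - 1))"
      by (intro continuous_map_compose2[OF \<Gamma>] continuous_map_subtopology_fst continuous_map_into_Icc continuous_intros
          continuous_map_from_subtopology[OF snd]) (use nsphere_coord_le_1 in auto)
    show "M (fst p, push n 1 (snd p)) = \<Gamma> (fst p, 2 * snd p 0 - 1)"
      if "p \<in> topspace ?Z" "snd p 0 = 1/2" for p
    proof -
      have 0: "2 * snd p 0 - 1 = 0" and t: "fst p \<in> {0..1}" using that by auto
      show ?thesis unfolding 0 using that t by (simp add: push_1_cap Mpt \<Gamma>0)
    qed
  qed
qed

text \<open>The end of a homotopy along \<open>\<gamma>\<close> is determined by its start and \<open>\<gamma>\<close>, because it can be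
  deformed, relative to the base point, into the standard choice \<open>drag n \<gamma> u\<close>.\<close>

lemma homotopic_along_target_drag:
  assumes "homotopic_along n X \<gamma> u v"
  shows "(drag n \<gamma> u, v) \<in> sphere_homotopy n X (\<gamma> 1)"
proof -
  obtain K where K: "continuous_map (prod_topology unit_interval (nsphere n)) X K"
    "\<And>z. z\<in>topspace (nsphere n) \<Longrightarrow> K (0, z) = u z" "\<And>z. z\<in>topspace (nsphere n) \<Longrightarrow> K (1, z) = v z"
    "\<And>t. t\<in>{0..1} \<Longrightarrow> K (t, sphere_pt) = \<gamma> t"
    using assms by (auto simp: homotopic_along_def)
  let ?Z = "prod_topology unit_interval (nsphere n)"
  let ?S = "sphere_homotopy n X (\<gamma> 1)"
  have fst: "continuous_map ?Z euclideanreal fst"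
    by (rule continuous_map_into_fulltopology[OF continuous_map_fst])
  have snd: "continuous_map ?Z euclideanreal (\<lambda>p. snd p i)" for i
    by (rule continuous_map_compose1[OF continuous_map_nsphere_projection continuous_map_snd])
  have push1: "push n 1 z \<in> topspace (nsphere n)" if "z \<in> topspace (nsphere n)" for z
    using push1_continuous that by (auto simp: continuous_map_def)
  have pt0: "sphere_pt 0 = 1" by (simp add: sphere_pt_def)
  have "(drag n \<gamma> u, v \<circ> push n 1) \<in> ?S"
    unfolding homotopic_rel_pt
  proof (intro exI conjI ballI)
    \<comment> \<open>on the cap the second argument is the base point and the first one runs from \<open>fst p\<close> to \<open>1\<close>\<close>
    let ?K = "\<lambda>p. K (fst p + (1 - fst p) * clamp01 (2 * snd p 0 - 1), push n 1 (snd p))"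
    show "continuous_map ?Z X ?K"
    proof (intro continuous_map_compose2[OF K(1)] continuous_map_into_Icc)
      show "continuous_map ?Z euclideanreal (\<lambda>p. fst p + (1 - fst p) * clamp01 (2 * snd p 0 - 1))"
        by (intro continuous_intros fst snd)
      show "continuous_map ?Z (nsphere n) (\<lambda>p. push n 1 (snd p))"
        by (intro continuous_map_compose1[OF push1_continuous] continuous_map_snd)
      show "0 \<le> fst p + (1 - fst p) * clamp01 (2 * snd p 0 - 1) \<and>
         fst p + (1 - fst p) * clamp01 (2 * snd p 0 - 1) \<le> 1" if "p \<in> topspace ?Z" for p
      proof -
        have t: "0 \<le> fst p" "fst p \<le> 1" using that by auto
        have "(1 - fst p) * clamp01 (2 * snd p 0 - 1) \<le> (1 - fst p) * 1"
          by (intro mult_left_mono clamp01_range) (use t in auto)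
        then show ?thesis using t clamp01_range by auto
      qed
    qed
    show "?K (0, z) = drag n \<gamma> u z" if "z \<in> topspace (nsphere n)" for z
    proof (cases "z 0 \<le> 1/2")
      case True
      then show ?thesis using K(2)[OF push1[OF that]] by (simp add: drag_def clamp01_def)
    next
      case False
      then show ?thesis using nsphere_coord_le_1[OF that] by (simp add: drag_def clamp01_def push_1_cap K(4))
    qed
    show "?K (1, z) = (v \<circ> push n 1) z" if "z \<in> topspace (nsphere n)" for z
      using K(3)[OF push1[OF that]] by simp
    show "?K (t, sphere_pt) = \<gamma> 1" if "t \<in> {0..1}" for t
      by (simp add: push_sphere_pt pt0 clamp01_def K(4))
  qed
  moreover have "(v, v \<circ> push n 1) \<in> ?S"
    unfolding homotopic_rel_pt
  proof (intro exI conjI ballI)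
    let ?K = "\<lambda>p. K (1, push n (fst p) (snd p))"
    show "continuous_map ?Z X ?K"
      by (intro continuous_map_compose2[OF K(1)] continuous_map_push continuous_map_fst continuous_map_snd) auto
    show "?K (0, z) = v z" if "z \<in> topspace (nsphere n)" for z
      using that by (simp add: push_0 K(3))
    show "?K (1, z) = (v \<circ> push n 1) z" if "z \<in> topspace (nsphere n)" for z
      using K(3)[OF push1[OF that]] by simp
    show "?K (t, sphere_pt) = \<gamma> 1" if "t \<in> {0..1}" for t
      by (simp add: push_sphere_pt K(4))
  qed
  ultimately show ?thesis
    unfolding sphere_homotopy_def using homotopic_with_trans homotopic_with_symD by blast
qed

lemma homotopic_along_unique:
  assumes "homotopic_along n X \<gamma> u v" "homotopic_along n X \<gamma> u' v'"
    and "(u, u') \<in> sphere_homotopy n X (\<gamma> 0)"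
  shows "(v, v') \<in> sphere_homotopy n X (\<gamma> 1)"
proof -
  let ?Z = "prod_topology unit_interval (nsphere n)"
  obtain K where K: "continuous_map ?Z X K" "\<And>t. t\<in>{0..1} \<Longrightarrow> K (t, sphere_pt) = \<gamma> t"
    using assms(1) by (auto simp: homotopic_along_def)
  obtain M where M: "continuous_map ?Z X M"
    "\<And>z. z\<in>topspace (nsphere n) \<Longrightarrow> M (0, z) = u z" "\<And>z. z\<in>topspace (nsphere n) \<Longrightarrow> M (1, z) = u' z"
    "\<And>t. t\<in>{0..1} \<Longrightarrow> M (t, sphere_pt) = \<gamma> 0"
    using assms(3) by (auto simp: homotopic_rel_pt)
  have push1: "push n 1 z \<in> topspace (nsphere n)" if "z \<in> topspace (nsphere n)" for z
    using push1_continuous that by (auto simp: continuous_map_def)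
  have pt0: "sphere_pt 0 = 1" by (simp add: sphere_pt_def)
  have "continuous_map ?Z X (\<lambda>p. drag n (\<lambda>s. K (snd (fst p, s), sphere_pt)) (\<lambda>z. M (fst p, z)) (snd p))"
  proof (rule drag_homotopy[where \<gamma> = \<gamma> and \<Gamma> = "\<lambda>q. K (snd q, sphere_pt)"])
    show "continuous_map (prod_topology unit_interval unit_interval) X (\<lambda>q. K (snd q, sphere_pt))"
      by (intro continuous_map_compose2[OF K(1)] continuous_map_snd) auto
  qed (use M K in auto)
  then have "(drag n \<gamma> u, drag n \<gamma> u') \<in> sphere_homotopy n X (\<gamma> 1)"
    unfolding homotopic_rel_pt
    by (intro exI[of _ "\<lambda>p. drag n (\<lambda>s. K (snd (fst p, s), sphere_pt)) (\<lambda>z. M (fst p, z)) (snd p)"])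
      (use nsphere_coord_le_1 in \<open>auto simp: drag_def K M push1 pt0\<close>)
  with homotopic_along_target_drag[OF assms(1)] homotopic_along_target_drag[OF assms(2)]
  show ?thesis
    unfolding sphere_homotopy_def using homotopic_with_trans homotopic_with_symD by blast
qed

lemma homotopic_along_exists:
  assumes u: "u \<in> sphere_maps n X (\<gamma> 0)" and \<gamma>: "continuous_map unit_interval X \<gamma>"
  obtains u' v where "(u', u) \<in> sphere_homotopy n X (\<gamma> 0)" "homotopic_along n X \<gamma> u' v"
proof -
  let ?Z = "prod_topology unit_interval (nsphere n)"
  have cu: "continuous_map (nsphere n) X u" and u0: "u sphere_pt = \<gamma> 0"
    using u by (auto simp: sphere_maps_def)
  have pt0: "sphere_pt 0 = 1" by (simp add: sphere_pt_def)
  have "continuous_map ?Z X (\<lambda>p. u (push n (1 - fst p) (snd p)))"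
    by (intro continuous_map_compose1[OF cu] continuous_map_push continuous_map_snd
       continuous_map_into_Icc continuous_intros continuous_map_into_fulltopology[OF continuous_map_fst]) auto
  then have 1: "(u \<circ> push n 1, u) \<in> sphere_homotopy n X (\<gamma> 0)"
    unfolding homotopic_rel_pt
    by (intro exI[of _ "\<lambda>p. u (push n (1 - fst p) (snd p))"]) (auto simp: push_0 push_sphere_pt u0)
  have 2: "homotopic_along n X \<gamma> (u \<circ> push n 1) (drag n \<gamma> u)"
    unfolding homotopic_along_def
  proof (intro exI conjI ballI)
    let ?K = "\<lambda>p. drag n (\<lambda>s. \<gamma> (fst (fst p, s) * snd (fst p, s))) (\<lambda>z. u (snd (fst p, z))) (snd p)"
    show "continuous_map ?Z X ?K"
    proof (rule drag_homotopy[where \<Gamma> = "\<lambda>q. \<gamma> (fst q * snd q)" and M = "\<lambda>q. u (snd q)" and \<gamma> = \<gamma>])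
      show "continuous_map ?Z X (\<lambda>q. u (snd q))"
        by (intro continuous_map_compose1[OF cu] continuous_map_snd)
      show "continuous_map (prod_topology unit_interval unit_interval) X (\<lambda>q. \<gamma> (fst q * snd q))"
        by (intro continuous_map_compose1[OF \<gamma>] continuous_map_into_Icc continuous_intros
            continuous_map_into_fulltopology[OF continuous_map_fst]
            continuous_map_into_fulltopology[OF continuous_map_snd]) (auto intro: mult_le_one)
    qed (simp_all add: u0)
    show "?K (0, z) = (u \<circ> push n 1) z" if "z \<in> topspace (nsphere n)" for z
      by (simp add: drag_def push_1_cap u0)
    show "?K (1, z) = drag n \<gamma> u z" for z by (simp add: drag_def)
    show "?K (t, sphere_pt) = \<gamma> t" for t by (simp add: drag_def pt0)
  qed
  from 1 2 show thesis by (rule that)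
qed

lemma homotopic_along_in_sphere_maps:
  assumes "homotopic_along n X \<gamma> u v" shows "v \<in> sphere_maps n X (\<gamma> 1)"
proof -
  obtain K where K: "continuous_map (prod_topology unit_interval (nsphere n)) X K"
    "\<And>z. z\<in>topspace (nsphere n) \<Longrightarrow> K (1, z) = v z" "\<And>t. t\<in>{0..1} \<Longrightarrow> K (t, sphere_pt) = \<gamma> t"
    using assms by (auto simp: homotopic_along_def)
  have "continuous_map (nsphere n) X (\<lambda>z. K (1, z))"
    by (intro continuous_map_compose2[OF K(1)]) auto
  then have "continuous_map (nsphere n) X v"
    by (rule continuous_map_eq) (use K in auto)
  then show ?thesis using K(2)[of sphere_pt] K(3)[of 1] by (simp add: sphere_maps_def)
qed

lemma equiv_sphere_homotopy: "equiv (sphere_maps n X x) (sphere_homotopy n X x)"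
proof (rule equivI)
  show "sphere_homotopy n X x \<subseteq> sphere_maps n X x \<times> sphere_maps n X x"
  proof (rule subrelI)
    fix u v assume "(u, v) \<in> sphere_homotopy n X x"
    then have h: "homotopic_with (\<lambda>w. w sphere_pt = x) (nsphere n) X u v"
      by (simp add: sphere_homotopy_def)
    show "(u, v) \<in> sphere_maps n X x \<times> sphere_maps n X x"
      using homotopic_with_imp_continuous_maps[OF h] homotopic_with_imp_property[OF h]
      by (simp add: sphere_maps_def)
  qed
  show "refl_on (sphere_maps n X x) (sphere_homotopy n X x)"
    by (auto simp: refl_on_def sphere_homotopy_def sphere_maps_def)
  show "sym (sphere_homotopy n X x)"
    by (auto simp: sym_def sphere_homotopy_def homotopic_with_symD)
  show "trans (sphere_homotopy n X x)"
    unfolding trans_def sphere_homotopy_def using homotopic_with_trans by blast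
qed

lemma sphere_homotopy_compose:
  assumes "continuous_map X Y f" "(u, v) \<in> sphere_homotopy n X x"
  shows "(f \<circ> u, f \<circ> v) \<in> sphere_homotopy n Y (f x)"
  using assms unfolding sphere_homotopy_def
  by (auto intro: homotopic_with_compose_continuous_map_left)

lemma sphere_maps_compose:
  assumes "continuous_map X Y f" "u \<in> sphere_maps n X x"
  shows "f \<circ> u \<in> sphere_maps n Y (f x)"
  using assms by (auto simp: sphere_maps_def intro: continuous_map_compose)

lemma htpy_map_class:
  assumes "continuous_map X Y f" "u \<in> sphere_maps n X x"
  shows "htpy_map n Y (f x) f (sphere_homotopy n X x `` {u}) = sphere_homotopy n Y (f x) `` {f \<circ> u}"
proof -
  have "sphere_homotopy n Y (f x) `` {f \<circ> v} = sphere_homotopy n Y (f x) `` {f \<circ> u}"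
    if "(u, v) \<in> sphere_homotopy n X x" for v
    by (rule equiv_class_eq[OF equiv_sphere_homotopy, symmetric], rule sphere_homotopy_compose[OF assms(1) that])
  moreover have "(u, u) \<in> sphere_homotopy n X x"
    using assms(2) equiv_sphere_homotopy by (metis equiv_def refl_onD)
  ultimately show ?thesis unfolding htpy_map_def by blast
qed

lemma homotopic_along_of_homotopic_id:
  assumes H: "continuous_map (prod_topology unit_interval X) X H"
    and H0: "\<And>x. x \<in> topspace X \<Longrightarrow> H (0, x) = k x" and H1: "\<And>x. x \<in> topspace X \<Longrightarrow> H (1, x) = x"
    and u: "u \<in> sphere_maps n X x"
  shows "homotopic_along n X (\<lambda>t. H (t, x)) (k \<circ> u) u"
proof -
  have cu: "continuous_map (nsphere n) X u" and u0: "u sphere_pt = x"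
    using u by (auto simp: sphere_maps_def)
  have "continuous_map (prod_topology unit_interval (nsphere n)) X (\<lambda>p. H (fst p, u (snd p)))"
    by (intro continuous_map_compose2[OF H] continuous_map_fst continuous_map_compose1[OF cu] continuous_map_snd)
  moreover have "u z \<in> topspace X" if "z \<in> topspace (nsphere n)" for z
    using cu that by (auto simp: continuous_map_def)
  ultimately show ?thesis
    unfolding homotopic_along_def
    by (intro exI[of _ "\<lambda>p. H (fst p, u (snd p))"]) (auto simp: H0 H1 u0)
qed

text \<open>A map that is freely homotopic to the identity acts bijectively on homotopy groups even though
  it may move the base point: up to the transport along the track of the base point it is the identity.\<close>

lemma homotopic_to_id_on_htpy:
  assumes "homotopic_with (\<lambda>_. True) X X k id" and x: "x \<in> topspace X"
  shows "\<lbrakk>u \<in> sphere_maps n X x; v \<in> sphere_maps n X x; (k \<circ> u, k \<circ> v) \<in> sphere_homotopy n X (k x)\<rbrakk>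
      \<Longrightarrow> (u, v) \<in> sphere_homotopy n X x"
    and "w \<in> sphere_maps n X (k x) \<Longrightarrow> \<exists>u\<in>sphere_maps n X x. (k \<circ> u, w) \<in> sphere_homotopy n X (k x)"
proof -
  obtain H where H: "continuous_map (prod_topology unit_interval X) X H"
    "\<And>x. H (0, x) = k x" "\<And>x. H (1, x) = x"
    using assms(1) unfolding homotopic_with_def id_def by metis
  note along = homotopic_along_of_homotopic_id[OF H(1), of k, OF H(2,3)]
  let ?\<gamma> = "\<lambda>t. H (t, x)"
  show "(u, v) \<in> sphere_homotopy n X x"
    if "u \<in> sphere_maps n X x" "v \<in> sphere_maps n X x" "(k \<circ> u, k \<circ> v) \<in> sphere_homotopy n X (k x)"
    using homotopic_along_unique[OF along[OF that(1)] along[OF that(2)]] that(3) by (simp add: H)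
  show "\<exists>u\<in>sphere_maps n X x. (k \<circ> u, w) \<in> sphere_homotopy n X (k x)"
    if w: "w \<in> sphere_maps n X (k x)"
  proof -
    have \<gamma>: "continuous_map unit_interval X ?\<gamma>"
      by (intro continuous_map_compose2[OF H(1)]) (use x in auto)
    obtain w' u where w': "(w', w) \<in> sphere_homotopy n X (k x)" and u: "homotopic_along n X ?\<gamma> w' u"
      using homotopic_along_exists[of w n X ?\<gamma>] w \<gamma> by (auto simp: H)
    have us: "u \<in> sphere_maps n X x" using homotopic_along_in_sphere_maps[OF u] by (simp add: H)
    have "(u, u) \<in> sphere_homotopy n X x" using us equiv_sphere_homotopy by (metis equiv_def refl_onD)
    then have "(k \<circ> u, w') \<in> sphere_homotopy n X (k x)"
      using homotopic_along_unique[OF homotopic_along_reverse[OF along[OF us]] homotopic_along_reverse[OF u]]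
      by (simp add: H)
    with w' have "(k \<circ> u, w) \<in> sphere_homotopy n X (k x)"
      using equiv_sphere_homotopy by (metis equiv_def transD)
    with us show ?thesis by blast
  qed
qed

text \<open>Surjectivity of \<open>f\<close> cannot be checked with the homotopy from \<open>f \<circ> g\<close> to the identity alone,
  because the base points \<open>x\<close> and \<open>f x\<close> are tracked along unrelated paths. It follows from the surjectivity
  of \<open>g \<circ> f\<close> and the injectivity of \<open>f \<circ> g\<close>.\<close>

theorem homotopy_equivalence_imp_weak_equivalence:
  assumes f: "continuous_map X Y f" and g: "continuous_map Y X g"
    and gf: "homotopic_with (\<lambda>_. True) X X (g \<circ> f) id"
    and fg: "homotopic_with (\<lambda>_. True) Y Y (f \<circ> g) id"
  shows "weak_equivalence X Y f"
  unfolding weak_equivalence_def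
proof (intro conjI allI ballI impI)
  show "topspace Y = {}" if "topspace X = {}"
    using continuous_map_image_subset_topspace[OF g] that by auto
  fix n x assume x: "x \<in> topspace X"
  then have fx: "f x \<in> topspace Y" using f by (auto simp: continuous_map_def)
  let ?SX = "sphere_homotopy n X x" and ?SY = "sphere_homotopy n Y (f x)"
  let ?MX = "sphere_maps n X x" and ?MY = "sphere_maps n Y (f x)"
  show "bij_betw (htpy_map n Y (f x) f) (htpy_set n X x) (htpy_set n Y (f x))"
    unfolding bij_betw_def
  proof
    show "inj_on (htpy_map n Y (f x) f) (htpy_set n X x)"
    proof (rule inj_onI)
      fix c d assume "c \<in> htpy_set n X x" "d \<in> htpy_set n X x"
        and eq: "htpy_map n Y (f x) f c = htpy_map n Y (f x) f d"
      then obtain u v where uv: "u \<in> ?MX" "v \<in> ?MX" "c = ?SX `` {u}" "d = ?SX `` {v}"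
        by (auto simp: htpy_set_def elim!: quotientE)
      then have "?SY `` {f \<circ> u} = ?SY `` {f \<circ> v}"
        using eq by (simp add: htpy_map_class[OF f])
      then have "(f \<circ> u, f \<circ> v) \<in> ?SY"
        using eq_equiv_class[OF _ equiv_sphere_homotopy] sphere_maps_compose[OF f uv(2)] by metis
      then have "((g \<circ> f) \<circ> u, (g \<circ> f) \<circ> v) \<in> sphere_homotopy n X ((g \<circ> f) x)"
        using sphere_homotopy_compose[OF g] by (fastforce simp: comp_assoc)
      then have "(u, v) \<in> ?SX" using homotopic_to_id_on_htpy(1)[OF gf x] uv by metis
      then show "c = d" using uv equiv_class_eq[OF equiv_sphere_homotopy] by metis
    qed
    show "htpy_map n Y (f x) f ` htpy_set n X x = htpy_set n Y (f x)"
    proof (intro subset_antisym subsetI)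
      fix d assume "d \<in> htpy_map n Y (f x) f ` htpy_set n X x"
      then obtain u where "u \<in> ?MX" "d = htpy_map n Y (f x) f (?SX `` {u})"
        by (auto simp: htpy_set_def elim!: quotientE)
      then show "d \<in> htpy_set n Y (f x)"
        by (simp add: htpy_map_class[OF f] htpy_set_def quotientI sphere_maps_compose[OF f])
    next
      fix d assume "d \<in> htpy_set n Y (f x)"
      then obtain w where w: "w \<in> ?MY" "d = ?SY `` {w}"
        by (auto simp: htpy_set_def elim!: quotientE)
      have "g \<circ> w \<in> sphere_maps n X ((g \<circ> f) x)" using sphere_maps_compose[OF g w(1)] by simp
      then obtain u where u: "u \<in> ?MX" "((g \<circ> f) \<circ> u, g \<circ> w) \<in> sphere_homotopy n X ((g \<circ> f) x)"
        using homotopic_to_id_on_htpy(2)[OF gf x] by blast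
      have "((f \<circ> g) \<circ> (f \<circ> u), (f \<circ> g) \<circ> w) \<in> sphere_homotopy n Y ((f \<circ> g) (f x))"
        using sphere_homotopy_compose[OF f u(2)] by (simp add: comp_assoc)
      then have "(f \<circ> u, w) \<in> ?SY"
        using homotopic_to_id_on_htpy(1)[OF fg fx] sphere_maps_compose[OF f u(1)] w(1) by metis
      then have "?SY `` {f \<circ> u} = d" using w equiv_class_eq[OF equiv_sphere_homotopy] by metis
      then show "d \<in> htpy_map n Y (f x) f ` htpy_set n X x"
        using u(1) htpy_map_class[OF f u(1)] by (force simp: htpy_set_def intro: quotientI)
    qed
  qed
qed (fact f)

section \<open>Contracting a neighbourhood of a point of a CW complex\<close>

text \<open>The topology of \<open>Z\<close> is the finest one for which all \<open>f i\<close> are continuous. The interest of this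
  notion is \<open>continuous_map_generated_by\<close>: it is compatible with products with the interval, so that
  homotopies can be defined cell by cell.\<close>

definition generated_by :: "'z topology \<Rightarrow> 'i set \<Rightarrow> ('i \<Rightarrow> 'd topology) \<Rightarrow> ('i \<Rightarrow> 'd \<Rightarrow> 'z) \<Rightarrow> bool" where
  "generated_by Z I D f \<longleftrightarrow>
     topspace Z = (\<Union>i\<in>I. f i ` topspace (D i)) \<and>
     (\<forall>S\<subseteq>topspace Z. closedin Z S \<longleftrightarrow> (\<forall>i\<in>I. closedin (D i) {z \<in> topspace (D i). f i z \<in> S}))"

lemma generated_by_quotient:
  assumes "generated_by Z I D f"
  shows "quotient_map (sum_topology D I) Z (\<lambda>(i, z). f i z)"
  unfolding quotient_map_closedin
proof (intro conjI allI impI)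
  show "(\<lambda>(i, z). f i z) ` topspace (sum_topology D I) = topspace Z"
    using assms by (force simp: generated_by_def image_iff)
  fix S assume "S \<subseteq> topspace Z"
  then have "closedin Z S \<longleftrightarrow> (\<forall>i\<in>I. closedin (D i) {z \<in> topspace (D i). f i z \<in> S})"
    using assms by (simp add: generated_by_def)
  moreover have "{z. (i, z) \<in> {s \<in> topspace (sum_topology D I). (case s of (i, z) \<Rightarrow> f i z) \<in> S}} =
      {z \<in> topspace (D i). f i z \<in> S}" if "i \<in> I" for i
    using that by auto
  ultimately show "closedin (sum_topology D I) {s \<in> topspace (sum_topology D I). (case s of (i, z) \<Rightarrow> f i z) \<in> S} \<longleftrightarrow> closedin Z S"
    by (auto simp: closedin_sum_topology)
qed

lemma continuous_map_generated_by:
  assumes Z: "generated_by Z I D f"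
    and F: "\<And>i. i \<in> I \<Longrightarrow> continuous_map (prod_topology unit_interval (D i)) T (\<lambda>s. F (fst s, f i (snd s)))"
  shows "continuous_map (prod_topology unit_interval Z) T F"
proof -
  let ?S = "sum_topology D I" and ?q = "\<lambda>(i, z). f i z"
  let ?Q = "prod_topology unit_interval ?S"
  have Q: "quotient_map ?Q (prod_topology unit_interval Z) (\<lambda>(t, s). (t, ?q s))"
    by (intro quotient_map_prod_right generated_by_quotient[OF Z] disjI1 compact_imp_locally_compact_space
        Hausdorff_space_subtopology Hausdorff_space_euclidean) (simp add: compact_space_subtopology)
  have "continuous_map ?Q T (\<lambda>s. F (fst s, f (fst (snd s)) (snd (snd s))))"
  proof (rule pasting_lemma[where I = I and T = "\<lambda>i. {0..1} \<times> ({i} \<times> topspace (D i))"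
        and f = "\<lambda>i s. F (fst s, f i (snd (snd s)))"])
    fix i assume i: "i \<in> I"
    let ?U = "{i} \<times> topspace (D i)"
    have "{x. (j, x) \<in> ?U} = (if j = i then topspace (D i) else {})" for j by auto
    then have "openin ?S ?U" using i by (auto simp: openin_sum_topology)
    then show "openin ?Q ({0..1} \<times> ?U)"
      using openin_prod_Times_iff[of unit_interval ?S "{0..1}" ?U] openin_topspace[of unit_interval] by simp
    have "continuous_map (subtopology ?S ?U) (D i) snd"
      unfolding continuous_map_def
    proof (intro conjI allI impI)
      fix V assume V: "openin (D i) V"
      then have "openin ?S ({i} \<times> V)"
      proof -
        have "{x. (j, x) \<in> {i} \<times> V} = (if j = i then V else {})" for j by auto
        then show ?thesis using i V openin_subset[OF V] by (auto simp: openin_sum_topology)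
      qed
      moreover have "{s \<in> topspace (subtopology ?S ?U). snd s \<in> V} = ({i} \<times> V) \<inter> ?U"
        using i openin_subset[OF V] by auto
      ultimately show "openin (subtopology ?S ?U) {s \<in> topspace (subtopology ?S ?U). snd s \<in> V}"
        by (simp add: openin_subtopology_Int)
    qed auto
    then have "continuous_map (subtopology ?Q ({0..1} \<times> ?U)) (D i) (\<lambda>s. snd (snd s))"
      by (intro continuous_map_compose1[of "subtopology ?S ?U" _ snd _ snd])
        (auto simp: continuous_map_in_subtopology intro: continuous_map_from_subtopology continuous_map_snd)
    then show "continuous_map (subtopology ?Q ({0..1} \<times> ?U)) T (\<lambda>s. F (fst s, f i (snd (snd s))))"
      using continuous_map_compose1[OF F[OF i] continuous_map_pairedI[OF continuous_map_subtopology_fst]] by simp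
  qed auto
  then have "continuous_map ?Q T (F \<circ> (\<lambda>(t, s). (t, ?q s)))"
    by (simp add: o_def case_prod_unfold)
  then show ?thesis by (rule continuous_compose_quotient_map[OF Q])
qed

subsection \<open>Disks\<close>

lemma topspace_unit_disk: "x \<in> topspace (unit_disk n) \<longleftrightarrow> (\<forall>i\<ge>n. x i = 0) \<and> (\<Sum>i<n. (x i)\<^sup>2) \<le> 1"
  by (simp add: unit_disk_def topspace_Euclidean_space)

lemma continuous_map_unit_diskI:
  assumes "\<And>i. continuous_map Z euclideanreal (\<lambda>z. f z i)" "\<And>z. z \<in> topspace Z \<Longrightarrow> f z \<in> topspace (unit_disk n)"
  shows "continuous_map Z (unit_disk n) f"
  using assms unfolding topspace_unit_disk unfolding unit_disk_def Euclidean_space_def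
  by (auto simp: continuous_map_in_subtopology continuous_map_componentwise_UNIV)

lemma continuous_map_unit_disk_coord: "continuous_map (unit_disk n) euclideanreal (\<lambda>x. x i)"
  unfolding unit_disk_def Euclidean_space_def subtopology_subtopology
  by (intro continuous_map_from_subtopology continuous_map_product_projection) auto

lemma topspace_C2_cell: "topspace (C2_cell H n) = C2_orbit H \<times> topspace (unit_disk n)"
  by (simp add: C2_cell_def)

lemma continuous_map_C2_cellI:
  assumes "continuous_map Z (discrete_topology (C2_orbit H)) c" "continuous_map Z (unit_disk n) f"
  shows "continuous_map Z (C2_cell H n) (\<lambda>z. (c z, f z))"
  unfolding C2_cell_def by (intro continuous_map_pairedI assms)

lemma C2_cell_projections:
  "continuous_map (C2_cell H n) (discrete_topology (C2_orbit H)) fst"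
  "continuous_map (C2_cell H n) euclideanreal (\<lambda>z. snd z i)"
  unfolding C2_cell_def
  by (rule continuous_map_fst, rule continuous_map_compose1[OF continuous_map_unit_disk_coord continuous_map_snd])

definition sqnorm :: "nat \<Rightarrow> (nat \<Rightarrow> real) \<Rightarrow> real" where "sqnorm n x = (\<Sum>i<n. (x i)\<^sup>2)"

lemma sqnorm_nonneg: "0 \<le> sqnorm n x" by (simp add: sqnorm_def sum_nonneg)

lemma sqnorm_scale: "sqnorm n (\<lambda>i. c * x i) = c\<^sup>2 * sqnorm n x"
  by (simp add: sqnorm_def power_mult_distrib sum_distrib_left)

lemma sqnorm_convex:
  assumes "0 \<le> g" "g \<le> 1" "sqnorm n x \<le> 1" "sqnorm n y \<le> 1"
  shows "sqnorm n (\<lambda>i. x i + g * (y i - x i)) \<le> 1"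
proof -
  have "(x i + g * (y i - x i))\<^sup>2 \<le> (1 - g) * (x i)\<^sup>2 + g * (y i)\<^sup>2" for i
  proof -
    have "(1 - g) * (x i)\<^sup>2 + g * (y i)\<^sup>2 - (x i + g * (y i - x i))\<^sup>2 = (g * (1 - g)) * (y i - x i)\<^sup>2"
      by (simp add: power2_eq_square algebra_simps)
    moreover have "0 \<le> (g * (1 - g)) * (y i - x i)\<^sup>2" using assms by simp
    ultimately show ?thesis by linarith
  qed
  then have "sqnorm n (\<lambda>i. x i + g * (y i - x i)) \<le> (\<Sum>i<n. (1 - g) * (x i)\<^sup>2 + g * (y i)\<^sup>2)"
    unfolding sqnorm_def by (intro sum_mono)
  also have "\<dots> = (1 - g) * sqnorm n x + g * sqnorm n y"
    by (simp add: sqnorm_def sum.distrib sum_distrib_left)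
  also have "\<dots> \<le> (1 - g) * 1 + g * 1"
    using assms by (intro add_mono mult_left_mono) auto
  finally show ?thesis by simp
qed

subsection \<open>Extension over cells\<close>

locale cw_structure =
  fixes K :: "('k, 'm) c2_space_scheme" and sk :: "nat \<Rightarrow> 'k set"
    and \<C> :: "nat \<Rightarrow> (bit set \<times> (bit set \<times> (nat \<Rightarrow> real) \<Rightarrow> 'k)) set"
  assumes attach_0: "attaches_cells K {} (sk 0) 0 (\<C> 0)"
    and attach_Suc: "attaches_cells K (sk n) (sk (Suc n)) (Suc n) (\<C> (Suc n))"
    and topspace_K: "topspace (Top K) = (\<Union>n. sk n)"
    and closedin_K: "S \<subseteq> topspace (Top K) \<Longrightarrow>
      closedin (Top K) S \<longleftrightarrow> (\<forall>n. closedin (subtopology (Top K) (sk n)) (S \<inter> sk n))"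
begin

definition below :: "nat \<Rightarrow> 'k set" where "below n = (case n of 0 \<Rightarrow> {} | Suc m \<Rightarrow> sk m)"

abbreviation skel :: "nat \<Rightarrow> 'k topology" where "skel n \<equiv> subtopology (Top K) (sk n)"

lemma attach: "attaches_cells K (below n) (sk n) n (\<C> n)"
  using attach_0 attach_Suc by (cases n) (auto simp: below_def)

lemma sk_subset: "sk n \<subseteq> topspace (Top K)"
  using attach by (auto simp: attaches_cells_def)

lemma topspace_skel: "topspace (skel n) = sk n"
  using sk_subset by auto

lemma sk_mono: "m \<le> n \<Longrightarrow> sk m \<subseteq> sk n"
  by (rule lift_Suc_mono_le[of sk]) (use attach_Suc in \<open>auto simp: attaches_cells_def\<close>)

lemma sk_below: "m < n \<Longrightarrow> sk m \<subseteq> below n"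
  using sk_mono by (cases n) (auto simp: below_def)

lemma cell_cont: "(H, \<Phi>) \<in> \<C> n \<Longrightarrow> continuous_map (C2_cell H n) (skel n) \<Phi>"
  using attach[of n] by (auto simp: attaches_cells_def)

lemma cell_boundary: "(H, \<Phi>) \<in> \<C> n \<Longrightarrow> z \<in> C2_cell_boundary H n \<Longrightarrow> \<Phi> z \<in> below n"
  using attach[of n] by (fastforce simp: attaches_cells_def)

lemma cell_bij: "bij_betw (\<lambda>((H, \<Phi>), z). \<Phi> z)
    (SIGMA (H, \<Phi>):\<C> n. topspace (C2_cell H n) - C2_cell_boundary H n) (sk n - below n)"
  using attach[of n] by (auto simp: attaches_cells_def)

lemma cell_interior:
  assumes "(H, \<Phi>) \<in> \<C> n" "z \<in> topspace (C2_cell H n)" "z \<notin> C2_cell_boundary H n"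
  shows "\<Phi> z \<in> sk n - below n"
  using bij_betw_apply[OF cell_bij, of "((H, \<Phi>), z)" n] assms by auto

lemma interior_point:
  assumes "x \<in> sk n - below n"
  obtains H \<Phi> z where "(H, \<Phi>) \<in> \<C> n" "z \<in> topspace (C2_cell H n)" "z \<notin> C2_cell_boundary H n" "x = \<Phi> z"
proof -
  have "x \<in> (\<lambda>((H, \<Phi>), z). \<Phi> z) ` (SIGMA (H, \<Phi>):\<C> n. topspace (C2_cell H n) - C2_cell_boundary H n)"
    using assms cell_bij[of n] by (simp add: bij_betw_def)
  then show thesis using that by auto
qed

lemma closedin_skel:
  "S \<subseteq> sk n \<Longrightarrow> closedin (skel n) S \<longleftrightarrow>
     closedin (subtopology (Top K) (below n)) (S \<inter> below n) \<and>
     (\<forall>(H, \<Phi>)\<in>\<C> n. closedin (C2_cell H n) {z \<in> topspace (C2_cell H n). \<Phi> z \<in> S})"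
  using attach[of n] unfolding attaches_cells_def by blast

definition cells :: "nat set \<Rightarrow> (nat \<times> bit set \<times> (bit set \<times> (nat \<Rightarrow> real) \<Rightarrow> 'k)) set" where
  "cells M = (SIGMA m:M. \<C> m)"

abbreviation cell_top :: "nat \<times> bit set \<times> (bit set \<times> (nat \<Rightarrow> real) \<Rightarrow> 'k) \<Rightarrow> (bit set \<times> (nat \<Rightarrow> real)) topology" where
  "cell_top i \<equiv> C2_cell (fst (snd i)) (fst i)"

lemma cell_in_sk: "(H, \<Phi>) \<in> \<C> m \<Longrightarrow> z \<in> topspace (C2_cell H m) \<Longrightarrow> \<Phi> z \<in> sk m"
  using continuous_map_image_subset_topspace[OF cell_cont[of H \<Phi> m]] sk_subset by auto

lemma sk_eq_cells: "sk n = (\<Union>i\<in>cells {..n}. snd (snd i) ` topspace (cell_top i))"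
proof (intro subset_antisym subsetI)
  fix x assume "x \<in> sk n"
  define m where "m = (LEAST m. x \<in> sk m)"
  have m: "x \<in> sk m" "m \<le> n" "\<And>k. k < m \<Longrightarrow> x \<notin> sk k"
    using \<open>x \<in> sk n\<close> by (auto simp: m_def intro: LeastI Least_le dest: not_less_Least)
  then have "x \<in> sk m - below m" by (cases m) (auto simp: below_def)
  then obtain H \<Phi> z where "(H, \<Phi>) \<in> \<C> m" "z \<in> topspace (C2_cell H m)" "x = \<Phi> z"
    by (rule interior_point)
  then show "x \<in> (\<Union>i\<in>cells {..n}. snd (snd i) ` topspace (cell_top i))"
    using m(2) by (intro UN_I[of "(m, H, \<Phi>)"]) (auto simp: cells_def)
next
  fix x assume "x \<in> (\<Union>i\<in>cells {..n}. snd (snd i) ` topspace (cell_top i))"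
  then show "x \<in> sk n" using cell_in_sk sk_mono by (fastforce simp: cells_def)
qed

lemma cell_preimage_Int:
  "i \<in> cells {..n} \<Longrightarrow>
   {z \<in> topspace (cell_top i). snd (snd i) z \<in> S \<inter> sk n} = {z \<in> topspace (cell_top i). snd (snd i) z \<in> S}"
  using sk_eq_cells[of n] by auto

lemma closedin_skel_cells:
  "S \<subseteq> sk n \<Longrightarrow> closedin (skel n) S \<longleftrightarrow>
     (\<forall>i\<in>cells {..n}. closedin (cell_top i) {z \<in> topspace (cell_top i). snd (snd i) z \<in> S})"
proof (induction n arbitrary: S)
  case 0
  then show ?case
    by (subst closedin_skel) (auto simp: below_def cells_def)
next
  case (Suc n)
  have "closedin (skel n) (S \<inter> sk n) \<longleftrightarrow>
     (\<forall>i\<in>cells {..n}. closedin (cell_top i) {z \<in> topspace (cell_top i). snd (snd i) z \<in> S \<inter> sk n})"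
    by (rule Suc.IH) simp
  also have "\<dots> \<longleftrightarrow> (\<forall>i\<in>cells {..n}. closedin (cell_top i) {z \<in> topspace (cell_top i). snd (snd i) z \<in> S})"
    by (rule ball_cong[OF refl]) (simp only: cell_preimage_Int)
  finally show ?case
    using Suc.prems by (subst closedin_skel) (auto simp: below_def cells_def atMost_Suc)
qed

lemma generated_skel: "generated_by (skel n) (cells {..n}) cell_top (\<lambda>i. snd (snd i))"
  unfolding generated_by_def topspace_skel using sk_eq_cells closedin_skel_cells by blast

lemma generated_K: "generated_by (Top K) (cells UNIV) cell_top (\<lambda>i. snd (snd i))"
  unfolding generated_by_def
proof (intro conjI allI impI)
  have "cells UNIV = (\<Union>n. cells {..n})" by (auto simp: cells_def)
  then show "topspace (Top K) = (\<Union>i\<in>cells UNIV. snd (snd i) ` topspace (cell_top i))"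
    unfolding topspace_K sk_eq_cells by auto
  fix S assume S: "S \<subseteq> topspace (Top K)"
  have "closedin (skel n) (S \<inter> sk n) \<longleftrightarrow>
     (\<forall>i\<in>cells {..n}. closedin (cell_top i) {z \<in> topspace (cell_top i). snd (snd i) z \<in> S})" for n
    by (subst closedin_skel_cells) (auto simp only: cell_preimage_Int inf_le2)
  then show "closedin (Top K) S \<longleftrightarrow>
      (\<forall>i\<in>cells UNIV. closedin (cell_top i) {z \<in> topspace (cell_top i). snd (snd i) z \<in> S})"
    unfolding closedin_K[OF S] \<open>cells UNIV = _\<close> by blast
qed

text \<open>The universal property of the pushout, for homotopies: the interior of the cells and the skeleton
  below are disjoint, and continuity of the combined map is tested on all cells up to dimension \<open>n\<close>.\<close>

lemma extend_over_cells:
  assumes F0: "continuous_map (prod_topology unit_interval (subtopology (Top K) (below n))) T F0"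
    and G: "\<And>H \<Phi>. (H, \<Phi>) \<in> \<C> n \<Longrightarrow> continuous_map (prod_topology unit_interval (C2_cell H n)) T (G H \<Phi>)"
    and GF: "\<And>H \<Phi> t z. \<lbrakk>(H, \<Phi>) \<in> \<C> n; t \<in> {0..1}; z \<in> C2_cell_boundary H n\<rbrakk> \<Longrightarrow> G H \<Phi> (t, z) = F0 (t, \<Phi> z)"
  obtains F where "continuous_map (prod_topology unit_interval (skel n)) T F"
    "\<And>t x. x \<in> below n \<Longrightarrow> F (t, x) = F0 (t, x)"
    "\<And>H \<Phi> t z. \<lbrakk>(H, \<Phi>) \<in> \<C> n; t \<in> {0..1}; z \<in> topspace (C2_cell H n)\<rbrakk> \<Longrightarrow> F (t, \<Phi> z) = G H \<Phi> (t, z)"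
proof -
  let ?Int = "SIGMA (H, \<Phi>):\<C> n. topspace (C2_cell H n) - C2_cell_boundary H n"
  let ?j = "\<lambda>((H, \<Phi>), z). \<Phi> z :: 'k"
  define F where "F = (\<lambda>(t, x). if x \<in> below n then F0 (t, x)
     else case inv_into ?Int ?j x of ((H, \<Phi>), z) \<Rightarrow> G H \<Phi> (t, z))"
  have F_below: "F (t, x) = F0 (t, x)" if "x \<in> below n" for t x using that by (simp add: F_def)
  have F_cell: "F (t, \<Phi> z) = G H \<Phi> (t, z)"
    if c: "(H, \<Phi>) \<in> \<C> n" and t: "t \<in> {0..1}" and z: "z \<in> topspace (C2_cell H n)" for H \<Phi> t z
  proof (cases "z \<in> C2_cell_boundary H n")
    case True
    then show ?thesis using F_below cell_boundary[OF c True] GF[OF c t True] by simp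
  next
    case False
    have "inv_into ?Int ?j (?j ((H, \<Phi>), z)) = ((H, \<Phi>), z)"
      by (rule inv_into_f_f) (use bij_betw_imp_inj_on[OF cell_bij] c z False in auto)
    then show ?thesis using cell_interior[OF c z False] by (simp add: F_def)
  qed
  have "continuous_map (prod_topology unit_interval (skel n)) T F"
  proof (rule continuous_map_generated_by[OF generated_skel])
    fix i assume "i \<in> cells {..n}"
    then obtain m H \<Phi> where i: "i = (m, H, \<Phi>)" "m \<le> n" "(H, \<Phi>) \<in> \<C> m" by (auto simp: cells_def)
    show "continuous_map (prod_topology unit_interval (cell_top i)) T (\<lambda>s. F (fst s, snd (snd i) (snd s)))"
    proof (cases "m = n")
      case True
      have "continuous_map (prod_topology unit_interval (C2_cell H n)) T (\<lambda>s. F (fst s, \<Phi> (snd s)))"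
        by (rule continuous_map_eq[OF G]) (use i True F_cell in auto)
      then show ?thesis using i True by simp
    next
      case False
      then have sub: "sk m \<subseteq> below n" using i sk_below by simp
      have "continuous_map (C2_cell H m) (subtopology (Top K) (below n)) \<Phi>"
        using cell_cont[OF i(3)] sub by (auto simp: continuous_map_in_subtopology)
      then have "continuous_map (prod_topology unit_interval (C2_cell H m)) T (\<lambda>s. F0 (fst s, \<Phi> (snd s)))"
        by (intro continuous_map_compose2[OF F0] continuous_map_fst continuous_map_compose1[OF _ continuous_map_snd])
      then have "continuous_map (prod_topology unit_interval (C2_cell H m)) T (\<lambda>s. F (fst s, \<Phi> (snd s)))"
        by (rule continuous_map_eq) (use subsetD[OF sub cell_in_sk[OF i(3)]] F_below in auto)
      then show ?thesis using i by simp
    qed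
  qed
  then show thesis using that F_below F_cell by blast
qed

text \<open>\<open>contracts p n (\<phi>, h)\<close>: during the deformation \<open>h\<close> of the \<open>n\<close>-skeleton in \<open>K\<close>, a point \<open>x\<close> has
  arrived at \<open>p\<close> at every time after \<open>\<phi> x\<close>.\<close>

definition contracts :: "'k \<Rightarrow> nat \<Rightarrow> ('k \<Rightarrow> real) \<times> (real \<times> 'k \<Rightarrow> 'k) \<Rightarrow> bool" where
  "contracts p n = (\<lambda>(\<phi>, h).
     continuous_map (skel n) unit_interval \<phi> \<and> continuous_map (prod_topology unit_interval (skel n)) (Top K) h \<and>
     p \<in> sk n \<and> \<phi> p = 1/2 \<and> (\<forall>x\<in>sk n. h (0, x) = x) \<and> (\<forall>t\<in>{0..1}. h (t, p) = p) \<and>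
     (\<forall>x\<in>sk n. \<forall>t\<in>{0..1}. \<phi> x < t \<longrightarrow> h (t, x) = p))"

text \<open>Inside the open cell through \<open>p\<close>, with \<open>p\<close> corresponding to \<open>z0\<close>, the disk is contracted linearly
  to \<open>z0\<close>. The gauge \<open>d\<close> is \<open>0\<close> at \<open>z0\<close> and \<open>2\<close> on the boundary sphere; the factor \<open>g\<close> by which
  the displacement from \<open>z0\<close> is scaled is \<open>0\<close> as soon as \<open>2 * s \<ge> 1 + d\<close>, and it stays \<open>1\<close> on the boundary, so the deformation
  fixes everything outside the cell.\<close>

lemma contracts_start:
  assumes p: "p \<in> sk n - below n"
  shows "\<exists>s. contracts p n s"
proof -
  obtain H0 \<Phi>0 q where c0: "(H0, \<Phi>0) \<in> \<C> n" "q \<in> topspace (C2_cell H0 n)" "q \<notin> C2_cell_boundary H0 n" "p = \<Phi>0 q"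
    using interior_point[OF p] by metis
  define z0 where "z0 = snd q"
  define \<rho> where "\<rho> = 1 - sqnorm n z0"
  have z0: "\<And>i. i \<ge> n \<Longrightarrow> z0 i = 0" "sqnorm n z0 \<le> 1"
    using c0(2) by (auto simp: z0_def topspace_C2_cell topspace_unit_disk sqnorm_def)
  have "sqnorm n z0 \<noteq> 1" using c0(2,3) by (auto simp: C2_cell_boundary_def z0_def sqnorm_def)
  then have \<rho>: "\<rho> > 0" using z0 by (simp add: \<rho>_def)
  define d where "d z = 2 * max 0 ((sqnorm n z - sqnorm n z0) / \<rho>)" for z
  define sel :: "bit set \<Rightarrow> (bit set \<times> (nat \<Rightarrow> real) \<Rightarrow> 'k) \<Rightarrow> bit set \<Rightarrow> real"
    where "sel H \<Phi> c = (if H = H0 \<and> \<Phi> = \<Phi>0 \<and> c = fst q then 1 else 0)" for H \<Phi> c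
  define g where "g H \<Phi> s z = clamp01 (1 - 2 * s * sel H \<Phi> (fst z) + d (snd z))" for H \<Phi> s z
  define P where "P H \<Phi> s z = (fst z, \<lambda>i. z0 i + g H \<Phi> s z * (snd z i - z0 i))" for H \<Phi> s z
  define G\<phi> where "G\<phi> H \<Phi> = (\<lambda>(s::real, z). min 1 (1/2 + d (snd z) / 2 + (1 - sel H \<Phi> (fst z))))" for H \<Phi>
  define Gh where "Gh H \<Phi> = (\<lambda>(s, z). \<Phi> (P H \<Phi> s z))" for H \<Phi>
  have d: "d z \<ge> 0" for z by (simp add: d_def)
  have d_boundary: "d (snd z) = 2" if "z \<in> C2_cell_boundary H n" for H z
  proof -
    have "sqnorm n (snd z) = 1" using that by (simp add: C2_cell_boundary_def sqnorm_def)
    then have "sqnorm n (snd z) - sqnorm n z0 = \<rho>" by (simp add: \<rho>_def)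
    then show ?thesis using \<rho> by (simp add: d_def)
  qed
  have dq: "d (snd q) = 0" by (simp add: d_def z0_def)
  let ?C = "\<lambda>H. prod_topology unit_interval (C2_cell H n)"
  have sc: "continuous_map (?C H) euclideanreal fst" for H
    by (rule continuous_map_into_fulltopology[OF continuous_map_fst])
  have zc: "continuous_map (?C H) euclideanreal (\<lambda>s. snd (snd s) i)" for H i
    by (rule continuous_map_compose1[OF C2_cell_projections(2) continuous_map_snd])
  have cc: "continuous_map (?C H) (discrete_topology (C2_orbit H)) (\<lambda>s. fst (snd s))" for H
    by (rule continuous_map_compose1[OF C2_cell_projections(1) continuous_map_snd])
  have selc: "continuous_map (?C H) euclideanreal (\<lambda>s. sel H \<Phi> (fst (snd s)))" for H \<Phi>
    by (rule continuous_map_compose1[OF _ cc]) auto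
  have dc: "continuous_map (?C H) euclideanreal (\<lambda>s. d (snd (snd s)))" for H
    unfolding d_def sqnorm_def using \<rho> by (intro continuous_intros zc) auto
  have P_in: "P H \<Phi> s z \<in> topspace (C2_cell H n)" if "z \<in> topspace (C2_cell H n)" for H \<Phi> s z
  proof -
    have "sqnorm n (\<lambda>i. z0 i + g H \<Phi> s z * (snd z i - z0 i)) \<le> 1"
      using that z0 by (intro sqnorm_convex) (auto simp: g_def clamp01_range topspace_C2_cell topspace_unit_disk sqnorm_def)
    then show ?thesis using that z0(1) by (auto simp: P_def topspace_C2_cell topspace_unit_disk sqnorm_def)
  qed
  have Pc: "continuous_map (?C H) (C2_cell H n) (\<lambda>s. P H \<Phi> (fst s) (snd s))" for H \<Phi>
    unfolding P_def
  proof (intro continuous_map_C2_cellI cc continuous_map_unit_diskI)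
    show "continuous_map (?C H) euclideanreal (\<lambda>s. z0 i + g H \<Phi> (fst s) (snd s) * (snd (snd s) i - z0 i))" for i
      unfolding g_def by (intro continuous_intros sc zc selc dc)
    show "(\<lambda>i. z0 i + g H \<Phi> (fst s) (snd s) * (snd (snd s) i - z0 i)) \<in> topspace (unit_disk n)"
      if "s \<in> topspace (?C H)" for s
      using P_in[of "snd s" H \<Phi> "fst s"] that by (auto simp: P_def topspace_C2_cell)
  qed
  have g1: "g H \<Phi> s z = 1" if "s \<in> {0..1}" "d (snd z) = 2 \<or> sel H \<Phi> (fst z) = 0 \<or> s = 0" for H \<Phi> s z
    using that d[of "snd z"] by (auto simp: g_def clamp01_def sel_def)
  have P1: "P H \<Phi> s z = z" if "g H \<Phi> s z = 1" for H \<Phi> s z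
    using that by (simp add: P_def)
  obtain f where f: "continuous_map (prod_topology unit_interval (skel n)) unit_interval f"
    "\<And>H \<Phi> t z. \<lbrakk>(H, \<Phi>) \<in> \<C> n; t \<in> {0..1}; z \<in> topspace (C2_cell H n)\<rbrakk> \<Longrightarrow> f (t, \<Phi> z) = G\<phi> H \<Phi> (t, z)"
    "\<And>t x. x \<in> below n \<Longrightarrow> f (t, x) = 1"
  proof (rule extend_over_cells[where n = n and T = unit_interval and ?F0.0 = "\<lambda>_. 1" and G = G\<phi>])
    show "continuous_map (?C H) unit_interval (G\<phi> H \<Phi>)" for H \<Phi>
      unfolding G\<phi>_def case_prod_unfold
      by (intro continuous_map_into_Icc continuous_intros selc dc) (use d in \<open>auto simp: sel_def\<close>)
    show "G\<phi> H \<Phi> (t, z) = 1" if "z \<in> C2_cell_boundary H n" for H \<Phi> t z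
      using d_boundary[OF that] by (simp add: G\<phi>_def sel_def)
  qed auto
  obtain h where h: "continuous_map (prod_topology unit_interval (skel n)) (Top K) h"
    "\<And>H \<Phi> t z. \<lbrakk>(H, \<Phi>) \<in> \<C> n; t \<in> {0..1}; z \<in> topspace (C2_cell H n)\<rbrakk> \<Longrightarrow> h (t, \<Phi> z) = Gh H \<Phi> (t, z)"
    "\<And>t x. x \<in> below n \<Longrightarrow> h (t, x) = x"
  proof (rule extend_over_cells[where n = n and T = "Top K" and ?F0.0 = snd and G = Gh])
    show "continuous_map (prod_topology unit_interval (subtopology (Top K) (below n))) (Top K) snd"
      by (rule continuous_map_into_fulltopology[OF continuous_map_snd])
    show "continuous_map (?C H) (Top K) (Gh H \<Phi>)" if "(H, \<Phi>) \<in> \<C> n" for H \<Phi>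
      unfolding Gh_def case_prod_unfold
      by (rule continuous_map_compose1[OF continuous_map_into_fulltopology[OF cell_cont[OF that]] Pc])
    show "Gh H \<Phi> (t, z) = snd (t, \<Phi> z)" if "t \<in> {0..1}" "z \<in> C2_cell_boundary H n" for H \<Phi> t z
      using d_boundary[OF that(2)] that(1) by (simp add: Gh_def P1 g1)
  qed auto
  have "contracts p n (\<lambda>x. f (0, x), h)"
    unfolding contracts_def prod.case
  proof (intro conjI ballI impI)
    show "continuous_map (skel n) unit_interval (\<lambda>x. f (0, x))"
      by (intro continuous_map_compose2[OF f(1)]) auto
    show "continuous_map (prod_topology unit_interval (skel n)) (Top K) h" by (rule h)
    show "p \<in> sk n" using p by simp
    have selq: "sel H0 \<Phi>0 (fst q) = 1" by (simp add: sel_def)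
    show "f (0, p) = 1/2"
      using f(2)[OF c0(1) _ c0(2), of 0] by (simp add: G\<phi>_def dq selq c0(4))
    show "h (t, p) = p" if "t \<in> {0..1}" for t
    proof -
      have "P H0 \<Phi>0 t q = q" by (simp add: P_def z0_def)
      then show ?thesis using h(2)[OF c0(1) that c0(2)] by (simp add: Gh_def c0(4))
    qed
    fix x assume x: "x \<in> sk n"
    show "h (0, x) = x"
    proof (cases "x \<in> below n")
      case False
      then obtain H \<Phi> z where "(H, \<Phi>) \<in> \<C> n" "z \<in> topspace (C2_cell H n)" "x = \<Phi> z"
        using interior_point x by blast
      then show ?thesis using h(2)[of H \<Phi> 0 z] by (simp add: Gh_def P1 g1)
    qed (rule h(3))
    show "h (t, x) = p" if t: "t \<in> {0..1}" and less: "f (0, x) < t" for t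
    proof -
      have "x \<notin> below n" using f(3) less t by fastforce
      then obtain H \<Phi> z where x: "(H, \<Phi>) \<in> \<C> n" "z \<in> topspace (C2_cell H n)" "x = \<Phi> z"
        using interior_point x by blast
      have l: "min 1 (1/2 + d (snd z) / 2 + (1 - sel H \<Phi> (fst z))) < t"
        using less f(2)[OF x(1) _ x(2), of 0] by (simp add: G\<phi>_def x(3))
      then have "sel H \<Phi> (fst z) \<noteq> 0" using t d[of "snd z"] by (auto simp: min_less_iff_disj)
      then have H: "H = H0" "\<Phi> = \<Phi>0" "fst z = fst q" by (auto simp: sel_def split: if_splits)
      then have "1/2 + d (snd z) / 2 < t" using l t by (auto simp: sel_def min_less_iff_disj)
      then have "g H \<Phi> t z = 0" using H by (simp add: g_def sel_def clamp01_def)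
      then have "P H \<Phi> t z = q" using H by (simp add: P_def z0_def prod_eq_iff)
      then show ?thesis using h(2)[OF x(1) t x(2)] H by (simp add: Gh_def x(3) c0(4))
    qed
  qed
  then show ?thesis by blast
qed

text \<open>Extension over one more skeleton, by the retraction of \<open>I \<times> D\<close> onto \<open>0 \<times> D \<union> I \<times> \<partial>D\<close> that projects
  radially: a point at distance \<open>\<nu>\<close> from the centre first moves out along its ray; it reaches the
  boundary at the time \<open>t\<close> with \<open>\<nu> * (1 + t) = 1\<close> and from then on follows the given deformation \<open>h\<close> with
  the clock \<open>\<nu> * (1 + t) - 1\<close>. Solving for the arrival at \<open>p\<close> gives the new \<open>\<phi>\<close>. On the boundary, where
  \<open>\<nu> = 1\<close>, nothing changes; so the infinitely many extensions have a limit.\<close>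

lemma contracts_step:
  assumes "contracts p m (\<phi>, h)"
  shows "\<exists>\<phi>' h'. contracts p (Suc m) (\<phi>', h') \<and> (\<forall>x\<in>sk m. \<phi>' x = \<phi> x \<and> (\<forall>t. h' (t, x) = h (t, x)))"
proof -
  let ?n = "Suc m"
  have \<phi>c: "continuous_map (skel m) unit_interval \<phi>" and hc: "continuous_map (prod_topology unit_interval (skel m)) (Top K) h"
    and p: "p \<in> sk m" "\<phi> p = 1/2" and h0: "\<And>x. x \<in> sk m \<Longrightarrow> h (0, x) = x" and hp: "\<And>t. t \<in> {0..1} \<Longrightarrow> h (t, p) = p"
    and arrive: "\<And>x t. x \<in> sk m \<Longrightarrow> t \<in> {0..1} \<Longrightarrow> \<phi> x < t \<Longrightarrow> h (t, x) = p"
    using assms by (auto simp: contracts_def)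
  have below: "below ?n = sk m" by (simp add: below_def)
  have \<phi>01: "0 \<le> \<phi> x \<and> \<phi> x \<le> 1" if "x \<in> sk m" for x
    using continuous_map_image_subset_topspace[OF \<phi>c] that unfolding topspace_skel by (auto simp: image_subset_iff)
  define \<nu> where "\<nu> z = sqrt (sqnorm ?n (snd z))" for z :: "bit set \<times> (nat \<Rightarrow> real)"
  define R :: "bit set \<times> (nat \<Rightarrow> real) \<Rightarrow> bit set \<times> (nat \<Rightarrow> real)"
    where "R z = (fst z, \<lambda>i. snd z i / \<nu> z)" for z
  define G\<phi> :: "bit set \<Rightarrow> (bit set \<times> (nat \<Rightarrow> real) \<Rightarrow> 'k) \<Rightarrow> real \<times> bit set \<times> (nat \<Rightarrow> real) \<Rightarrow> real"
    where "G\<phi> H \<Phi> = (\<lambda>s. if \<nu> (snd s) \<le> 1/2 then 1 else min 1 ((1 + \<phi> (\<Phi> (R (snd s)))) / \<nu> (snd s) - 1))" for H \<Phi>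
  define Gh :: "bit set \<Rightarrow> (bit set \<times> (nat \<Rightarrow> real) \<Rightarrow> 'k) \<Rightarrow> real \<times> bit set \<times> (nat \<Rightarrow> real) \<Rightarrow> 'k"
    where "Gh H \<Phi> = (\<lambda>s. if \<nu> (snd s) * (1 + fst s) \<le> 1 then \<Phi> (fst (snd s), \<lambda>i. (1 + fst s) * snd (snd s) i)
      else h (\<nu> (snd s) * (1 + fst s) - 1, \<Phi> (R (snd s))))" for H \<Phi>
  let ?C = "\<lambda>H. prod_topology unit_interval (C2_cell H ?n)"
  have sc: "continuous_map (?C H) euclideanreal fst" for H
    by (rule continuous_map_into_fulltopology[OF continuous_map_fst])
  have zc: "continuous_map (?C H) euclideanreal (\<lambda>s. snd (snd s) i)" for H i
    by (rule continuous_map_compose1[OF C2_cell_projections(2) continuous_map_snd])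
  have cc: "continuous_map (?C H) (discrete_topology (C2_orbit H)) (\<lambda>s. fst (snd s))" for H
    by (rule continuous_map_compose1[OF C2_cell_projections(1) continuous_map_snd])
  have \<nu>c: "continuous_map (?C H) euclideanreal (\<lambda>s. \<nu> (snd s))" for H
    unfolding \<nu>_def sqnorm_def by (intro continuous_intros zc) auto
  have \<nu>: "0 \<le> \<nu> z" "(\<nu> z)\<^sup>2 = sqnorm ?n (snd z)" for z
    by (auto simp: \<nu>_def sqnorm_nonneg)
  have \<nu>1: "\<nu> z \<le> 1" if "z \<in> topspace (C2_cell H ?n)" for H z
    using that by (auto simp: \<nu>_def topspace_C2_cell topspace_unit_disk sqnorm_def simp del: sum.lessThan_Suc)
  have R_boundary: "R z \<in> C2_cell_boundary H ?n" if "z \<in> topspace (C2_cell H ?n)" "\<nu> z > 0" for H z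
  proof -
    have "sqnorm ?n (snd (R z)) = (1 / \<nu> z)\<^sup>2 * sqnorm ?n (snd z)"
      using sqnorm_scale[of ?n "1 / \<nu> z" "snd z"] by (simp add: R_def)
    also have "\<dots> = 1" using that \<nu>(2)[of z, symmetric] by (simp add: power_divide)
    finally show ?thesis using that
      by (auto simp: C2_cell_boundary_def topspace_C2_cell topspace_unit_disk R_def sqnorm_def simp del: sum.lessThan_Suc)
  qed
  have \<Phi>R: "\<Phi> (R z) \<in> sk m" if "(H, \<Phi>) \<in> \<C> ?n" "z \<in> topspace (C2_cell H ?n)" "\<nu> z > 0" for H \<Phi> z
    using cell_boundary[OF that(1) R_boundary[OF that(2,3)]] below by simp
  have \<Phi>Rc: "continuous_map (subtopology (?C H) S) (skel m) (\<lambda>s. \<Phi> (R (snd s)))"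
    if c: "(H, \<Phi>) \<in> \<C> ?n" and S: "\<And>s. s \<in> S \<Longrightarrow> s \<in> topspace (?C H) \<Longrightarrow> \<nu> (snd s) > 0" for H \<Phi> S
  proof -
    have "continuous_map (subtopology (?C H) S) (C2_cell H ?n) (\<lambda>s. R (snd s))"
      unfolding R_def
    proof (intro continuous_map_C2_cellI continuous_map_from_subtopology[OF cc] continuous_map_unit_diskI)
      show "continuous_map (subtopology (?C H) S) euclideanreal (\<lambda>s. snd (snd s) i / \<nu> (snd s))" for i
        by (intro continuous_intros continuous_map_from_subtopology[OF zc] continuous_map_from_subtopology[OF \<nu>c])
          (use S in force)
      show "(\<lambda>i. snd (snd s) i / \<nu> (snd s)) \<in> topspace (unit_disk ?n)" if "s \<in> topspace (subtopology (?C H) S)" for s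
      proof -
        have "R (snd s) \<in> topspace (C2_cell H ?n)"
          using R_boundary[of "snd s" H] S[of s] that by (auto simp: C2_cell_boundary_def)
        then show ?thesis by (simp add: R_def topspace_C2_cell)
      qed
    qed
    then have "continuous_map (subtopology (?C H) S) (Top K) (\<lambda>s. \<Phi> (R (snd s)))"
      by (rule continuous_map_compose1[OF continuous_map_into_fulltopology[OF cell_cont[OF c]]])
    then show ?thesis
      using \<Phi>R[OF c] S by (fastforce simp: continuous_map_in_subtopology)
  qed
  have \<nu>_boundary: "\<nu> z = 1" "R z = z" if "z \<in> C2_cell_boundary H ?n" for H z
  proof -
    show "\<nu> z = 1" using that by (simp add: C2_cell_boundary_def \<nu>_def sqnorm_def del: sum.lessThan_Suc)
    then show "R z = z" by (simp add: R_def)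
  qed
  obtain f where f: "continuous_map (prod_topology unit_interval (skel ?n)) unit_interval f"
    "\<And>t x. x \<in> below ?n \<Longrightarrow> f (t, x) = \<phi> x"
    "\<And>H \<Phi> t z. \<lbrakk>(H, \<Phi>) \<in> \<C> ?n; t \<in> {0..1}; z \<in> topspace (C2_cell H ?n)\<rbrakk> \<Longrightarrow> f (t, \<Phi> z) = G\<phi> H \<Phi> (t, z)"
  proof (rule extend_over_cells[where n = ?n and T = unit_interval and ?F0.0 = "\<lambda>s. \<phi> (snd s)" and G = G\<phi>])
    show "continuous_map (prod_topology unit_interval (subtopology (Top K) (below ?n))) unit_interval (\<lambda>s. \<phi> (snd s))"
      unfolding below by (rule continuous_map_compose1[OF \<phi>c continuous_map_snd])
    show "continuous_map (?C H) unit_interval (G\<phi> H \<Phi>)" if c: "(H, \<Phi>) \<in> \<C> ?n" for H \<Phi>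
    proof (rule continuous_map_into_Icc)
      show "continuous_map (?C H) euclideanreal (G\<phi> H \<Phi>)"
        unfolding G\<phi>_def
      proof (rule continuous_map_cases_le)
        let ?S = "{s \<in> topspace (?C H). 1/2 \<le> \<nu> (snd s)}"
        have "continuous_map (subtopology (?C H) ?S) euclideanreal (\<lambda>s. \<phi> (\<Phi> (R (snd s))))"
          by (rule continuous_map_compose1[OF continuous_map_into_fulltopology[OF \<phi>c] \<Phi>Rc[OF c]]) auto
        then show "continuous_map (subtopology (?C H) ?S) euclideanreal (\<lambda>s. min 1 ((1 + \<phi> (\<Phi> (R (snd s)))) / \<nu> (snd s) - 1))"
          by (intro continuous_intros continuous_map_from_subtopology[OF \<nu>c]) auto
        show "1 = min 1 ((1 + \<phi> (\<Phi> (R (snd s)))) / \<nu> (snd s) - 1)" if "s \<in> topspace (?C H)" "\<nu> (snd s) = 1/2" for s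
        proof -
          have "snd s \<in> topspace (C2_cell H ?n)" using that(1) by auto
          then have "0 \<le> \<phi> (\<Phi> (R (snd s)))" using \<phi>01[OF \<Phi>R[OF c, of "snd s"]] that(2) by simp
          then show ?thesis unfolding that(2) by simp
        qed
      qed (use \<nu>c in auto)
      show "0 \<le> G\<phi> H \<Phi> s \<and> G\<phi> H \<Phi> s \<le> 1" if "s \<in> topspace (?C H)" for s
      proof (cases "\<nu> (snd s) \<le> 1/2")
        case False
        then have "0 \<le> \<phi> (\<Phi> (R (snd s)))" using \<phi>01[OF \<Phi>R[OF c, of "snd s"]] that by auto
        moreover have "\<nu> (snd s) \<le> 1" using \<nu>1[of "snd s" H] that by auto
        ultimately show ?thesis using False by (simp add: G\<phi>_def field_simps)
      qed (simp add: G\<phi>_def)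
    qed
    show "G\<phi> H \<Phi> (t, z) = \<phi> (snd (t, \<Phi> z))" if "(H, \<Phi>) \<in> \<C> ?n" "z \<in> C2_cell_boundary H ?n" for H \<Phi> t z
      using \<nu>_boundary[OF that(2)] \<phi>01[of "\<Phi> z"] cell_boundary[OF that] below by (simp add: G\<phi>_def)
  qed auto
  obtain h' where h': "continuous_map (prod_topology unit_interval (skel ?n)) (Top K) h'"
    "\<And>t x. x \<in> below ?n \<Longrightarrow> h' (t, x) = h (t, x)"
    "\<And>H \<Phi> t z. \<lbrakk>(H, \<Phi>) \<in> \<C> ?n; t \<in> {0..1}; z \<in> topspace (C2_cell H ?n)\<rbrakk> \<Longrightarrow> h' (t, \<Phi> z) = Gh H \<Phi> (t, z)"
  proof (rule extend_over_cells[where n = ?n and T = "Top K" and ?F0.0 = h and G = Gh])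
    show "continuous_map (prod_topology unit_interval (subtopology (Top K) (below ?n))) (Top K) h"
      unfolding below by (rule hc)
    show "continuous_map (?C H) (Top K) (Gh H \<Phi>)" if c: "(H, \<Phi>) \<in> \<C> ?n" for H \<Phi>
      unfolding Gh_def
    proof (rule continuous_map_cases_le)
      show "continuous_map (?C H) euclideanreal (\<lambda>s. \<nu> (snd s) * (1 + fst s))"
        by (intro continuous_intros \<nu>c sc)
      let ?S = "{s \<in> topspace (?C H). \<nu> (snd s) * (1 + fst s) \<le> 1}"
      let ?T = "{s \<in> topspace (?C H). 1 \<le> \<nu> (snd s) * (1 + fst s)}"
      have "continuous_map (subtopology (?C H) ?S) (C2_cell H ?n) (\<lambda>s. (fst (snd s), \<lambda>i. (1 + fst s) * snd (snd s) i))"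
      proof (intro continuous_map_C2_cellI continuous_map_from_subtopology[OF cc] continuous_map_unit_diskI)
        show "continuous_map (subtopology (?C H) ?S) euclideanreal (\<lambda>s. (1 + fst s) * snd (snd s) i)" for i
          by (intro continuous_intros continuous_map_from_subtopology[OF zc] continuous_map_from_subtopology[OF sc])
        show "(\<lambda>i. (1 + fst s) * snd (snd s) i) \<in> topspace (unit_disk ?n)" if s: "s \<in> topspace (subtopology (?C H) ?S)" for s
        proof -
          have "(\<nu> (snd s) * (1 + fst s))\<^sup>2 \<le> 1" using s \<nu>(1)[of "snd s"] by (intro power_le_one) auto
          then have "sqnorm ?n (\<lambda>i. (1 + fst s) * snd (snd s) i) \<le> 1"
            unfolding sqnorm_scale power_mult_distrib \<nu>(2) by (simp add: mult.commute)
          then show ?thesis using s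
            by (auto simp: topspace_unit_disk topspace_C2_cell sqnorm_def simp del: sum.lessThan_Suc)
        qed
      qed
      then show "continuous_map (subtopology (?C H) ?S) (Top K) (\<lambda>s. \<Phi> (fst (snd s), \<lambda>i. (1 + fst s) * snd (snd s) i))"
        by (rule continuous_map_compose1[OF continuous_map_into_fulltopology[OF cell_cont[OF c]]])
      have pos: "\<nu> (snd s) > 0" if "s \<in> ?T" for s
        using that \<nu>(1)[of "snd s"] by (cases "\<nu> (snd s) = 0") auto
      have "\<nu> (snd s) * (1 + fst s) \<le> 2" if "s \<in> topspace (?C H)" for s
      proof -
        have "\<nu> (snd s) * (1 + fst s) \<le> 1 * 2"
          using that \<nu>1[of "snd s" H] by (intro mult_mono) auto
        then show ?thesis by simp
      qed
      then show "continuous_map (subtopology (?C H) ?T) (Top K) (\<lambda>s. h (\<nu> (snd s) * (1 + fst s) - 1, \<Phi> (R (snd s))))"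
        by (intro continuous_map_compose2[OF hc] \<Phi>Rc[OF c] continuous_map_into_Icc continuous_intros
            continuous_map_from_subtopology[OF sc] continuous_map_from_subtopology[OF \<nu>c]) (use pos in auto)
      show "\<Phi> (fst (snd s), \<lambda>i. (1 + fst s) * snd (snd s) i) = h (\<nu> (snd s) * (1 + fst s) - 1, \<Phi> (R (snd s)))"
        if s: "s \<in> topspace (?C H)" and eq: "\<nu> (snd s) * (1 + fst s) = 1" for s
      proof -
        have ne: "\<nu> (snd s) > 0" using pos s eq by simp
        then have "1 + fst s = 1 / \<nu> (snd s)" using eq by (simp add: field_simps)
        then have "(fst (snd s), \<lambda>i. (1 + fst s) * snd (snd s) i) = R (snd s)" by (simp add: R_def)
        then show ?thesis using h0[OF \<Phi>R[OF c _ ne]] s eq by auto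
      qed
    qed auto
    show "Gh H \<Phi> (t, z) = h (t, \<Phi> z)" if "(H, \<Phi>) \<in> \<C> ?n" "t \<in> {0..1}" "z \<in> C2_cell_boundary H ?n" for H \<Phi> t z
    proof -
      have "\<Phi> z \<in> sk m" using cell_boundary[OF that(1,3)] below by simp
      then show ?thesis using \<nu>_boundary[OF that(3)] that(2) h0 by (auto simp: Gh_def)
    qed
  qed auto
  have "contracts p ?n (\<lambda>x. f (0, x), h')"
    unfolding contracts_def prod.case
  proof (intro conjI ballI impI)
    show "continuous_map (skel ?n) unit_interval (\<lambda>x. f (0, x))"
      by (intro continuous_map_compose2[OF f(1)]) auto
    show "continuous_map (prod_topology unit_interval (skel ?n)) (Top K) h'" by (rule h')
    show "p \<in> sk ?n" using p sk_mono[of m ?n] by auto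
    show "f (0, p) = 1/2" using f(2) p below by simp
    show "h' (t, p) = p" if "t \<in> {0..1}" for t using h'(2) p below hp that by simp
    fix x assume x: "x \<in> sk ?n"
    show "h' (0, x) = x"
    proof (cases "x \<in> below ?n")
      case True then show ?thesis using h'(2) h0 below by simp
    next
      case False
      then obtain H \<Phi> z where x: "(H, \<Phi>) \<in> \<C> ?n" "z \<in> topspace (C2_cell H ?n)" "x = \<Phi> z"
        using interior_point x by blast
      then show ?thesis using h'(3)[of H \<Phi> 0 z] \<nu>1[OF x(2)] by (simp add: Gh_def)
    qed
    show "h' (t, x) = p" if t: "t \<in> {0..1}" and less: "f (0, x) < t" for t
    proof (cases "x \<in> below ?n")
      case True then show ?thesis using h'(2) f(2) less arrive t below by simp
    next
      case False
      then obtain H \<Phi> z where x: "(H, \<Phi>) \<in> \<C> ?n" "z \<in> topspace (C2_cell H ?n)" "x = \<Phi> z"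
        using interior_point x by blast
      have l: "G\<phi> H \<Phi> (0, z) < t" using less f(3)[OF x(1) _ x(2), of 0] by (simp add: x(3))
      then have \<nu>2: "\<nu> z > 1/2" and l2: "(1 + \<phi> (\<Phi> (R z))) / \<nu> z - 1 < t"
        using t by (auto simp: G\<phi>_def min_less_iff_disj split: if_splits)
      have sk: "\<Phi> (R z) \<in> sk m" using \<Phi>R[OF x(1,2)] \<nu>2 by simp
      have "(1 + \<phi> (\<Phi> (R z))) < (1 + t) * \<nu> z" using l2 \<nu>2 by (simp add: field_simps)
      then have a: "\<phi> (\<Phi> (R z)) < \<nu> z * (1 + t) - 1" by (simp add: mult.commute)
      moreover have "\<nu> z * (1 + t) \<le> 1 * 2" using t \<nu>1[OF x(2)] by (intro mult_mono) auto
      moreover have "0 \<le> \<phi> (\<Phi> (R z))" using \<phi>01[OF sk] by simp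
      ultimately have "h (\<nu> z * (1 + t) - 1, \<Phi> (R z)) = p" by (intro arrive sk) auto
      then show ?thesis using h'(3)[OF x(1) t x(2)] a \<open>0 \<le> \<phi> (\<Phi> (R z))\<close> by (simp add: Gh_def x(3))
    qed
  qed
  then show ?thesis using f(2) h'(2) below by (intro exI[of _ "\<lambda>x. f (0, x)"] exI[of _ h']) auto
qed

theorem well_pointed_CW:
  assumes "p \<in> topspace (Top K)"
  shows "well_pointed (Top K) p"
proof -
  define n where "n = (LEAST n. p \<in> sk n)"
  have n: "p \<in> sk n" "\<And>k. k < n \<Longrightarrow> p \<notin> sk k"
    using assms topspace_K by (auto simp: n_def intro: LeastI dest: not_less_Least)
  then have "p \<in> sk n - below n" by (cases n) (auto simp: below_def)
  then have "\<exists>s. contracts p (n + 0) s" using contracts_start by simp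
  moreover have "\<exists>s'. contracts p (n + Suc k) s' \<and>
      (\<forall>x\<in>sk (n + k). fst s' x = fst s x \<and> (\<forall>t. snd s' (t, x) = snd s (t, x)))" if "contracts p (n + k) s" for k s
    using contracts_step[of p "n + k" "fst s" "snd s"] that by fastforce
  ultimately obtain s where s: "\<And>k. contracts p (n + k) (s k)"
    and ext: "\<And>k x. x \<in> sk (n + k) \<Longrightarrow> fst (s (Suc k)) x = fst (s k) x \<and> (\<forall>t. snd (s (Suc k)) (t, x) = snd (s k) (t, x))"
    using dependent_nat_choice[of "\<lambda>k s. contracts p (n + k) s"
       "\<lambda>k s s'. \<forall>x\<in>sk (n + k). fst s' x = fst s x \<and> (\<forall>t. snd s' (t, x) = snd s (t, x))"] by metis
  have ext': "fst (s (k + j)) x = fst (s k) x \<and> (\<forall>t. snd (s (k + j)) (t, x) = snd (s k) (t, x))"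
    if "x \<in> sk (n + k)" for k j x
  proof (induction j)
    case (Suc j)
    have "x \<in> sk (n + (k + j))" using that sk_mono[of "n + k" "n + (k + j)"] by auto
    then show ?case using Suc ext[of x "k + j"] by simp
  qed simp
  define K' where "K' x = (LEAST k. x \<in> sk (n + k))" for x
  define \<phi> where "\<phi> x = fst (s (K' x)) x" for x
  define h where "h = (\<lambda>(t, x). snd (s (K' x)) (t, x))"
  have \<phi>h: "\<phi> x = fst (s k) x \<and> (\<forall>t. h (t, x) = snd (s k) (t, x))" if "x \<in> sk (n + k)" for k x
  proof -
    have "x \<in> sk (n + K' x)" "K' x \<le> k" using that by (auto simp: K'_def intro: LeastI Least_le)
    then show ?thesis using ext'[of x "K' x" "k - K' x"] by (simp add: \<phi>_def h_def)
  qed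
  have "\<exists>k. x \<in> sk (n + k)" if "x \<in> topspace (Top K)" for x
    using that topspace_K sk_mono by (metis UN_E le_add2 subsetD)
  note reach = this
  have c\<phi>: "continuous_map (skel (n + k)) unit_interval (fst (s k))"
    and ch: "continuous_map (prod_topology unit_interval (skel (n + k))) (Top K) (snd (s k))"
    and s0: "x \<in> sk (n + k) \<Longrightarrow> snd (s k) (0, x) = x" and sp: "t \<in> {0..1} \<Longrightarrow> snd (s k) (t, p) = p"
    and sp': "fst (s k) p = 1/2"
    and arrive: "x \<in> sk (n + k) \<Longrightarrow> t \<in> {0..1} \<Longrightarrow> fst (s k) x < t \<Longrightarrow> snd (s k) (t, x) = p" for k x t
    using s[of k] by (auto simp: contracts_def split: prod.splits)
  have cell: "continuous_map (C2_cell H m) (skel (n + m)) \<Phi>" "z \<in> topspace (C2_cell H m) \<Longrightarrow> \<Phi> z \<in> sk (n + m)"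
    if "(H, \<Phi>) \<in> \<C> m" for H \<Phi> m z
    using cell_cont[OF that] subsetD[OF sk_mono[of m "n + m"] cell_in_sk[OF that]]
    by (auto simp: continuous_map_in_subtopology)
  have "continuous_map (prod_topology unit_interval (Top K)) unit_interval (\<lambda>s. \<phi> (snd s))"
  proof (rule continuous_map_generated_by[OF generated_K])
    fix i assume "i \<in> cells UNIV"
    then obtain m H \<Phi> where i: "i = (m, H, \<Phi>)" "(H, \<Phi>) \<in> \<C> m" by (auto simp: cells_def)
    have "continuous_map (prod_topology unit_interval (C2_cell H m)) unit_interval (\<lambda>z. fst (s m) (\<Phi> (snd z)))"
      by (intro continuous_map_compose1[OF c\<phi>] continuous_map_compose1[OF cell(1)[OF i(2)]] continuous_map_snd)
    then have "continuous_map (prod_topology unit_interval (C2_cell H m)) unit_interval (\<lambda>z. \<phi> (\<Phi> (snd z)))"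
      by (rule continuous_map_eq) (use \<phi>h[OF cell(2)[OF i(2)]] in auto)
    then show "continuous_map (prod_topology unit_interval (cell_top i)) unit_interval (\<lambda>s. \<phi> (snd (fst s, snd (snd i) (snd s))))"
      using i by simp
  qed
  then have \<phi>c: "continuous_map (Top K) unit_interval \<phi>"
    using continuous_map_compose2[of unit_interval "Top K" unit_interval "\<lambda>s. \<phi> (snd s)" "Top K" "\<lambda>_. 0" "\<lambda>x. x"]
    by simp
  have hc: "continuous_map (prod_topology unit_interval (Top K)) (Top K) h"
  proof (rule continuous_map_generated_by[OF generated_K])
    fix i assume "i \<in> cells UNIV"
    then obtain m H \<Phi> where i: "i = (m, H, \<Phi>)" "(H, \<Phi>) \<in> \<C> m" by (auto simp: cells_def)
    have "continuous_map (prod_topology unit_interval (C2_cell H m)) (Top K) (\<lambda>z. snd (s m) (fst z, \<Phi> (snd z)))"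
      by (intro continuous_map_compose2[OF ch] continuous_map_fst continuous_map_compose1[OF cell(1)[OF i(2)]] continuous_map_snd)
    then have "continuous_map (prod_topology unit_interval (C2_cell H m)) (Top K) (\<lambda>z. h (fst z, \<Phi> (snd z)))"
      by (rule continuous_map_eq) (use \<phi>h[OF cell(2)[OF i(2)]] in auto)
    then show "continuous_map (prod_topology unit_interval (cell_top i)) (Top K) (\<lambda>s. h (fst s, snd (snd i) (snd s)))"
      using i by simp
  qed
  show ?thesis
    unfolding well_pointed_def
  proof (intro exI[of _ "\<lambda>x. max 0 (2 * \<phi> x - 1)"] exI[of _ h] conjI ballI impI)
    have "\<phi> x \<le> 1" if "x \<in> topspace (Top K)" for x
      using continuous_map_image_subset_topspace[OF \<phi>c] that by (auto simp: image_subset_iff)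
    then show "continuous_map (Top K) unit_interval (\<lambda>x. max 0 (2 * \<phi> x - 1))"
      by (intro continuous_map_into_Icc continuous_intros continuous_map_into_fulltopology[OF \<phi>c]) auto
    show "max 0 (2 * \<phi> p - 1) = 0" using \<phi>h[of p 0] n sp'[of 0] by simp
    show "h (t, p) = p" if "t \<in> {0..1}" for t using \<phi>h[of p 0] n sp[OF that] by simp
    show "continuous_map (prod_topology unit_interval (Top K)) (Top K) h" by (rule hc)
    fix x assume "x \<in> topspace (Top K)"
    then obtain k where k: "x \<in> sk (n + k)" using reach by blast
    then show "h (0, x) = x" using \<phi>h s0 by metis
    show "h (1, x) = p" if "max 0 (2 * \<phi> x - 1) < 1"
      using arrive[OF k, of 1] \<phi>h[OF k] that by simp
  qed
qed

end

lemma C2_CW_complex_well_pointed: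
  assumes "C2_CW_complex K" "p \<in> topspace (Top K)"
  shows "well_pointed (Top K) p"
proof -
  obtain sk \<C> where "cw_structure K sk \<C>"
    using assms(1) by (auto simp: C2_CW_complex_def cw_structure_def)
  from cw_structure.well_pointed_CW[OF this assms(2)] show ?thesis .
qed

text \<open>With \<open>g \<circ> f\<close> homotopic to the identity, the space \<open>X\<close> can be moved to \<open>Y\<close> and back, contracted while
  it is in \<open>Y\<close>.\<close>

lemma well_pointed_homotopy_invariant:
  assumes f: "continuous_map X Y f" "f p = q" and g: "continuous_map Y X g" "g q = p"
    and H: "homotopic_with (\<lambda>k. k p = p) X X (g \<circ> f) id"
    and Y: "well_pointed Y q"
  shows "well_pointed X p"
proof -
  obtain \<phi> h where \<phi>: "continuous_map Y unit_interval \<phi>" "\<phi> q = 0"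
    and h: "continuous_map (prod_topology unit_interval Y) Y h" "\<And>y. y \<in> topspace Y \<Longrightarrow> h (0, y) = y"
      "\<And>t. t \<in> {0..1} \<Longrightarrow> h (t, q) = q" "\<And>y. y \<in> topspace Y \<Longrightarrow> \<phi> y < 1 \<Longrightarrow> h (1, y) = q"
    using Y unfolding well_pointed_def by blast
  have fY: "f x \<in> topspace Y" if "x \<in> topspace X" for x
    using continuous_map_image_subset_topspace[OF f(1)] that by auto
  define K where "K = (\<lambda>(t, x). if t = 0 then g (f x) else g (h (t, f x)))"
  have "continuous_map (prod_topology unit_interval X) X (\<lambda>s. g (h (fst s, f (snd s))))"
    by (intro continuous_map_compose1[OF g(1)] continuous_map_compose2[OF h(1)] continuous_map_fst
        continuous_map_compose1[OF f(1)] continuous_map_snd)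
  then have "continuous_map (prod_topology unit_interval X) X K"
    by (rule continuous_map_eq) (auto simp: K_def h fY)
  then have "homotopic_with (\<lambda>k. k p = p) X X (g \<circ> f) (\<lambda>x. g (h (1, f x)))"
    unfolding homotopic_with_def by (intro exI[of _ K]) (auto simp: K_def f g h)
  then have "homotopic_with (\<lambda>k. k p = p) X X id (\<lambda>x. g (h (1, f x)))"
    using H by (blast intro: homotopic_with_trans homotopic_with_symD)
  then obtain k where k: "continuous_map (prod_topology unit_interval X) X k" "\<And>x. k (0, x) = x"
    "\<And>x. k (1, x) = g (h (1, f x))" "\<And>t. t \<in> {0..1} \<Longrightarrow> k (t, p) = p"
    unfolding homotopic_with_def id_def by blast
  show ?thesis
    unfolding well_pointed_def
    by (intro exI[of _ "\<lambda>x. \<phi> (f x)"] exI[of _ k] conjI ballI impI continuous_map_compose1[OF \<phi>(1) f(1)] k(1))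
      (use k f g \<phi> h fY in auto)
qed

section \<open>Pinching the suspension of a product\<close>

abbreviation J :: "real topology" where "J \<equiv> top_of_set {-1..1}"

definition clamp :: "real \<Rightarrow> real" where "clamp t = max (-1) (min 1 t)"

lemma clamp_range [simp]: "-1 \<le> clamp t" "clamp t \<le> 1" by (auto simp: clamp_def)

lemma clamp_id: "-1 \<le> t \<Longrightarrow> t \<le> 1 \<Longrightarrow> clamp t = t" by (auto simp: clamp_def)

lemma clamp_ge: "1 \<le> t \<Longrightarrow> clamp t = 1" and clamp_le: "t \<le> -1 \<Longrightarrow> clamp t = -1"
  by (auto simp: clamp_def)

lemma clamp_clamp: "clamp (3 * clamp (3 * v)) = clamp (9 * v)"
  by (simp add: clamp_def max_def min_def)

lemma continuous_map_clamp:
  "continuous_map Z euclideanreal f \<Longrightarrow> continuous_map Z J (\<lambda>z. clamp (f z))"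
  by (intro continuous_map_into_Icc) (auto simp: clamp_def intro!: continuous_intros)

lemma continuous_map_J_real: "continuous_map Z J f \<Longrightarrow> continuous_map Z euclideanreal f"
  by (rule continuous_map_into_fulltopology)

definition cat3 :: "real \<Rightarrow> 'b \<Rightarrow> 'b \<Rightarrow> 'b \<Rightarrow> 'b" where
  "cat3 v a b c = (if v \<le> -1/3 then a else if v \<le> 1/3 then b else c)"

lemma continuous_map_cat3:
  assumes v: "continuous_map Q euclideanreal v"
    and f: "continuous_map Q T f1" "continuous_map Q T f2" "continuous_map Q T f3"
    and 1: "\<And>q. q \<in> topspace Q \<Longrightarrow> v q = -1/3 \<Longrightarrow> f1 q = f2 q"
    and 2: "\<And>q. q \<in> topspace Q \<Longrightarrow> v q = 1/3 \<Longrightarrow> f2 q = f3 q"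
  shows "continuous_map Q T (\<lambda>q. cat3 (v q) (f1 q) (f2 q) (f3 q))"
  unfolding cat3_def
proof -
  have "continuous_map Q T (\<lambda>q. if v q \<le> 1/3 then f2 q else f3 q)"
    by (rule continuous_map_cases_le) (auto intro!: v continuous_map_from_subtopology f simp: 2)
  then show "continuous_map Q T (\<lambda>q. if v q \<le> -1/3 then f1 q else if v q \<le> 1/3 then f2 q else f3 q)"
    by (intro continuous_map_cases_le[where q = "\<lambda>_. -1/3"] v continuous_map_from_subtopology f) (auto simp: 1)
qed

text \<open>Homotopies that descend to the quotient by \<open>q\<close> at every time. Concatenating them upstairs avoids
  having to name the intermediate maps on the quotient.\<close>

definition fibre_homotopic ::
    "'q topology \<Rightarrow> ('q \<Rightarrow> 'r) \<Rightarrow> 't topology \<Rightarrow> ('q \<Rightarrow> 't) \<Rightarrow> ('q \<Rightarrow> 't) \<Rightarrow> bool" where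
  "fibre_homotopic Q q T =
     homotopic_with (\<lambda>k. \<forall>z\<in>topspace Q. \<forall>z'\<in>topspace Q. q z = q z' \<longrightarrow> k z = k z') Q T"

lemma fibre_homotopicI:
  assumes "continuous_map (prod_topology unit_interval Q) T K"
    and "\<And>t z z'. \<lbrakk>t \<in> {0..1}; z \<in> topspace Q; z' \<in> topspace Q; q z = q z'\<rbrakk> \<Longrightarrow> K (t, z) = K (t, z')"
    and "\<And>z. z \<in> topspace Q \<Longrightarrow> K (0, z) = F z" "\<And>z. z \<in> topspace Q \<Longrightarrow> K (1, z) = F' z"
  shows "fibre_homotopic Q q T F F'"
  unfolding fibre_homotopic_def
proof (subst homotopic_with)
  show "(\<forall>z\<in>topspace Q. \<forall>z'\<in>topspace Q. q z = q z' \<longrightarrow> f z = f z') \<longleftrightarrow>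
      (\<forall>z\<in>topspace Q. \<forall>z'\<in>topspace Q. q z = q z' \<longrightarrow> g z = g z')"
    if "\<And>x. x \<in> topspace Q \<Longrightarrow> f x = g x" for f g :: "'a \<Rightarrow> 'b"
    using that by metis
  show "\<exists>h. continuous_map (prod_topology unit_interval Q) T h \<and> (\<forall>x\<in>topspace Q. h (0, x) = F x) \<and>
     (\<forall>x\<in>topspace Q. h (1, x) = F' x) \<and>
     (\<forall>t\<in>{0..1}. \<forall>z\<in>topspace Q. \<forall>z'\<in>topspace Q. q z = q z' \<longrightarrow> h (t, z) = h (t, z'))"
    by (intro exI[of _ K]) (use assms in blast)
qed

lemma fibre_homotopic_trans:
  "fibre_homotopic Q q T F F' \<Longrightarrow> fibre_homotopic Q q T F' F'' \<Longrightarrow> fibre_homotopic Q q T F F''"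
  unfolding fibre_homotopic_def by (rule homotopic_with_trans)

lemma fibre_homotopic_imp_homotopic:
  assumes q: "quotient_map Q R q" and F: "fibre_homotopic Q q T F F'"
    and f: "\<And>z. z \<in> topspace Q \<Longrightarrow> f (q z) = F z" and g: "\<And>z. z \<in> topspace Q \<Longrightarrow> g (q z) = F' z"
  shows "homotopic_with (\<lambda>_. True) R T f g"
proof -
  obtain K where K: "continuous_map (prod_topology unit_interval Q) T K" "\<And>z. K (0, z) = F z" "\<And>z. K (1, z) = F' z"
    and fib: "\<And>t z z'. \<lbrakk>t \<in> {0..1}; z \<in> topspace Q; z' \<in> topspace Q; q z = q z'\<rbrakk> \<Longrightarrow> K (t, z) = K (t, z')"
    using F unfolding fibre_homotopic_def homotopic_with_def by blast
  have Q: "quotient_map (prod_topology unit_interval Q) (prod_topology unit_interval R) (\<lambda>(t, z). (t, q z))"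
    by (intro quotient_map_prod_right q disjI1 compact_imp_locally_compact_space Hausdorff_space_subtopology
        Hausdorff_space_euclidean) (simp add: compact_space_subtopology)
  have "K s = K s'" if "s \<in> topspace (prod_topology unit_interval Q)" "s' \<in> topspace (prod_topology unit_interval Q)"
    "(\<lambda>(t, z). (t, q z)) s = (\<lambda>(t, z). (t, q z)) s'" for s s'
    using fib[of "fst s" "snd s" "snd s'"] that by (cases s; cases s') simp
  then obtain H where H: "continuous_map (prod_topology unit_interval R) T H"
    "\<And>s. s \<in> topspace (prod_topology unit_interval Q) \<Longrightarrow> H ((\<lambda>(t, z). (t, q z)) s) = K s"
    using quotient_map_lift_exists[OF Q K(1)] by metis
  have "q ` topspace Q = topspace R" using q by (simp add: quotient_imp_surjective_map)
  then have sur: "\<exists>z\<in>topspace Q. r = q z" if "r \<in> topspace R" for r using that by blast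
  have H': "H (t, q z) = K (t, z)" if "t \<in> {0..1}" "z \<in> topspace Q" for t z
    using H(2)[of "(t, z)"] that by simp
  show ?thesis
  proof (subst homotopic_with, simp, intro exI conjI ballI)
    fix x assume "x \<in> topspace R"
    then obtain z where z: "z \<in> topspace Q" "x = q z" using sur by blast
    show "H (0, x) = f x" "H (1, x) = g x" using z by (simp_all add: H' K f g)
  qed (auto intro: H(1))
qed

text \<open>In the application \<open>P\<close> is \<open>\<Sigma>(X \<times> X)\<close> and \<open>E v x y\<close> its point over \<open>(x, y)\<close> at height \<open>v\<close>; the wedge
  \<open>W\<close> is covered by its summands \<open>A\<close> (a circle smashed with the first factor), \<open>N\<close> (with the smash product)
  and \<open>B\<close> (with the second factor), glued at \<open>bW\<close> only (\<open>pieces_eq\<close>). The map \<open>\<eta>\<close> runs through the three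
  pieces in turn.\<close>

locale pinched_suspension =
  fixes X :: "'a topology" and p :: 'a
    and P :: "'p topology" and E :: "real \<Rightarrow> 'a \<Rightarrow> 'a \<Rightarrow> 'p" and bP :: 'p
    and W :: "'w topology" and A :: "real \<Rightarrow> 'a \<Rightarrow> 'w" and N :: "real \<Rightarrow> 'a \<Rightarrow> 'a \<Rightarrow> 'w" and B :: "real \<Rightarrow> 'a \<Rightarrow> 'w"
    and bW :: 'w and \<eta> :: "'p \<Rightarrow> 'w" and \<phi> :: "'a \<Rightarrow> real" and h :: "real \<times> 'a \<Rightarrow> 'a"
  assumes p: "p \<in> topspace X"
    and E_quotient: "quotient_map (prod_topology J (prod_topology X X)) P (\<lambda>(v, x, y). E v x y)"
    and E_base: "v = -1 \<or> v = 1 \<or> x = p \<and> y = p \<Longrightarrow> v \<in> {-1..1} \<Longrightarrow> x \<in> topspace X \<Longrightarrow> y \<in> topspace X \<Longrightarrow> E v x y = bP"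
    and E_eq: "\<lbrakk>z \<in> {-1..1} \<times> topspace X \<times> topspace X; z' \<in> {-1..1} \<times> topspace X \<times> topspace X;
        (\<lambda>(v, x, y). E v x y) z = (\<lambda>(v, x, y). E v x y) z'; z \<noteq> z'\<rbrakk> \<Longrightarrow>
        fst z = -1 \<or> fst z = 1 \<or> snd z = (p, p)"
    and A_cont: "continuous_map (prod_topology J X) W (\<lambda>(v, x). A v x)"
    and N_cont: "continuous_map (prod_topology J (prod_topology X X)) W (\<lambda>(v, x, y). N v x y)"
    and B_cont: "continuous_map (prod_topology J X) W (\<lambda>(v, x). B v x)"
    and A_base: "v \<in> {-1..1} \<Longrightarrow> x \<in> topspace X \<Longrightarrow> A v x = bW \<longleftrightarrow> v = -1 \<or> v = 1 \<or> x = p"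
    and B_base: "v \<in> {-1..1} \<Longrightarrow> x \<in> topspace X \<Longrightarrow> B v x = bW \<longleftrightarrow> v = -1 \<or> v = 1 \<or> x = p"
    and N_base: "v \<in> {-1..1} \<Longrightarrow> x \<in> topspace X \<Longrightarrow> y \<in> topspace X \<Longrightarrow>
        N v x y = bW \<longleftrightarrow> v = -1 \<or> v = 1 \<or> x = p \<or> y = p"
    and pieces_eq: "\<lbrakk>s \<in> ({-1..1} \<times> topspace X) <+> (({-1..1} \<times> topspace X \<times> topspace X) <+> ({-1..1} \<times> topspace X));
        s' \<in> ({-1..1} \<times> topspace X) <+> (({-1..1} \<times> topspace X \<times> topspace X) <+> ({-1..1} \<times> topspace X));
        case_sum (\<lambda>(v, x). A v x) (case_sum (\<lambda>(v, x, y). N v x y) (\<lambda>(v, x). B v x)) s =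
        case_sum (\<lambda>(v, x). A v x) (case_sum (\<lambda>(v, x, y). N v x y) (\<lambda>(v, x). B v x)) s'; s \<noteq> s'\<rbrakk> \<Longrightarrow>
        case_sum (\<lambda>(v, x). A v x) (case_sum (\<lambda>(v, x, y). N v x y) (\<lambda>(v, x). B v x)) s = bW"
    and W_cover: "w \<in> topspace W \<Longrightarrow> (\<exists>v\<in>{-1..1}. \<exists>x\<in>topspace X. w = A v x \<or> w = B v x) \<or>
        (\<exists>v\<in>{-1..1}. \<exists>x\<in>topspace X. \<exists>y\<in>topspace X. w = N v x y)"
    and W_open: "\<lbrakk>U \<subseteq> topspace W;
        openin (prod_topology J X) {z \<in> {-1..1} \<times> topspace X. (\<lambda>(v, x). A v x) z \<in> U};
        openin (prod_topology J (prod_topology X X)) {z \<in> {-1..1} \<times> topspace X \<times> topspace X. (\<lambda>(v, x, y). N v x y) z \<in> U};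
        openin (prod_topology J X) {z \<in> {-1..1} \<times> topspace X. (\<lambda>(v, x). B v x) z \<in> U}\<rbrakk> \<Longrightarrow> openin W U"
    and \<eta>_E: "\<lbrakk>v \<in> {-1..1}; x \<in> topspace X; y \<in> topspace X\<rbrakk> \<Longrightarrow>
        \<eta> (E v x y) = cat3 v (A (clamp (3 * v + 2)) x) (N (clamp (3 * v)) x y) (B (clamp (3 * v - 2)) y)"
    and \<phi>_cont: "continuous_map X unit_interval \<phi>" and \<phi>_p: "\<phi> p = 0"
    and h_cont: "continuous_map (prod_topology unit_interval X) X h"
    and h_0: "x \<in> topspace X \<Longrightarrow> h (0, x) = x" and h_p: "t \<in> {0..1} \<Longrightarrow> h (t, p) = p"
    and h_1: "\<lbrakk>x \<in> topspace X; \<phi> x < 1\<rbrakk> \<Longrightarrow> h (1, x) = p"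
begin

abbreviation JXX :: "(real \<times> 'a \<times> 'a) topology" where "JXX \<equiv> prod_topology J (prod_topology X X)"

text \<open>\<open>retr\<close> is the end of the contraction. The levels \<open>lower y\<close> and \<open>upper x\<close> in \<open>[-1, 1]\<close> say how much
  of a loop is to be traversed: where they differ from the extreme values \<open>-1\<close> and \<open>1\<close>, \<open>retr y\<close> and \<open>retr x\<close>
  are already the base point (\<open>retr_eq_p\<close>), and at the base point nothing of the loop is left.\<close>

definition retr :: "'a \<Rightarrow> 'a" where "retr x = h (1, x)"
definition lower :: "'a \<Rightarrow> real" where "lower y = 1 - 2 * \<phi> y"
definition upper :: "'a \<Rightarrow> real" where "upper x = 2 * \<phi> x - 1"
text \<open>The pinch map, lifted to \<open>[-1, 1] \<times> X \<times> X\<close>.\<close>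

definition G :: "real \<Rightarrow> 'a \<Rightarrow> 'a \<Rightarrow> 'w" where
  "G v x y = cat3 v (A (clamp (3 * v + 2)) x) (N (clamp (3 * v)) x y) (B (clamp (3 * v - 2)) y)"

lemma projections:
  "continuous_map JXX J fst" "continuous_map JXX X (\<lambda>z. fst (snd z))" "continuous_map JXX X (\<lambda>z. snd (snd z))"
  by (rule continuous_map_fst, rule continuous_map_compose1[OF continuous_map_fst continuous_map_snd],
      rule continuous_map_compose1[OF continuous_map_snd continuous_map_snd])

lemma cont_retr: "continuous_map Z X f \<Longrightarrow> continuous_map Z X (\<lambda>z. retr (f z))"
  unfolding retr_def by (intro continuous_map_compose2[OF h_cont]) auto

lemma cont_h: "continuous_map Z unit_interval t \<Longrightarrow> continuous_map Z X f \<Longrightarrow> continuous_map Z X (\<lambda>z. h (t z, f z))"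
  by (intro continuous_map_compose2[OF h_cont])

lemma cont_E: "continuous_map Z J v \<Longrightarrow> continuous_map Z X x \<Longrightarrow> continuous_map Z X y \<Longrightarrow>
    continuous_map Z P (\<lambda>z. E (v z) (x z) (y z))"
  using continuous_map_compose2[OF quotient_imp_continuous_map[OF E_quotient], of Z v "\<lambda>z. (x z, y z)"]
  by (simp add: continuous_map_pairedI)

lemma cont_A: "continuous_map Z J v \<Longrightarrow> continuous_map Z X x \<Longrightarrow> continuous_map Z W (\<lambda>z. A (v z) (x z))"
  using continuous_map_compose2[OF A_cont, of Z v x] by simp

lemma cont_B: "continuous_map Z J v \<Longrightarrow> continuous_map Z X x \<Longrightarrow> continuous_map Z W (\<lambda>z. B (v z) (x z))"
  using continuous_map_compose2[OF B_cont, of Z v x] by simp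

lemma cont_N: "continuous_map Z J v \<Longrightarrow> continuous_map Z X x \<Longrightarrow> continuous_map Z X y \<Longrightarrow>
    continuous_map Z W (\<lambda>z. N (v z) (x z) (y z))"
  using continuous_map_compose2[OF N_cont, of Z v "\<lambda>z. (x z, y z)"]
  by (simp add: continuous_map_pairedI)

lemma h_in: "t \<in> {0..1} \<Longrightarrow> x \<in> topspace X \<Longrightarrow> h (t, x) \<in> topspace X"
  using continuous_map_image_subset_topspace[OF h_cont] by (auto simp: image_subset_iff)

lemma retr_in: "x \<in> topspace X \<Longrightarrow> retr x \<in> topspace X"
  by (simp add: retr_def h_in)

lemma retr_p: "retr p = p" by (simp add: retr_def h_p)

lemma \<phi>_range: "x \<in> topspace X \<Longrightarrow> 0 \<le> \<phi> x \<and> \<phi> x \<le> 1"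
  using continuous_map_image_subset_topspace[OF \<phi>_cont] by (auto simp: image_subset_iff)

lemma lower_range: "x \<in> topspace X \<Longrightarrow> -1 \<le> lower x" "x \<in> topspace X \<Longrightarrow> lower x \<le> 1"
  and upper_range: "x \<in> topspace X \<Longrightarrow> -1 \<le> upper x" "x \<in> topspace X \<Longrightarrow> upper x \<le> 1"
  using \<phi>_range by (auto simp: lower_def upper_def)

lemma lower_p: "lower p = 1" and upper_p: "upper p = -1" by (auto simp: lower_def upper_def \<phi>_p)

lemma retr_eq_p: "x \<in> topspace X \<Longrightarrow> -1 < lower x \<Longrightarrow> retr x = p" "x \<in> topspace X \<Longrightarrow> upper x < 1 \<Longrightarrow> retr x = p"
  using h_1 by (auto simp: lower_def upper_def retr_def)

lemma cont_\<phi>: "continuous_map Z X f \<Longrightarrow> continuous_map Z euclideanreal (\<lambda>z. \<phi> (f z))"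
  by (rule continuous_map_compose1[OF continuous_map_into_fulltopology[OF \<phi>_cont]])

lemma cont_lower: "continuous_map Z X f \<Longrightarrow> continuous_map Z euclideanreal (\<lambda>z. lower (f z))"
  unfolding lower_def by (intro continuous_intros cont_\<phi>)

lemma cont_upper: "continuous_map Z X f \<Longrightarrow> continuous_map Z euclideanreal (\<lambda>z. upper (f z))"
  unfolding upper_def by (intro continuous_intros cont_\<phi>)

lemma in_X: "continuous_map Z X f \<Longrightarrow> z \<in> topspace Z \<Longrightarrow> f z \<in> topspace X"
  using continuous_map_image_subset_topspace by (force simp: image_subset_iff)

lemma in_J: "continuous_map Z J f \<Longrightarrow> z \<in> topspace Z \<Longrightarrow> -1 \<le> f z \<and> f z \<le> 1"
  using continuous_map_image_subset_topspace[of Z J f] by (force simp: image_subset_iff)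

lemma E_ends: "x \<in> topspace X \<Longrightarrow> y \<in> topspace X \<Longrightarrow> E (-1) x y = bP" "x \<in> topspace X \<Longrightarrow> y \<in> topspace X \<Longrightarrow> E 1 x y = bP"
  "-1 \<le> v \<Longrightarrow> v \<le> 1 \<Longrightarrow> E v p p = bP"
  by (auto intro!: E_base p)

lemma A_bases: "x \<in> topspace X \<Longrightarrow> A (-1) x = bW" "x \<in> topspace X \<Longrightarrow> A 1 x = bW" "-1 \<le> v \<Longrightarrow> v \<le> 1 \<Longrightarrow> A v p = bW"
  "x \<in> topspace X \<Longrightarrow> B (-1) x = bW" "x \<in> topspace X \<Longrightarrow> B 1 x = bW" "-1 \<le> v \<Longrightarrow> v \<le> 1 \<Longrightarrow> B v p = bW"
  using A_base B_base p by auto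

lemma N_bases: "x \<in> topspace X \<Longrightarrow> y \<in> topspace X \<Longrightarrow> N (-1) x y = bW"
   "x \<in> topspace X \<Longrightarrow> y \<in> topspace X \<Longrightarrow> N 1 x y = bW"
   "-1 \<le> v \<Longrightarrow> v \<le> 1 \<Longrightarrow> y \<in> topspace X \<Longrightarrow> N v p y = bW"
   "-1 \<le> v \<Longrightarrow> v \<le> 1 \<Longrightarrow> x \<in> topspace X \<Longrightarrow> N v x p = bW"
  using N_base p by auto

lemmas bases = E_ends A_bases N_bases

lemma cont_G:
  assumes v: "continuous_map Z J v" and x: "continuous_map Z X x" and y: "continuous_map Z X y"
  shows "continuous_map Z W (\<lambda>z. G (v z) (x z) (y z))"
  unfolding G_def
  by (intro continuous_map_cat3 cont_A cont_B cont_N continuous_map_clamp continuous_intros continuous_map_J_real[OF v] x y)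
    (use in_X[OF x] in_X[OF y] in \<open>auto simp: bases clamp_def\<close>)

lemma G_left: "v \<le> -1/3 \<Longrightarrow> G v x y = A (clamp (3 * v + 2)) x"
  by (simp add: G_def cat3_def)

lemma G_right: "1/3 \<le> v \<Longrightarrow> x \<in> topspace X \<Longrightarrow> y \<in> topspace X \<Longrightarrow> G v x y = B (clamp (3 * v - 2)) y"
proof (cases "v = 1/3")
  assume "v = 1/3" and xy: "x \<in> topspace X" "y \<in> topspace X"
  then show ?thesis by (simp add: G_def cat3_def clamp_def bases)
qed (simp add: G_def cat3_def)

lemma G_mid: "-1/3 \<le> v \<Longrightarrow> v \<le> 1/3 \<Longrightarrow> x \<in> topspace X \<Longrightarrow> y \<in> topspace X \<Longrightarrow> G v x y = N (clamp (3 * v)) x y"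
proof (cases "v = -1/3")
  assume "v = -1/3" and xy: "x \<in> topspace X" "y \<in> topspace X"
  then show ?thesis by (simp add: G_def cat3_def clamp_def bases)
qed (simp add: G_def cat3_def)

lemma G_ends: "x \<in> topspace X \<Longrightarrow> y \<in> topspace X \<Longrightarrow> G (-1) x y = bW" "x \<in> topspace X \<Longrightarrow> y \<in> topspace X \<Longrightarrow> G 1 x y = bW"
  by (auto simp: G_def cat3_def bases clamp_def)

lemma G_p_right: "-1/3 \<le> v \<Longrightarrow> x \<in> topspace X \<Longrightarrow> G v x p = bW"
  using p by (auto simp: G_def cat3_def bases clamp_def)

lemma G_p_left: "v \<le> 1/3 \<Longrightarrow> y \<in> topspace X \<Longrightarrow> G v p y = bW"
  using p by (auto simp: G_def cat3_def bases)

lemma G_p_p: "G v p p = bW"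
  using p by (auto simp: G_def cat3_def bases)

lemma \<eta>_E_eq_G: "\<lbrakk>v \<in> {-1..1}; x \<in> topspace X; y \<in> topspace X\<rbrakk> \<Longrightarrow> \<eta> (E v x y) = G v x y"
  by (simp add: \<eta>_E G_def)

lemma \<eta>_cont: "continuous_map P W \<eta>"
proof (rule continuous_compose_quotient_map[OF E_quotient])
  have "continuous_map JXX W (\<lambda>z. G (fst z) (fst (snd z)) (snd (snd z)))"
    by (intro cont_G projections)
  then show "continuous_map JXX W (\<eta> \<circ> (\<lambda>(v, x, y). E v x y))"
    by (rule continuous_map_eq) (auto simp: \<eta>_E_eq_G)
qed

abbreviation pieces :: "real \<times> 'a + real \<times> 'a \<times> 'a + real \<times> 'a \<Rightarrow> 'w" where
  "pieces \<equiv> case_sum (\<lambda>(v, x). A v x) (case_sum (\<lambda>(v, x, y). N v x y) (\<lambda>(v, x). B v x))"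

definition piece_of :: "real \<times> 'a \<times> 'a \<Rightarrow> real \<times> 'a + real \<times> 'a \<times> 'a + real \<times> 'a" where
  "piece_of z = (case z of (v, x, y) \<Rightarrow>
     cat3 v (Inl (clamp (3 * v + 2), x)) (Inr (Inl (clamp (3 * v), x, y))) (Inr (Inr (clamp (3 * v - 2), y))))"

lemma pieces_piece_of: "pieces (piece_of (v, x, y)) = G v x y"
  by (auto simp: piece_of_def G_def cat3_def)

lemma piece_of_in:
  "x \<in> topspace X \<Longrightarrow> y \<in> topspace X \<Longrightarrow>
   piece_of (v, x, y) \<in> ({-1..1} \<times> topspace X) <+> (({-1..1} \<times> topspace X \<times> topspace X) <+> ({-1..1} \<times> topspace X))"
  by (auto simp: piece_of_def cat3_def)

lemma A_eq_G: "v \<in> {-1..1} \<Longrightarrow> A v x = G ((v - 2) / 3) x p"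
  and B_eq_G: "v \<in> {-1..1} \<Longrightarrow> x \<in> topspace X \<Longrightarrow> B v x = G ((v + 2) / 3) p x"
  and N_eq_G: "v \<in> {-1..1} \<Longrightarrow> x \<in> topspace X \<Longrightarrow> y \<in> topspace X \<Longrightarrow> N v x y = G (v / 3) x y"
proof -
  have 1: "3 * ((v - 2) / 3) + 2 = v" "3 * ((v + 2) / 3) - 2 = v" "3 * (v / 3) = v" by (simp_all add: field_simps)
  then show "v \<in> {-1..1} \<Longrightarrow> A v x = G ((v - 2) / 3) x p"
    "v \<in> {-1..1} \<Longrightarrow> x \<in> topspace X \<Longrightarrow> B v x = G ((v + 2) / 3) p x"
    "v \<in> {-1..1} \<Longrightarrow> x \<in> topspace X \<Longrightarrow> y \<in> topspace X \<Longrightarrow> N v x y = G (v / 3) x y"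
    using p by (simp_all add: G_left[of "(v - 2) / 3"] G_right[of "(v + 2) / 3"] G_mid[of "v / 3"] 1 clamp_id del: times_divide_eq_right)
qed

text \<open>The pinch map is itself a quotient map, so that homotopies out of the wedge can be
  constructed on the product of the interval with \<open>X \<times> X\<close>.\<close>

lemma G_quotient: "quotient_map JXX W (\<lambda>(v, x, y). G v x y)"
proof -
  let ?G = "\<lambda>(v, x, y). G v x y"
  have c: "continuous_map JXX W (\<lambda>z. G (fst z) (fst (snd z)) (snd (snd z)))"
    by (intro cont_G projections)
  have "topspace W \<subseteq> ?G ` topspace JXX"
  proof
    fix w assume "w \<in> topspace W"
    then consider v x where "v \<in> {-1..1}" "x \<in> topspace X" "w = A v x"
      | v x where "v \<in> {-1..1}" "x \<in> topspace X" "w = B v x"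
      | v x y where "v \<in> {-1..1}" "x \<in> topspace X" "y \<in> topspace X" "w = N v x y"
      using W_cover by blast
    then show "w \<in> ?G ` topspace JXX"
    proof cases
      case 1 then show ?thesis using p by (auto simp: A_eq_G intro!: rev_image_eqI[of "((v - 2) / 3, x, p)"])
    next
      case 2 then show ?thesis using p by (auto simp: B_eq_G intro!: rev_image_eqI[of "((v + 2) / 3, p, x)"])
    next
      case 3 then show ?thesis by (auto simp: N_eq_G intro!: rev_image_eqI[of "(v / 3, x, y)"])
    qed
  qed
  then have im: "?G ` topspace JXX = topspace W"
    using continuous_map_image_subset_topspace[OF c] by (auto simp: case_prod_unfold)
  have "openin W U" if U: "U \<subseteq> topspace W" and o: "openin JXX {z \<in> topspace JXX. ?G z \<in> U}" for U
  proof (rule W_open[OF U])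
    have 1: "continuous_map (prod_topology J X) JXX (\<lambda>z. ((fst z - 2) / 3, snd z, p))"
      by (intro continuous_map_pairedI continuous_map_into_Icc continuous_intros continuous_map_J_real[OF continuous_map_fst])
        (use p in auto)
    have 2: "continuous_map (prod_topology J X) JXX (\<lambda>z. ((fst z + 2) / 3, p, snd z))"
      by (intro continuous_map_pairedI continuous_map_into_Icc continuous_intros continuous_map_J_real[OF continuous_map_fst])
        (use p in auto)
    have 3: "continuous_map JXX JXX (\<lambda>z. (fst z / 3, snd z))"
      by (intro continuous_map_pairedI continuous_map_into_Icc continuous_intros continuous_map_J_real[OF continuous_map_fst])
        auto
    have "{z \<in> {-1..1} \<times> topspace X. (\<lambda>(v, x). A v x) z \<in> U} =
       {z \<in> topspace (prod_topology J X). ((fst z - 2) / 3, snd z, p) \<in> {z \<in> topspace JXX. ?G z \<in> U}}"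
      using p by (auto simp: A_eq_G)
    then show "openin (prod_topology J X) {z \<in> {-1..1} \<times> topspace X. (\<lambda>(v, x). A v x) z \<in> U}"
      using openin_continuous_map_preimage[OF 1 o] by (simp only:)
    have "{z \<in> {-1..1} \<times> topspace X. (\<lambda>(v, x). B v x) z \<in> U} =
       {z \<in> topspace (prod_topology J X). ((fst z + 2) / 3, p, snd z) \<in> {z \<in> topspace JXX. ?G z \<in> U}}"
      using p by (auto simp: B_eq_G)
    then show "openin (prod_topology J X) {z \<in> {-1..1} \<times> topspace X. (\<lambda>(v, x). B v x) z \<in> U}"
      using openin_continuous_map_preimage[OF 2 o] by (simp only:)
    have "{z \<in> {-1..1} \<times> topspace X \<times> topspace X. (\<lambda>(v, x, y). N v x y) z \<in> U} =
       {z \<in> topspace JXX. (fst z / 3, snd z) \<in> {z \<in> topspace JXX. ?G z \<in> U}}"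
      using p by (auto simp: N_eq_G)
    then show "openin JXX {z \<in> {-1..1} \<times> topspace X \<times> topspace X. (\<lambda>(v, x, y). N v x y) z \<in> U}"
      using openin_continuous_map_preimage[OF 3 o] by (simp only:)
  qed
  moreover have "openin JXX {z \<in> topspace JXX. ?G z \<in> U}" if "openin W U" for U
    using openin_continuous_map_preimage[OF c that] by (simp add: case_prod_unfold)
  ultimately show ?thesis
    using im unfolding quotient_map_def by blast
qed

subsection \<open>The homotopy inverse\<close>

text \<open>For \<open>m = 1\<close> this is the homotopy inverse on the summand \<open>N\<close>: the loop of \<open>(x', *)\<close> backwards from
  its end down to the level \<open>lower y\<close>, then the loop of \<open>(x', y')\<close> from \<open>lower y\<close> up to \<open>upper x\<close>, then the loop
  of \<open>(*, y')\<close> backwards from \<open>upper x\<close> down to its beginning. If \<open>lower y\<close> is not \<open>-1\<close> then \<open>y' = *\<close>, so the first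
  two paths fit together, and likewise at \<open>upper x\<close>. As \<open>m\<close> decreases to \<open>-1\<close>, the parts of the first path
  above \<open>m\<close> and of the last path below \<open>-m\<close> are cut off, until the loop of \<open>(x', y')\<close> remains.\<close>

definition unpinch_norm :: "real \<Rightarrow> real \<Rightarrow> 'a \<Rightarrow> 'a \<Rightarrow> 'p" where
  "unpinch_norm m v x y = cat3 v
     (E (min m (max (- clamp (3 * v + 2)) (lower y))) (retr x) p)
     (E (max (min m (lower y)) (min (clamp (3 * v)) (max (- m) (upper x)))) (retr x) (retr y))
     (E (max (- m) (min (- clamp (3 * v - 2)) (upper x))) p (retr y))"

lemma unpinch_norm_cont:
  assumes m: "continuous_map Z J m" and v: "continuous_map Z J v" and x: "continuous_map Z X x" and y: "continuous_map Z X y"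
  shows "continuous_map Z P (\<lambda>z. unpinch_norm (m z) (v z) (x z) (y z))"
  unfolding unpinch_norm_def
proof (rule continuous_map_cat3)
  note c = continuous_map_J_real[OF m] continuous_map_J_real[OF v] cont_lower[OF y] cont_upper[OF x] 
    continuous_map_J_real[OF continuous_map_clamp]
  note ins = in_J[OF m] in_J[OF v] lower_range[OF in_X[OF y]] upper_range[OF in_X[OF x]]
  show "continuous_map Z euclideanreal v" by (rule c)
  show "continuous_map Z P (\<lambda>z. E (min (m z) (max (- clamp (3 * v z + 2)) (lower (y z)))) (retr (x z)) p)"
    by (intro cont_E cont_retr x y continuous_map_into_Icc continuous_intros c)
      (use p ins in \<open>auto simp: min_le_iff_disj le_max_iff_disj\<close>)
  show "continuous_map Z P (\<lambda>z. E (max (min (m z) (lower (y z))) (min (clamp (3 * v z)) (max (- m z) (upper (x z))))) (retr (x z)) (retr (y z)))"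
    by (intro cont_E cont_retr x y continuous_map_into_Icc continuous_intros c)
      (use p ins in \<open>auto simp: min_le_iff_disj le_max_iff_disj\<close>)
  show "continuous_map Z P (\<lambda>z. E (max (- m z) (min (- clamp (3 * v z - 2)) (upper (x z)))) p (retr (y z)))"
    by (intro cont_E cont_retr x y continuous_map_into_Icc continuous_intros c)
      (use p ins in \<open>auto simp: min_le_iff_disj le_max_iff_disj\<close>)
  fix z assume z: "z \<in> topspace Z"
  let ?x = "retr (x z)" and ?y = "retr (y z)" and ?a = "min (m z) (lower (y z))" and ?e = "max (- m z) (upper (x z))"
  note xy = in_X[OF x z] in_X[OF y z]
  have xy': "?x \<in> topspace X" "?y \<in> topspace X" using retr_in xy by auto
  have ra: "-1 \<le> ?a" "?a \<le> 1" "-1 \<le> ?e" "?e \<le> 1"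
    using in_J[OF m z] lower_range[OF xy(2)] upper_range[OF xy(1)] by auto
  have ya: "?a > -1 \<Longrightarrow> ?y = p" and xe: "?e < 1 \<Longrightarrow> ?x = p"
    using retr_eq_p xy by auto
  have "E ?a ?x p = E ?a ?x ?y"
  proof (cases "?a = -1")
    case True
    then show ?thesis unfolding True using xy' p by (simp add: bases)
  next
    case False
    then have "?y = p" using ya ra by linarith
    then show ?thesis by simp
  qed
  moreover have "max (-1) (lower (y z)) = lower (y z)" "max ?a (min (-1) ?e) = ?a"
    using lower_range[OF xy(2)] ra by auto
  ultimately show "E (min (m z) (max (- clamp (3 * v z + 2)) (lower (y z)))) ?x p = 
      E (max ?a (min (clamp (3 * v z)) ?e)) ?x ?y" if "v z = -1/3"
    using that by (simp add: clamp_def)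
  have "E (max ?a ?e) ?x ?y = E ?e p ?y"
  proof (cases "?a \<le> ?e")
    case True
    then have "max ?a ?e = ?e" by simp
    moreover have "E ?e ?x ?y = E ?e p ?y"
    proof (cases "?e = 1")
      case True
      then show ?thesis unfolding True using xy' p by (simp add: bases)
    next
      case False
      then have "?x = p" using xe ra by linarith
      then show ?thesis by simp
    qed
    ultimately show ?thesis by simp
  next
    case False
    then have "?x = p" "?y = p" using ya xe ra by linarith+
    then show ?thesis using ra by (simp add: bases)
  qed
  moreover have "min 1 (upper (x z)) = upper (x z)" "min 1 ?e = ?e"
    using upper_range[OF xy(1)] ra by auto
  ultimately show "E (max ?a (min (clamp (3 * v z)) ?e)) ?x ?y = 
       E (max (- m z) (min (- clamp (3 * v z - 2)) (upper (x z)))) p ?y" if "v z = 1/3"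
    using that by (simp add: clamp_def)
qed

lemma unpinch_norm_base:
  assumes x: "x \<in> topspace X" and y: "y \<in> topspace X"
  shows "m \<in> {-1..1} \<Longrightarrow> unpinch_norm m (-1) x y = E m (retr x) p" "m \<in> {-1..1} \<Longrightarrow> unpinch_norm m 1 x y = E (- m) p (retr y)"
    and unpinch_norm_p_p_aux: "m \<in> {-1..1} \<Longrightarrow> unpinch_norm m v p p = bP"
    and unpinch_norm_x_p_aux: "unpinch_norm 1 v x p = bP" and unpinch_norm_p_y_aux: "unpinch_norm 1 v p y = bP"
proof -
  note rx = retr_in[OF x] retr_in[OF y] p retr_p lower_range[OF x] upper_range[OF x] lower_range[OF y] upper_range[OF y] lower_p upper_p
  show "unpinch_norm m (-1) x y = E m (retr x) p" "unpinch_norm m 1 x y = E (- m) p (retr y)" if m: "m \<in> {-1..1}"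
    using m rx by (auto simp: unpinch_norm_def cat3_def clamp_def min_def max_def)
  show "unpinch_norm m v p p = bP" if m: "m \<in> {-1..1}"
    using m rx by (auto simp: unpinch_norm_def cat3_def min_le_iff_disj le_max_iff_disj intro!: bases)
  have "-1 \<le> max (-1) (min (- clamp t) (upper x))" "max (-1) (min (- clamp t) (upper x)) \<le> 1" for t
    using rx by (auto simp: min_le_iff_disj le_max_iff_disj)
  then show "unpinch_norm 1 v x p = bP"
    using rx by (auto simp: unpinch_norm_def cat3_def bases min_absorb1 max_absorb1 min_le_iff_disj le_max_iff_disj)
  have "E (max (lower y) (min (clamp (3 * v)) (-1))) p (retr y) = bP"
  proof (cases "lower y = -1")
    case True
    then have "max (lower y) (min (clamp (3 * v)) (-1)) = -1" by auto
    then show ?thesis using rx by (simp add: bases)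
  next
    case False
    then have "retr y = p" using retr_eq_p y rx by force
    moreover have "-1 \<le> max (lower y) (min (clamp (3 * v)) (-1))" "max (lower y) (min (clamp (3 * v)) (-1)) \<le> 1"
      using rx by (auto simp: min_le_iff_disj le_max_iff_disj)
    ultimately show ?thesis by (simp add: bases)
  qed
  moreover have "E (min 1 (max (- clamp (3 * v + 2)) (lower y))) p p = bP"
    using rx by (auto intro!: bases simp: min_le_iff_disj le_max_iff_disj)
  moreover have "max (-1) (min (- clamp (3 * v - 2)) (-1)) = -1" "min 1 (lower y) = lower y" 
    using rx by (auto simp: min_absorb2)
  ultimately show "unpinch_norm 1 v p y = bP"
    using rx by (simp add: unpinch_norm_def cat3_def bases)
qed

lemmas unpinch_norm_p_p = unpinch_norm_p_p_aux[OF p p] and unpinch_norm_x_p = unpinch_norm_x_p_aux[OF _ p] and unpinch_norm_p_y = unpinch_norm_p_y_aux[OF p]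
lemmas unpinch_norm_bases = unpinch_norm_base(1,2) unpinch_norm_p_p unpinch_norm_x_p unpinch_norm_p_y

text \<open>What a map on \<open>[-1, 1] \<times> X \<times> X\<close> must satisfy to descend to \<open>P\<close> is weaker than what it must satisfy
  to descend to \<open>W\<close>: there each third of the interval forgets a coordinate.\<close>

lemma E_fibres:
  assumes "z \<in> topspace JXX" "z' \<in> topspace JXX" "(\<lambda>(v, x, y). E v x y) z = (\<lambda>(v, x, y). E v x y) z'"
    and "\<And>v x y. \<lbrakk>v \<in> {-1..1}; x \<in> topspace X; y \<in> topspace X; v = -1 \<or> v = 1 \<or> x = p \<and> y = p\<rbrakk> \<Longrightarrow> K (v, x, y) = c"
  shows "K z = K z'"
proof (cases "z = z'")
  case False
  have z: "z \<in> {-1..1} \<times> topspace X \<times> topspace X" "z' \<in> {-1..1} \<times> topspace X \<times> topspace X"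
    using assms(1,2) by auto
  have "K z = c" using E_eq[OF z assms(3) False] z by (cases z) (auto intro!: assms(4))
  moreover have "K z' = c"
    using E_eq[OF z(2,1) assms(3)[symmetric]] False z by (cases z') (auto intro!: assms(4))
  ultimately show ?thesis by simp
qed simp

lemma G_fibres:
  assumes "z \<in> topspace JXX" "z' \<in> topspace JXX" "(\<lambda>(v, x, y). G v x y) z = (\<lambda>(v, x, y). G v x y) z'"
    and K: "\<And>v x y. \<lbrakk>v \<in> {-1..1}; x \<in> topspace X; y \<in> topspace X\<rbrakk> \<Longrightarrow>
       K (v, x, y) = cat3 v (FA (clamp (3 * v + 2)) x) (FN (clamp (3 * v)) x y) (FB (clamp (3 * v - 2)) y)"
    and FA: "\<And>v x. \<lbrakk>v \<in> {-1..1}; x \<in> topspace X; v = -1 \<or> v = 1 \<or> x = p\<rbrakk> \<Longrightarrow> FA v x = c"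
    and FB: "\<And>v x. \<lbrakk>v \<in> {-1..1}; x \<in> topspace X; v = -1 \<or> v = 1 \<or> x = p\<rbrakk> \<Longrightarrow> FB v x = c"
    and FN: "\<And>v x y. \<lbrakk>v \<in> {-1..1}; x \<in> topspace X; y \<in> topspace X; v = -1 \<or> v = 1 \<or> x = p \<or> y = p\<rbrakk> \<Longrightarrow> FN v x y = c"
  shows "K z = K z'"
proof -
  let ?S = "({-1..1} \<times> topspace X) <+> (({-1..1} \<times> topspace X \<times> topspace X) <+> ({-1..1} \<times> topspace X))"
  let ?F = "case_sum (\<lambda>(v, x). FA v x) (case_sum (\<lambda>(v, x, y). FN v x y) (\<lambda>(v, x). FB v x))"
  have KF: "K z = ?F (piece_of z)" if "z \<in> topspace JXX" for z
    using that by (cases z) (auto simp: K piece_of_def cat3_def)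
  have Gz: "(\<lambda>(v, x, y). G v x y) z = pieces (piece_of z)" for z
    by (cases z) (simp only: pieces_piece_of case_prod_conv)
  have S: "piece_of z \<in> ?S" if "z \<in> topspace JXX" for z
    using that by (cases z) (auto intro: piece_of_in)
  have c: "?F s = c" if "s \<in> ?S" "pieces s = bW" for s
  proof -
    from that(1) consider v x where "s = Inl (v, x)" "v \<in> {-1..1}" "x \<in> topspace X"
      | v x y where "s = Inr (Inl (v, x, y))" "v \<in> {-1..1}" "x \<in> topspace X" "y \<in> topspace X"
      | v x where "s = Inr (Inr (v, x))" "v \<in> {-1..1}" "x \<in> topspace X"
      by blast
    then show ?thesis
    proof cases
      case 1 then show ?thesis using that(2) FA A_base by simp
    next
      case 2 then show ?thesis using that(2) FN N_base by simp
    next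
      case 3 then show ?thesis using that(2) FB B_base by simp
    qed
  qed
  have eq: "pieces (piece_of z) = pieces (piece_of z')"
    using assms(3) by (simp only: Gz)
  show ?thesis
  proof (cases "piece_of z = piece_of z'")
    case True
    then show ?thesis using KF assms(1,2) by simp
  next
    case False
    then have "pieces (piece_of z) = bW"
      using pieces_eq[OF S[OF assms(1)] S[OF assms(2)] eq] by simp
    then show ?thesis using eq c S assms(1,2) KF by metis
  qed
qed

abbreviation IJXX :: "(real \<times> real \<times> 'a \<times> 'a) topology" where "IJXX \<equiv> prod_topology unit_interval JXX"

lemma projections4:
  "continuous_map IJXX euclideanreal fst" "continuous_map IJXX J (\<lambda>z. fst (snd z))"
  "continuous_map IJXX X (\<lambda>z. fst (snd (snd z)))" "continuous_map IJXX X (\<lambda>z. snd (snd (snd z)))"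
  "continuous_map IJXX unit_interval fst" "continuous_map IJXX euclideanreal (\<lambda>z. fst (snd z))"
proof -
  show "continuous_map IJXX unit_interval fst" by (rule continuous_map_fst)
  then show "continuous_map IJXX euclideanreal fst" by (rule continuous_map_into_fulltopology)
  show "continuous_map IJXX J (\<lambda>z. fst (snd z))"
    by (rule continuous_map_compose1[OF projections(1) continuous_map_snd])
  then show "continuous_map IJXX euclideanreal (\<lambda>z. fst (snd z))" by (rule continuous_map_into_fulltopology)
qed (rule continuous_map_compose1[OF projections(2) continuous_map_snd],
  rule continuous_map_compose1[OF projections(3) continuous_map_snd])

definition unpinch :: "real \<times> 'a \<times> 'a \<Rightarrow> 'p" where
  "unpinch z = (case z of (v, x, y) \<Rightarrow>
     cat3 v (E (clamp (3 * v + 2)) x p) (unpinch_norm 1 (clamp (3 * v)) x y) (E (clamp (3 * v - 2)) p y))"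

text \<open>Pinching and then applying the inverse gives \<open>(x, *) (x', *)\<^sup>-\<^sup>1 (x', y') (*, y')\<^sup>-\<^sup>1 (*, y)\<close>, truncated. Once
  the outer loops have been moved to \<open>(x', *)\<close> and \<open>(*, y')\<close>, they are cancelled by lowering their common
  turning point \<open>m = 1 - 2t\<close>. Here only the common base point of \<open>x\<close> and \<open>y\<close> has to be respected, so the
  truncations of \<open>unpinch_norm\<close> may be undone on the way. The last stage reparametrises and reverses the
  contraction.\<close>

lemma unpinch_homotopic_E: "fibre_homotopic JXX (\<lambda>(v, x, y). E v x y) P unpinch (\<lambda>(v, x, y). E v x y)"
proof -
  let ?E = "\<lambda>(v, x, y). E v x y"
  let ?F1 = "\<lambda>(v, x, y). cat3 v (E (clamp (3 * v + 2)) (retr x) p) (unpinch_norm 1 (clamp (3 * v)) x y) (E (clamp (3 * v - 2)) p (retr y))"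
  let ?F2 = "\<lambda>(v, x, y). E (clamp (9 * v)) (retr x) (retr y)"
  note ptop = continuous_map_canonical_const continuous_map_const[THEN iffD2, OF disjI2, OF p]
  note facts = p retr_in retr_p h_in h_p bases unpinch_norm_bases
  have 1: "fibre_homotopic JXX ?E P unpinch ?F1"
  proof (rule fibre_homotopicI)
    let ?K = "\<lambda>z. cat3 (fst (snd z)) (E (clamp (3 * fst (snd z) + 2)) (h (fst z, fst (snd (snd z)))) p)
      (unpinch_norm 1 (clamp (3 * fst (snd z))) (fst (snd (snd z))) (snd (snd (snd z))))
      (E (clamp (3 * fst (snd z) - 2)) p (h (fst z, snd (snd (snd z)))))"
    show "continuous_map IJXX P ?K"
      by (intro continuous_map_cat3 cont_E unpinch_norm_cont cont_h continuous_map_clamp projections4 ptop continuous_intros)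
        (auto simp: clamp_def facts)
    show "?K (t, z) = ?K (t, z')" if "t \<in> {0..1}" "z \<in> topspace JXX" "z' \<in> topspace JXX" "?E z = ?E z'" for t z z'
      by (rule E_fibres[OF that(2,3,4), where c = bP]) (use that(1) in \<open>auto simp: clamp_def cat3_def facts\<close>)
  qed (auto simp: unpinch_def h_0 retr_def)
  have 2: "fibre_homotopic JXX ?E P ?F1 ?F2"
  proof (rule fibre_homotopicI)
    let ?K = "\<lambda>z. cat3 (fst (snd z)) (E (min (1 - 2 * fst z) (clamp (3 * fst (snd z) + 2))) (retr (fst (snd (snd z)))) p)
      (unpinch_norm (1 - 2 * fst z) (clamp (3 * fst (snd z))) (fst (snd (snd z))) (snd (snd (snd z))))
      (E (max (- (1 - 2 * fst z)) (clamp (3 * fst (snd z) - 2))) p (retr (snd (snd (snd z)))))"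
    show "continuous_map IJXX P ?K"
      by (intro continuous_map_cat3 cont_E unpinch_norm_cont cont_retr continuous_map_clamp continuous_map_into_Icc projections4 ptop continuous_intros
           continuous_map_J_real[OF continuous_map_clamp])
        (auto simp: clamp_def facts min_le_iff_disj le_max_iff_disj)
    show "?K (t, z) = ?K (t, z')" if "t \<in> {0..1}" "z \<in> topspace JXX" "z' \<in> topspace JXX" "?E z = ?E z'" for t z z'
      by (rule E_fibres[OF that(2,3,4), where c = bP])
        (use that(1) in \<open>auto simp: clamp_def cat3_def facts min_le_iff_disj le_max_iff_disj\<close>)
    show "?K (0, z) = ?F1 z" for z
      by (cases z) (simp add: min_absorb2 max_absorb2)
    show "?K (1, z) = ?F2 z" if "z \<in> topspace JXX" for z
    proof -
      obtain v x y where z: "z = (v, x, y)" by (cases z)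
      have vxy: "-1 \<le> v" "v \<le> 1" "x \<in> topspace X" "y \<in> topspace X" "retr x \<in> topspace X" "retr y \<in> topspace X"
        using that z retr_in by auto
      have "unpinch_norm (-1) u x y = E (clamp (3 * u)) (retr x) (retr y)" if "-1 \<le> u" "u \<le> 1" for u
      proof -
        have "min (-1) (max (- clamp (3 * u + 2)) (lower y)) = -1" "max 1 (min (- clamp (3 * u - 2)) (upper x)) = 1"
          "max (min (-1) (lower y)) (min (clamp (3 * u)) (max 1 (upper x))) = clamp (3 * u)"
          using lower_range[OF vxy(4)] upper_range[OF vxy(3)] by (auto simp: min_absorb1 max_absorb1 min_le_iff_disj le_max_iff_disj)
        then have "unpinch_norm (-1) u x y = cat3 u (E (-1) (retr x) p) (E (clamp (3 * u)) (retr x) (retr y)) (E 1 p (retr y))"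
          by (simp add: unpinch_norm_def)
        then show ?thesis using vxy p by (simp add: cat3_def bases clamp_le clamp_ge)
      qed
      then have "unpinch_norm (-1) (clamp (3 * v)) x y = E (clamp (9 * v)) (retr x) (retr y)"
        by (simp add: clamp_clamp)
      moreover have "min (-1) (clamp (3 * v + 2)) = -1" "max 1 (clamp (3 * v - 2)) = 1"
        by (auto simp: min_absorb1 max_absorb1)
      ultimately show ?thesis
        using vxy p by (auto simp: z cat3_def bases clamp_le clamp_ge)
    qed
  qed
  have 3: "fibre_homotopic JXX ?E P ?F2 ?E"
  proof (rule fibre_homotopicI)
    let ?K = "\<lambda>z. E (clamp ((9 - 8 * fst z) * fst (snd z))) (h (1 - fst z, fst (snd (snd z)))) (h (1 - fst z, snd (snd (snd z))))"
    show "continuous_map IJXX P ?K"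
      by (intro cont_E cont_h continuous_map_clamp continuous_map_into_Icc projections4 continuous_intros) auto
    show "?K (t, z) = ?K (t, z')" if "t \<in> {0..1}" "z \<in> topspace JXX" "z' \<in> topspace JXX" "?E z = ?E z'" for t z z'
      by (rule E_fibres[OF that(2,3,4), where c = bP]) (use that(1) in \<open>auto simp: clamp_ge clamp_le facts\<close>)
    show "?K (0, z) = ?F2 z" for z by (cases z) (simp add: retr_def)
    show "?K (1, z) = ?E z" if "z \<in> topspace JXX" for z
      using that by (cases z) (auto simp: h_0 clamp_id)
  qed
  from 1 2 3 show ?thesis by (blast intro: fibre_homotopic_trans)
qed

text \<open>The pinch map applied to the loop \<open>unpinch_norm 1\<close>, with the levels confined to \<open>[m, -m]\<close>. Now both
  axes must go to the base point all the time, so the truncation can never be undone. It suffices to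
  let \<open>m\<close> increase from \<open>-1\<close> to \<open>-1/3\<close>: the image of the loop of \<open>(x', *)\<close> runs through the summand \<open>A\<close> below
  the level \<open>-1/3\<close> and is constant above it, and up to this level the loop of \<open>(x', y')\<close> has the same
  image, so that the turning point may be moved even where \<open>y'\<close> is not the base point.\<close>

definition renorm :: "real \<Rightarrow> real \<Rightarrow> 'a \<Rightarrow> 'a \<Rightarrow> 'w" where
  "renorm m v x y = cat3 v
     (G (max (- clamp (3 * v + 2)) (max (lower y) m)) (retr x) p)
     (G (max (max (lower y) m) (min (clamp (3 * v)) (min (upper x) (- m)))) (retr x) (retr y))
     (G (min (- clamp (3 * v - 2)) (min (upper x) (- m))) p (retr y))"

lemma renorm_cont:
  assumes m: "continuous_map Z J m" and v: "continuous_map Z J v" and x: "continuous_map Z X x" and y: "continuous_map Z X y"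
    and m_le: "\<And>z. z \<in> topspace Z \<Longrightarrow> m z \<le> -1/3"
  shows "continuous_map Z W (\<lambda>z. renorm (m z) (v z) (x z) (y z))"
  unfolding renorm_def
proof (rule continuous_map_cat3)
  note c = continuous_map_J_real[OF m] continuous_map_J_real[OF v] cont_lower[OF y] cont_upper[OF x] 
    continuous_map_J_real[OF continuous_map_clamp]
  note ins = in_J[OF m] in_J[OF v] lower_range[OF in_X[OF y]] upper_range[OF in_X[OF x]]
  show "continuous_map Z euclideanreal v" by (rule c)
  show "continuous_map Z W (\<lambda>z. G (max (- clamp (3 * v z + 2)) (max (lower (y z)) (m z))) (retr (x z)) p)"
    by (intro cont_G cont_retr x y continuous_map_into_Icc continuous_intros c)
      (use p ins in \<open>auto simp: min_le_iff_disj le_max_iff_disj\<close>)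
  show "continuous_map Z W (\<lambda>z. G (max (max (lower (y z)) (m z)) (min (clamp (3 * v z)) (min (upper (x z)) (- m z)))) (retr (x z)) (retr (y z)))"
    by (intro cont_G cont_retr x y continuous_map_into_Icc continuous_intros c)
      (use p ins in \<open>auto simp: min_le_iff_disj le_max_iff_disj\<close>)
  show "continuous_map Z W (\<lambda>z. G (min (- clamp (3 * v z - 2)) (min (upper (x z)) (- m z))) p (retr (y z)))"
    by (intro cont_G cont_retr x y continuous_map_into_Icc continuous_intros c)
      (use p ins in \<open>auto simp: min_le_iff_disj le_max_iff_disj\<close>)
  fix z assume z: "z \<in> topspace Z"
  let ?x = "retr (x z)" and ?y = "retr (y z)" and ?a = "max (lower (y z)) (m z)" and ?e = "min (upper (x z)) (- m z)"
  note xy = in_X[OF x z] in_X[OF y z]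
  have xy': "?x \<in> topspace X" "?y \<in> topspace X" using retr_in xy by auto
  have m': "m z \<le> -1/3" "-1 \<le> m z" using m_le[OF z] in_J[OF m z] by auto
  have ra: "-1 \<le> lower (y z)" "lower (y z) \<le> 1" "-1 \<le> upper (x z)" "upper (x z) \<le> 1" "-1 \<le> ?a" "?a \<le> 1" "-1 \<le> ?e" "?e \<le> 1"
    using m' lower_range[OF xy(2)] upper_range[OF xy(1)] by auto
  have ya: "lower (y z) > -1 \<Longrightarrow> ?y = p" and xe: "upper (x z) < 1 \<Longrightarrow> ?x = p"
    using retr_eq_p xy by auto
  have "G ?a ?x p = G ?a ?x ?y"
  proof (cases "lower (y z) > -1")
    case False
    then have "?a = m z" using ra m' by simp
    then show ?thesis using m' by (simp add: G_left)
  qed (simp add: ya)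
  moreover have "max (-1) ?a = ?a" "max ?a (min (-1) ?e) = ?a"
    using ra by auto
  ultimately show "G (max (- clamp (3 * v z + 2)) ?a) ?x p = G (max ?a (min (clamp (3 * v z)) ?e)) ?x ?y" if "v z = -1/3"
    using that by (simp add: clamp_def)
  have "G (max ?a ?e) ?x ?y = G ?e p ?y"
  proof (cases "?a \<le> ?e")
    case True
    moreover have "G ?e ?x ?y = G ?e p ?y"
    proof (cases "upper (x z) < 1")
      case False
      then have "?e = - m z" using ra m' by simp
      then show ?thesis using m' xy' p by (simp add: G_right)
    qed (simp add: xe)
    ultimately show ?thesis by (simp add: max_absorb2)
  next
    case False
    then have max: "max ?a ?e = ?a" by (intro max_absorb1) linarith
    consider "?x = p" "?y = p" | "lower (y z) > -1" "upper (x z) = 1" | "lower (y z) = -1"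
      using ya xe ra by linarith
    then show ?thesis
    proof cases
      case 1 then show ?thesis by (simp add: G_p_p)
    next
      case 2
      then have "?e = - m z" using m' by simp
      then have "?a > 1/3" using False m' by linarith
      then show ?thesis unfolding max using 2 ya xy' by (simp add: G_p_p G_p_right)
    next
      case 3
      then have am: "?a = m z" using m' by simp
      then have e: "?e < m z" using False by linarith
      then have "upper (x z) < 1" using m' by (simp add: min_less_iff_disj)
      then have "?x = p" using xe by simp
      moreover have "?e \<le> 1/3" using e m' by linarith
      ultimately show ?thesis unfolding max am using m' xy' by (simp add: G_p_left)
    qed
  qed
  moreover have "min 1 ?e = ?e" using ra by simp
  ultimately show "G (max ?a (min (clamp (3 * v z)) ?e)) ?x ?y = G (min (- clamp (3 * v z - 2)) ?e) p ?y" if "v z = 1/3"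
    using that by (simp add: clamp_def)
qed

lemma renorm_base:
  assumes m: "-1 \<le> m" "m \<le> -1/3" and x: "x \<in> topspace X" and y: "y \<in> topspace X"
    and b: "v = -1 \<or> v = 1 \<or> x = p \<or> y = p"
  shows "renorm m v x y = bW"
proof -
  let ?a = "max (lower y) m" and ?e = "min (upper x) (- m)"
  note rx = retr_in[OF x] retr_in[OF y] p retr_p lower_range[OF x] upper_range[OF x] lower_range[OF y] upper_range[OF y] lower_p upper_p
  have ra: "-1 \<le> ?a" "?a \<le> 1" "-1 \<le> ?e" "?e \<le> 1" using m rx by auto
  from b consider "v = -1" | "v = 1" | "x = p" | "y = p" by blast
  then show ?thesis
  proof cases
    case 1
    have "max 1 ?a = 1" using ra by simp
    then show ?thesis using 1 rx by (simp add: renorm_def cat3_def clamp_def G_ends)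
  next
    case 2
    have "min (-1) ?e = -1" using ra by simp
    then show ?thesis using 2 rx by (simp add: renorm_def cat3_def clamp_def G_ends)
  next
    case 3
    then have e: "?e = -1" using upper_p m by simp
    have "max ?a (min (clamp (3 * v)) (-1)) = ?a" using ra by (simp add: min_absorb2)
    moreover have "G ?a p (retr y) = bW"
    proof (cases "lower y = -1")
      case True
      then have "?a = m" using m by simp
      then show ?thesis using m rx by (simp add: G_p_left)
    next
      case False
      then have "retr y = p" using retr_eq_p(1)[OF y] rx by linarith
      then show ?thesis by (simp add: G_p_p)
    qed
    moreover have "min (- clamp (3 * v - 2)) (-1) = -1" by (simp add: min_absorb2)
    ultimately show ?thesis using rx 3 unfolding renorm_def e by (simp add: cat3_def G_ends G_p_p)
  next
    case 4
    then have a: "?a = 1" using lower_p m by simp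
    have "max (- clamp (3 * v + 2)) 1 = 1" "max 1 (min (clamp (3 * v)) ?e) = 1"
      using clamp_range(1)[of "3 * v + 2"] by (auto simp: min_le_iff_disj)
    then show ?thesis using rx 4 unfolding renorm_def a by (simp add: cat3_def G_ends G_p_p)
  qed
qed

lemma \<eta>_unpinch_norm:
  assumes "x \<in> topspace X" "y \<in> topspace X"
  shows "\<eta> (unpinch_norm 1 v x y) = renorm (-1) v x y"
proof -
  note rx = retr_in[OF assms(1)] retr_in[OF assms(2)] p lower_range[OF assms(2)] upper_range[OF assms(1)]
  have 1: "max (lower y) (-1) = lower y" "min (upper x) 1 = upper x" "max (-1) (upper x) = upper x" "min 1 (lower y) = lower y"
    "min 1 (max (- clamp (3 * v + 2)) (lower y)) = max (- clamp (3 * v + 2)) (lower y)"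
    "max (-1) (min (- clamp (3 * v - 2)) (upper x)) = min (- clamp (3 * v - 2)) (upper x)"
    using rx clamp_range(1)[of "3 * v + 2"] clamp_range(2)[of "3 * v - 2"]
    by (auto simp: min_absorb2 max_absorb2)
  have "-1 \<le> max (- clamp (3 * v + 2)) (lower y)" "max (- clamp (3 * v + 2)) (lower y) \<le> 1"
    "-1 \<le> max (lower y) (min (clamp (3 * v)) (upper x))" "max (lower y) (min (clamp (3 * v)) (upper x)) \<le> 1"
    "-1 \<le> min (- clamp (3 * v - 2)) (upper x)" "min (- clamp (3 * v - 2)) (upper x) \<le> 1"
    using rx clamp_range(1)[of "3 * v + 2"] clamp_range(2)[of "3 * v - 2"]
    by (auto simp: min_le_iff_disj le_max_iff_disj)
  then show ?thesis
    using rx by (simp add: unpinch_norm_def renorm_def 1 cat3_def \<eta>_E_eq_G)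
qed

lemma renorm_end:
  assumes x: "x \<in> topspace X" and y: "y \<in> topspace X"
  shows "renorm (-1/3) v x y = N (clamp (9 * v)) (retr x) (retr y)"
proof -
  let ?a = "max (lower y) (-1/3)" and ?e = "min (upper x) (1/3)"
  note rx = retr_in[OF x] retr_in[OF y] p lower_range[OF y] upper_range[OF x]
  consider "v \<le> -1/3" | "v > 1/3" | "-1/3 < v" "v \<le> 1/3" by linarith
  then show ?thesis
  proof cases
    case 1
    then show ?thesis using rx by (simp add: renorm_def cat3_def clamp_le bases G_p_right le_max_iff_disj)
  next
    case 2
    then show ?thesis using rx by (simp add: renorm_def cat3_def clamp_ge bases G_p_left min_le_iff_disj)
  next
    case 3
    define k where "k = max ?a (min (clamp (3 * v)) ?e)"
    have unpinch_norm: "renorm (-1/3) v x y = G k (retr x) (retr y)"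
      using 3 by (simp add: renorm_def cat3_def k_def)
    have k: "k \<ge> -1/3" by (simp add: k_def)
    show ?thesis
    proof (cases "retr y = p")
      case True
      then show ?thesis unfolding unpinch_norm using k rx by (simp add: G_p_right bases)
    next
      case False
      then have "lower y = -1" using retr_eq_p(1)[OF y] rx by force
      then have a: "?a = -1/3" by simp
      then have k': "k \<le> 1/3" by (simp add: k_def min_le_iff_disj)
      show ?thesis
      proof (cases "retr x = p")
        case True
        then show ?thesis unfolding unpinch_norm using k' rx by (simp add: G_p_left bases)
      next
        case False
        then have "upper x = 1" using retr_eq_p(2)[OF x] rx by force
        then have e: "?e = 1/3" by simp
        have "clamp (3 * k) = clamp (9 * v)" using 3 unfolding k_def a e clamp_def by (simp add: min_def max_def)
        then show ?thesis unfolding unpinch_norm using k k' rx by (simp add: G_mid)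
      qed
    qed
  qed
qed

text \<open>On the summands \<open>A\<close> and \<open>B\<close> the composite is the loop followed or preceded by constant paths, and
  only a reparametrisation is needed.\<close>

lemma \<eta>_unpinch_homotopic_G:
  "fibre_homotopic JXX (\<lambda>(v, x, y). G v x y) W (\<lambda>z. \<eta> (unpinch z)) (\<lambda>(v, x, y). G v x y)"
proof -
  let ?G = "\<lambda>(v, x, y). G v x y"
  let ?F1 = "\<lambda>(v, x, y). cat3 v (A (clamp (3 * v + 2)) x) (N (clamp (9 * clamp (3 * v))) (retr x) (retr y)) (B (clamp (3 * v - 2)) y)"
  note facts = p retr_in retr_p h_in h_p bases
  have 1: "fibre_homotopic JXX ?G W (\<lambda>z. \<eta> (unpinch z)) ?F1"
  proof (rule fibre_homotopicI)
    let ?A = "\<lambda>t u. clamp ((3 - 2 * t) * u + 2 - 2 * t)" and ?B = "\<lambda>t u. clamp ((3 - 2 * t) * u - 2 + 2 * t)"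
    let ?K = "\<lambda>z. cat3 (fst (snd z)) (A (?A (fst z) (clamp (3 * fst (snd z) + 2))) (fst (snd (snd z))))
      (renorm (2/3 * fst z - 1) (clamp (3 * fst (snd z))) (fst (snd (snd z))) (snd (snd (snd z))))
      (B (?B (fst z) (clamp (3 * fst (snd z) - 2))) (snd (snd (snd z))))"
    show "continuous_map IJXX W ?K"
      by (intro continuous_map_cat3 cont_A cont_B renorm_cont continuous_map_clamp continuous_map_into_Icc projections4 continuous_intros
           continuous_map_J_real[OF continuous_map_clamp])
        (auto simp: facts renorm_base clamp_le clamp_ge)
    show "?K (t, z) = ?K (t, z')" if t: "t \<in> {0..1}" and "z \<in> topspace JXX" "z' \<in> topspace JXX" "?G z = ?G z'" for t z z'
    proof (rule G_fibres[OF that(2,3,4), where c = bW and FA = "\<lambda>v x. A (?A t v) x" and FB = "\<lambda>v x. B (?B t v) x" and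
          FN = "renorm (2/3 * t - 1)"])
      show "renorm (2/3 * t - 1) v x y = bW" if "x \<in> topspace X" "y \<in> topspace X" "v = - 1 \<or> v = 1 \<or> x = p \<or> y = p" for v x y
        using that t by (intro renorm_base) auto
      show "A (?A t v) x = bW" if "x \<in> topspace X" "v = - 1 \<or> v = 1 \<or> x = p" for v x
        using that t by (auto simp: facts clamp_le clamp_ge)
      show "B (?B t v) x = bW" if "x \<in> topspace X" "v = - 1 \<or> v = 1 \<or> x = p" for v x
        using that t by (auto simp: facts clamp_le clamp_ge)
    qed simp
    show "?K (0, z) = \<eta> (unpinch z)" if "z \<in> topspace JXX" for z
    proof -
      have "G u x p = A (clamp (3 * u + 2)) x" if "x \<in> topspace X" for u x
        using that by (cases "u \<le> -1/3") (auto simp: G_left G_p_right facts clamp_ge)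
      moreover have "G u p x = B (clamp (3 * u - 2)) x" if "x \<in> topspace X" for u x
        using that by (cases "1/3 \<le> u") (auto simp: G_right G_p_left facts clamp_le)
      ultimately show ?thesis
        using that p by (cases z) (auto simp: unpinch_def cat3_def \<eta>_unpinch_norm \<eta>_E_eq_G)
    qed
    show "?K (1, z) = ?F1 z" if "z \<in> topspace JXX" for z
      using that renorm_end by (cases z) (auto simp: cat3_def clamp_id)
  qed
  have 2: "fibre_homotopic JXX ?G W ?F1 ?G"
  proof (rule fibre_homotopicI)
    let ?N = "\<lambda>t u x y. N (clamp ((9 - 8 * t) * u)) (h (1 - t, x)) (h (1 - t, y))"
    let ?K = "\<lambda>z. cat3 (fst (snd z)) (A (clamp (3 * fst (snd z) + 2)) (fst (snd (snd z))))
      (?N (fst z) (clamp (3 * fst (snd z))) (fst (snd (snd z))) (snd (snd (snd z))))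
      (B (clamp (3 * fst (snd z) - 2)) (snd (snd (snd z))))"
    show "continuous_map IJXX W ?K"
      by (intro continuous_map_cat3 cont_A cont_B cont_N cont_h continuous_map_clamp continuous_map_into_Icc projections4 continuous_intros
           continuous_map_J_real[OF continuous_map_clamp])
        (auto simp: facts clamp_le clamp_ge)
    show "?K (t, z) = ?K (t, z')" if t: "t \<in> {0..1}" and "z \<in> topspace JXX" "z' \<in> topspace JXX" "?G z = ?G z'" for t z z'
      by (rule G_fibres[OF that(2,3,4), where c = bW and FA = A and FB = B and FN = "?N t"])
        (use t in \<open>auto simp: facts clamp_le clamp_ge\<close>)
    show "?K (0, z) = ?F1 z" for z by (cases z) (simp add: retr_def)
    show "?K (1, z) = ?G z" if "z \<in> topspace JXX" for z
      using that by (cases z) (auto simp: h_0 clamp_id G_def)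
  qed
  from 1 2 show ?thesis by (rule fibre_homotopic_trans)
qed

lemma homotopy_inverse:
  obtains \<zeta> where "continuous_map W P \<zeta>"
    "homotopic_with (\<lambda>_. True) P P (\<zeta> \<circ> \<eta>) id" "homotopic_with (\<lambda>_. True) W W (\<eta> \<circ> \<zeta>) id"
proof -
  let ?G = "\<lambda>(v, x, y). G v x y" and ?E = "\<lambda>(v, x, y). E v x y"
  note facts = p retr_in bases unpinch_norm_bases
  note ptop = continuous_map_const[THEN iffD2, OF disjI2, OF p]
  have c: "continuous_map JXX P unpinch"
    using unpinch_homotopic_E unfolding fibre_homotopic_def by (blast dest: homotopic_with_imp_continuous_maps)
  have "unpinch z = unpinch z'" if "z \<in> topspace JXX" "z' \<in> topspace JXX" "?G z = ?G z'" for z z'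
    by (rule G_fibres[OF that, where c = bP and FA = "\<lambda>v x. E v x p" and FB = "\<lambda>v y. E v p y" and FN = "unpinch_norm 1"])
      (auto simp: unpinch_def facts)
  then obtain \<zeta> where \<zeta>: "continuous_map W P \<zeta>" "\<And>z. z \<in> topspace JXX \<Longrightarrow> \<zeta> (?G z) = unpinch z"
    using quotient_map_lift_exists[OF G_quotient c] by metis
  have "homotopic_with (\<lambda>_. True) P P (\<zeta> \<circ> \<eta>) id"
    by (rule fibre_homotopic_imp_homotopic[OF E_quotient unpinch_homotopic_E])
      (use \<zeta>(2) in \<open>auto simp: \<eta>_E_eq_G\<close>)
  moreover have "homotopic_with (\<lambda>_. True) W W (\<eta> \<circ> \<zeta>) id"
    by (rule fibre_homotopic_imp_homotopic[OF G_quotient \<eta>_unpinch_homotopic_G])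
      (use \<zeta>(2) in auto)
  ultimately show thesis using \<zeta>(1) that by blast
qed

theorem pinch_weak_equivalence: "weak_equivalence P W \<eta>"
  using homotopy_inverse homotopy_equivalence_imp_weak_equivalence[OF \<eta>_cont] by metis

end

section \<open>Collapsing\<close>

lemma quotient_map_collapse: "quotient_map X (collapse X A) (collapse_proj A)"
  unfolding collapse_def by (rule quotient_map_quotient_topology)

lemma topspace_collapse [simp]: "topspace (collapse X A) = collapse_proj A ` topspace X"
  by (simp add: collapse_def)

lemma openin_collapse:
  assumes "U \<subseteq> topspace (collapse X A)"
  shows "openin (collapse X A) U \<longleftrightarrow> openin X {x \<in> topspace X. collapse_proj A x \<in> U}"
  using assms by (simp add: collapse_def openin_quotient_topology)

lemma collapse_proj_eq_iff: "collapse_proj A x = collapse_proj A y \<longleftrightarrow> x = y \<or> x \<in> A \<and> y \<in> A"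
  by (auto simp: collapse_proj_def)

lemma collapse_proj_eq_base_iff: "collapse_proj A x = A \<longleftrightarrow> x \<in> A"
  by (auto simp: collapse_proj_def)

lemma in_axes_iff: "(x, y) \<in> axes X Y \<longleftrightarrow> x \<in> topspace (Top X) \<and> y = pt Y \<or> x = pt X \<and> y \<in> topspace (Top Y)"
  by (auto simp: axes_def)

lemma Top_smash: "Top (smash X Y) = collapse (prod_topology (Top X) (Top Y)) (axes X Y)"
  and pt_smash: "pt (smash X Y) = axes X Y"
  and act_smash: "act (smash X Y) g = collapse_map (axes X Y) (map_prod (act X g) (act Y g))"
  by (simp_all add: smash_def)

lemma Top_wedge: "Top (wedge X Y) = collapse (coproduct_topology (Top X) (Top Y)) {Inl (pt X), Inr (pt Y)}"
  and pt_wedge: "pt (wedge X Y) = {Inl (pt X), Inr (pt Y)}"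
  and act_wedge: "act (wedge X Y) g = collapse_map {Inl (pt X), Inr (pt Y)} (map_sum (act X g) (act Y g))"
  by (simp_all add: wedge_def)

lemma Top_S: "Top S_one = Alexandroff_compactification euclideanreal" "Top S_sigma = Alexandroff_compactification euclideanreal"
  and pt_S: "pt S_one = None" "pt S_sigma = None"
  and act_S_one: "act S_one g = id"
  by (simp_all add: S_one_def S_sigma_def)

lemma topspace_S: "topspace (Alexandroff_compactification euclideanreal) = UNIV"
  by (auto simp: notin_range_Some)

lemma Top_C2_plus: "Top C2_plus = discrete_topology UNIV" and pt_C2_plus: "pt C2_plus = None"
  and act_C2_plus: "act C2_plus g = map_option ((+) g)"
  by (simp_all add: C2_plus_def)

lemma Top_Map: "Top (Map_C2 X) = product_topology (\<lambda>_. Top X) UNIV" and pt_Map: "pt (Map_C2 X) = (\<lambda>_. pt X)"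
  and act_Map: "act (Map_C2 X) g u h = act X g (u (- g + h))"
  by (simp_all add: Map_C2_def)

lemma topspace_Map: "u \<in> topspace (Top (Map_C2 X)) \<longleftrightarrow> (\<forall>h. u h \<in> topspace (Top X))"
  by (auto simp: Top_Map PiE_iff)

lemma Top_Norm: "Top (Norm_C2 X) = collapse (Top (Map_C2 X)) (hits_pt X)" and pt_Norm: "pt (Norm_C2 X) = hits_pt X"
  and act_Norm: "act (Norm_C2 X) g = collapse_map (hits_pt X) (act (Map_C2 X) g)"
  by (simp_all add: Norm_C2_def)

section \<open>The circle as a quotient of an interval\<close>

text \<open>\<open>line\<close> stretches the open interval \<open>(-1, 1)\<close> to the real line and sends everything else to infinity;
  it commutes with the sign. The value \<open>1\<close> of \<open>unline\<close> at infinity is one of two possible choices.\<close>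

definition line :: "real \<Rightarrow> real option" where
  "line v = (if \<bar>v\<bar> < 1 then Some (v / (1 - \<bar>v\<bar>)) else None)"

definition unline :: "real option \<Rightarrow> real" where
  "unline s = (case s of None \<Rightarrow> 1 | Some t \<Rightarrow> t / (1 + \<bar>t\<bar>))"

lemma unline_line: "\<bar>v\<bar> < 1 \<Longrightarrow> unline (line v) = v"
proof -
  assume v: "\<bar>v\<bar> < 1"
  then have "1 + \<bar>v / (1 - \<bar>v\<bar>)\<bar> = 1 / (1 - \<bar>v\<bar>)" by (simp add: field_simps)
  then show ?thesis using v by (simp add: line_def unline_def)
qed

lemma unline_lt: "\<bar>t / (1 + \<bar>t\<bar>)\<bar> < (1::real)"
  by (simp add: field_simps)

lemma line_unline: "line (unline s) = s"
proof (cases s)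
  case (Some t)
  have "1 - \<bar>t / (1 + \<bar>t\<bar>)\<bar> = 1 / (1 + \<bar>t\<bar>)" by (simp add: field_simps)
  then show ?thesis using unline_lt[of t] by (simp add: Some line_def unline_def)
qed (simp add: unline_def line_def)

lemma unline_range: "-1 \<le> unline s" "unline s \<le> 1"
proof -
  have "\<bar>unline s\<bar> \<le> 1"
  proof (cases s)
    case (Some t)
    then show ?thesis unfolding Some unline_def option.case using unline_lt[of t] by linarith
  qed (simp add: unline_def)
  then show "-1 \<le> unline s" "unline s \<le> 1" by linarith+
qed

lemma line_eq_None: "line v = None \<longleftrightarrow> \<bar>v\<bar> \<ge> 1" by (auto simp: line_def)

lemma line_eq_iff: "line v = line w \<longleftrightarrow> v = w \<or> \<bar>v\<bar> \<ge> 1 \<and> \<bar>w\<bar> \<ge> 1"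
proof
  assume eq: "line v = line w"
  show "v = w \<or> \<bar>v\<bar> \<ge> 1 \<and> \<bar>w\<bar> \<ge> 1"
  proof (cases "\<bar>v\<bar> < 1")
    case True
    then have "\<bar>w\<bar> < 1" using eq by (auto simp: line_def split: if_splits)
    then show ?thesis using True eq unline_line by metis
  next
    case False
    then show ?thesis using eq line_eq_None by (metis not_less)
  qed
qed (auto simp: line_def)

lemma line_clamp: "line (clamp t) = line t" "line (- clamp t) = line (- t)"
  unfolding line_eq_iff by (auto simp: clamp_def)

lemma act_S_sigma_line: "act S_sigma g (line v) = line (if g = 0 then v else - v)"
  by (auto simp: S_sigma_def line_def)

lemma continuous_map_line: "continuous_map J (Alexandroff_compactification euclideanreal) line"
  unfolding continuous_map_def
proof (intro conjI allI impI)
  show "line \<in> topspace J \<rightarrow> topspace (Alexandroff_compactification euclideanreal)"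
    unfolding topspace_S by auto
  fix U assume "openin (Alexandroff_compactification euclideanreal) U"
  then consider V where "open V" "U = Some ` V" | C where "compact C" "U = insert None (Some ` (UNIV - C))"
    by (auto simp: openin_Alexandroff_compactification)
  then show "openin J {v \<in> topspace J. line v \<in> U}"
  proof cases
    case 1
    have "continuous_on {-1<..<1} (\<lambda>v::real. v / (1 - \<bar>v\<bar>))"
      by (intro continuous_intros) auto
    then have "open ((\<lambda>v. v / (1 - \<bar>v\<bar>)) -` V \<inter> {-1<..<1::real})"
      using 1 by (simp add: continuous_on_open_vimage)
    moreover have "{v \<in> topspace J. line v \<in> U} = {-1..1} \<inter> ((\<lambda>v. v / (1 - \<bar>v\<bar>)) -` V \<inter> {-1<..<1})"
      using 1 by (auto simp: line_def abs_less_iff split: if_splits)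
    ultimately show ?thesis by (simp add: openin_open_Int)
  next
    case 2
    have "continuous_on C (\<lambda>t::real. t / (1 + \<bar>t\<bar>))"
      by (intro continuous_intros) auto
    then have "closed ((\<lambda>t. t / (1 + \<bar>t\<bar>)) ` C)"
      using 2 by (intro compact_imp_closed compact_continuous_image)
    moreover have "{v \<in> topspace J. line v \<in> U} = {-1..1} \<inter> - ((\<lambda>t. t / (1 + \<bar>t\<bar>)) ` C)"
    proof -
      have "line v \<in> U \<longleftrightarrow> v \<notin> (\<lambda>t. t / (1 + \<bar>t\<bar>)) ` C" for v
      proof -
        have "line v \<notin> U \<longleftrightarrow> (\<exists>t\<in>C. line v = Some t)" using 2 by (cases "line v") auto
        also have "\<dots> \<longleftrightarrow> (\<exists>t\<in>C. v = unline (Some t))"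
          by (metis line_unline unline_line line_eq_None not_less option.distinct(1))
        finally show ?thesis by (auto simp: unline_def)
      qed
      then show ?thesis by auto
    qed
    ultimately show ?thesis using openin_open_Int[OF open_Compl] by metis
  qed
qed

lemma Hausdorff_S: "Hausdorff_space (Alexandroff_compactification euclideanreal)"
  unfolding Hausdorff_space_Alexandroff_compactification
  by (simp add: Hausdorff_space_euclidean locally_compact_space_euclidean)

lemma compact_J: "compact_space J" by (simp add: compact_space_subtopology)

lemma J_locally_compact: "locally_compact_space J" and J_Hausdorff: "Hausdorff_space J"
  by (rule compact_imp_locally_compact_space[OF compact_J], intro Hausdorff_space_subtopology Hausdorff_space_euclidean)

text \<open>The map \<open>line\<close> is proper, and proper maps stay closed after taking the product with any space,
  locally compact or not.\<close>

lemma quotient_map_line_prod: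
  "quotient_map (prod_topology J Z) (prod_topology (Alexandroff_compactification euclideanreal) Z) (\<lambda>(v, z). (line v, z))"
proof -
  have "proper_map J (Alexandroff_compactification euclideanreal) line"
    by (rule continuous_imp_proper_map[OF compact_J Hausdorff_imp_kc_space[OF Hausdorff_S] continuous_map_line])
  then have "proper_map (prod_topology J Z) (prod_topology (Alexandroff_compactification euclideanreal) Z) (\<lambda>(v, z). (line v, id z))"
    by (subst proper_map_prod) (auto simp: proper_map_id)
  then have 1: "closed_map (prod_topology J Z) (prod_topology (Alexandroff_compactification euclideanreal) Z) (\<lambda>(v, z). (line v, z))"
    by (auto dest: proper_imp_closed_map)
  have 2: "continuous_map (prod_topology J Z) (prod_topology (Alexandroff_compactification euclideanreal) Z) (\<lambda>(v, z). (line v, z))"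
    unfolding case_prod_unfold
    by (intro continuous_map_pairedI continuous_map_compose1[OF continuous_map_line] continuous_map_fst continuous_map_snd)
  have "s \<in> line ` {-1..1}" for s
    using line_unline[of s] unline_range[of s] by (metis atLeastAtMost_iff imageI)
  then have "(\<lambda>(v, z). (line v, z)) ` topspace (prod_topology J Z) = topspace (prod_topology (Alexandroff_compactification euclideanreal) Z)"
    unfolding topspace_prod_topology topspace_S by (force simp: image_iff)
  with 1 2 show ?thesis by (intro continuous_closed_imp_quotient_map)
qed

lemma quotient_map_smash_line:
  assumes "Top S = Alexandroff_compactification euclideanreal"
  shows "quotient_map (prod_topology J (Top X)) (Top (smash S X)) (\<lambda>(v, x). collapse_proj (axes S X) (line v, x))"
proof -
  have "quotient_map (prod_topology J (Top X)) (Top (smash S X)) (collapse_proj (axes S X) \<circ> (\<lambda>(v, x). (line v, x)))"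
    unfolding Top_smash assms by (rule quotient_map_compose[OF quotient_map_line_prod quotient_map_collapse])
  then show ?thesis by (simp add: o_def case_prod_unfold)
qed

section \<open>The pinch map\<close>

text \<open>Points of the wedge: \<open>loop_piece X h v x\<close> in the circle labelled by \<open>h\<close>, \<open>norm_piece X v u\<close> in the
  suspended norm. The parameter \<open>v\<close> in \<open>[-1, 1]\<close> is the coordinate on the circle or on \<open>S\<^sup>\<sigma>\<close>.\<close>

definition loop_piece :: "'a based_c2_space \<Rightarrow> bit \<Rightarrow> real \<Rightarrow> 'a \<Rightarrow> 'a splitting_point" where
  "loop_piece X h v x = collapse_proj {Inl (pt (smash C2_plus (Susp X))), Inr (pt (Susp_sigma (Norm_C2 X)))}
     (Inl (collapse_proj (axes C2_plus (Susp X)) (Some h, collapse_proj (axes S_one X) (line v, x))))"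

definition norm_piece :: "'a based_c2_space \<Rightarrow> real \<Rightarrow> (bit \<Rightarrow> 'a) \<Rightarrow> 'a splitting_point" where
  "norm_piece X v u = collapse_proj {Inl (pt (smash C2_plus (Susp X))), Inr (pt (Susp_sigma (Norm_C2 X)))}
     (Inr (collapse_proj (axes S_sigma (Norm_C2 X)) (line v, collapse_proj (hits_pt X) u)))"

text \<open>The circle labelled \<open>1\<close> is traversed in the opposite direction, because the action reverses the
  interval but does not act on the circle coordinate of \<open>\<Sigma>X\<close>.\<close>

definition pinch_at :: "'a based_c2_space \<Rightarrow> real \<Rightarrow> (bit \<Rightarrow> 'a) \<Rightarrow> 'a splitting_point" where
  "pinch_at X v u = cat3 v (loop_piece X 1 (- (3 * v + 2)) (u 1)) (norm_piece X (3 * v) u) (loop_piece X 0 (3 * v - 2) (u 0))"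

text \<open>Every representative of the base point of the source goes to the base point of the wedge, so the
  choice made here does not matter (\<open>pinch_susp_point\<close>).\<close>

definition pinch :: "'a based_c2_space \<Rightarrow> (real option \<times> (bit \<Rightarrow> 'a)) set \<Rightarrow> 'a splitting_point" where
  "pinch X z = (case SOME q. q \<in> z of (s, u) \<Rightarrow> pinch_at X (unline s) u)"

definition susp_point :: "'a based_c2_space \<Rightarrow> real \<Rightarrow> (bit \<Rightarrow> 'a) \<Rightarrow> (real option \<times> (bit \<Rightarrow> 'a)) set" where
  "susp_point X v u = collapse_proj (axes S_sigma (Map_C2 X)) (line v, u)"

lemma in_hits_pt: "u \<in> hits_pt X \<longleftrightarrow> u \<in> topspace (Top (Map_C2 X)) \<and> (\<exists>h. u h = pt X)"
  by (simp add: hits_pt_def)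

lemma in_axes_S: "(s, x) \<in> axes S_one X \<longleftrightarrow> x = pt X \<or> s = None \<and> x \<in> topspace (Top X)"
  "(s, x) \<in> axes S_sigma X \<longleftrightarrow> x = pt X \<or> s = None \<and> x \<in> topspace (Top X)"
  "(Some h, y) \<in> axes C2_plus Y \<longleftrightarrow> y = pt Y"
  by (auto simp: in_axes_iff Top_S topspace_S pt_S pt_C2_plus Top_C2_plus simp del: topspace_Alexandroff_compactification)

lemma loop_piece_base: "x \<in> topspace (Top X) \<Longrightarrow>
    loop_piece X h v x = pt (splitting X) \<longleftrightarrow> \<bar>v\<bar> \<ge> 1 \<or> x = pt X"
  by (auto simp: loop_piece_def splitting_def pt_wedge collapse_proj_eq_base_iff in_axes_S pt_smash line_eq_None)

lemma norm_piece_base: "u \<in> topspace (Top (Map_C2 X)) \<Longrightarrow>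
    norm_piece X v u = pt (splitting X) \<longleftrightarrow> \<bar>v\<bar> \<ge> 1 \<or> (\<exists>h. u h = pt X)"
  by (auto simp: norm_piece_def splitting_def pt_wedge collapse_proj_eq_base_iff in_axes_S pt_smash line_eq_None
      pt_Norm in_hits_pt Top_Norm)

lemma loop_piece_eq:
  assumes "x \<in> topspace (Top X)" "y \<in> topspace (Top X)" "loop_piece X h v x = loop_piece X g w y"
  shows "(h = g \<and> v = w \<and> x = y) \<or> loop_piece X h v x = pt (splitting X)"
proof -
  have "(h = g \<and> (v = w \<or> \<bar>v\<bar> \<ge> 1 \<and> \<bar>w\<bar> \<ge> 1) \<and> x = y) \<or> (\<bar>v\<bar> \<ge> 1 \<or> x = pt X)"
    using assms(3) unfolding loop_piece_def collapse_proj_eq_iff sum.inject prod.inject option.inject insert_iff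
      in_axes_S pt_smash collapse_proj_eq_base_iff line_eq_None line_eq_iff by blast
  then show ?thesis using loop_piece_base[OF assms(1)] by blast
qed

lemma norm_piece_eq:
  assumes "u \<in> topspace (Top (Map_C2 X))" "u' \<in> topspace (Top (Map_C2 X))" "norm_piece X v u = norm_piece X w u'"
  shows "(v = w \<and> u = u') \<or> norm_piece X v u = pt (splitting X)"
proof -
  have "((v = w \<or> \<bar>v\<bar> \<ge> 1 \<and> \<bar>w\<bar> \<ge> 1) \<and> u = u') \<or> (\<bar>v\<bar> \<ge> 1 \<or> (\<exists>h. u h = pt X))"
    using assms(3) unfolding norm_piece_def collapse_proj_eq_iff sum.inject prod.inject option.inject insert_iff
      in_axes_S pt_smash collapse_proj_eq_base_iff line_eq_None line_eq_iff pt_Norm in_hits_pt by blast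
  then show ?thesis using norm_piece_base[OF assms(1)] by blast
qed

lemma loop_piece_eq_norm_piece:
  assumes "x \<in> topspace (Top X)" "loop_piece X h v x = norm_piece X w u"
  shows "loop_piece X h v x = pt (splitting X)"
proof -
  have "\<bar>v\<bar> \<ge> 1 \<or> x = pt X"
    using assms(2) unfolding loop_piece_def norm_piece_def collapse_proj_eq_iff insert_iff sum.inject sum.distinct
      in_axes_S pt_smash collapse_proj_eq_base_iff line_eq_None by blast
  then show ?thesis using loop_piece_base[OF assms(1)] by blast
qed

lemma susp_point_base: "u \<in> topspace (Top (Map_C2 X)) \<Longrightarrow>
    susp_point X v u = pt (susp_Map X) \<longleftrightarrow> \<bar>v\<bar> \<ge> 1 \<or> u = (\<lambda>_. pt X)"
  by (auto simp: susp_point_def susp_Map_def pt_smash collapse_proj_eq_base_iff in_axes_S pt_Map line_eq_None)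

lemma susp_point_eq:
  assumes "u \<in> topspace (Top (Map_C2 X))" "susp_point X v u = susp_point X w u'"
  shows "(v = w \<and> u = u') \<or> susp_point X v u = pt (susp_Map X)"
proof -
  have "((v = w \<or> \<bar>v\<bar> \<ge> 1 \<and> \<bar>w\<bar> \<ge> 1) \<and> u = u') \<or> (\<bar>v\<bar> \<ge> 1 \<or> u = (\<lambda>_. pt X))"
    using assms(2) unfolding susp_point_def collapse_proj_eq_iff prod.inject
      in_axes_S line_eq_None line_eq_iff pt_Map by blast
  then show ?thesis using susp_point_base[OF assms(1)] by blast
qed

lemma topspace_susp_Map:
  assumes "z \<in> topspace (Top (susp_Map X))"
  obtains v u where "v \<in> {-1..1}" "u \<in> topspace (Top (Map_C2 X))" "z = susp_point X v u"
proof -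
  obtain s u where su: "u \<in> topspace (Top (Map_C2 X))" "z = collapse_proj (axes S_sigma (Map_C2 X)) (s, u)"
    using assms by (auto simp: susp_Map_def Top_smash)
  show thesis by (rule that[of "unline s" u]) (use su unline_range in \<open>auto simp: susp_point_def line_unline\<close>)
qed

lemma susp_point_in: "u \<in> topspace (Top (Map_C2 X)) \<Longrightarrow> susp_point X v u \<in> topspace (Top (susp_Map X))"
  by (auto simp: susp_point_def susp_Map_def Top_smash Top_S topspace_S simp del: topspace_Alexandroff_compactification)

lemma topspace_splitting:
  assumes "w \<in> topspace (Top (splitting X))" and X: "pt X \<in> topspace (Top X)"
  obtains h v x where "v \<in> {-1..1}" "x \<in> topspace (Top X)" "w = loop_piece X h v x"
    | v u where "v \<in> {-1..1}" "u \<in> topspace (Top (Map_C2 X))" "w = norm_piece X v u"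
proof -
  let ?B = "{Inl (pt (smash C2_plus (Susp X))), Inr (pt (Susp_sigma (Norm_C2 X)))}"
  obtain q where q: "w = collapse_proj ?B q" "q \<in> topspace (Top (smash C2_plus (Susp X))) <+> topspace (Top (Susp_sigma (Norm_C2 X)))"
    using assms(1) by (auto simp: splitting_def Top_wedge)
  show thesis
  proof (cases q)
    case (Inl a)
    then obtain o' s x where a: "x \<in> topspace (Top X)" "a = collapse_proj (axes C2_plus (Susp X)) (o', collapse_proj (axes S_one X) (s, x))"
      using q(2) by (auto simp: Top_smash)
    show thesis
    proof (cases o')
      case None
      have "(None, collapse_proj (axes S_one X) (s, x)) \<in> axes C2_plus (Susp X)"
        using a by (auto simp: in_axes_iff pt_C2_plus Top_smash Top_S topspace_S simp del: topspace_Alexandroff_compactification)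
      then have "a = axes C2_plus (Susp X)" using a None by (simp add: collapse_proj_eq_base_iff)
      then have "w = pt (splitting X)" using q Inl by (simp add: splitting_def pt_wedge pt_smash collapse_proj_eq_base_iff)
      then show thesis using that(1)[of 1 "pt X" 0] X loop_piece_base[OF X, of 0 1] by auto
    next
      case (Some h)
      show thesis by (rule that(1)[of "unline s" x h])
        (use a q Inl Some unline_range in \<open>auto simp: loop_piece_def line_unline\<close>)
    qed
  next
    case (Inr a)
    then obtain s u where a: "u \<in> topspace (Top (Map_C2 X))" "a = collapse_proj (axes S_sigma (Norm_C2 X)) (s, collapse_proj (hits_pt X) u)"
      using q(2) by (auto simp: Top_smash Top_Norm)
    show thesis by (rule that(2)[of "unline s" u])
      (use a q Inr unline_range in \<open>auto simp: norm_piece_def line_unline\<close>)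
  qed
qed

lemma continuous_map_Inl: "continuous_map X (coproduct_topology X Y) Inl"
  and continuous_map_Inr: "continuous_map Y (coproduct_topology X Y) Inr"
proof -
  have "{x \<in> topspace X. Inl x \<in> U} = Inl -` U" if "openin (coproduct_topology X Y) U" for U
    using that openin_subset[of X "Inl -` U"] by (auto simp: openin_coproduct_topology)
  then show "continuous_map X (coproduct_topology X Y) Inl"
    by (auto simp: continuous_map_def openin_coproduct_topology)
  have "{x \<in> topspace Y. Inr x \<in> U} = Inr -` U" if "openin (coproduct_topology X Y) U" for U
    using that openin_subset[of Y "Inr -` U"] by (auto simp: openin_coproduct_topology)
  then show "continuous_map Y (coproduct_topology X Y) Inr"
    by (auto simp: continuous_map_def openin_coproduct_topology)
qed

lemma openin_by_quotient:
  "quotient_map X Y q \<Longrightarrow> U \<subseteq> topspace Y \<Longrightarrow> openin X {x \<in> topspace X. q x \<in> U} \<Longrightarrow> openin Y U"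
  by (simp add: quotient_map_def)

lemma continuous_map_loop_piece:
  "continuous_map (prod_topology J (Top X)) (Top (splitting X)) (\<lambda>(v, x). loop_piece X h v x)"
proof -
  note c = quotient_imp_continuous_map[OF quotient_map_collapse]
  have 1: "continuous_map (prod_topology J (Top X)) (Top (Susp X)) (\<lambda>z. collapse_proj (axes S_one X) (line (fst z), snd z))"
    using quotient_imp_continuous_map[OF quotient_map_smash_line[OF Top_S(1)]] by (simp add: case_prod_unfold)
  have "continuous_map (prod_topology J (Top X)) (Top (smash C2_plus (Susp X)))
     (\<lambda>z. collapse_proj (axes C2_plus (Susp X)) (Some h, collapse_proj (axes S_one X) (line (fst z), snd z)))"
    unfolding Top_smash[of C2_plus]
    by (intro continuous_map_compose1[OF c] continuous_map_pairedI 1) (simp add: Top_C2_plus)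
  then show ?thesis
    unfolding splitting_def Top_wedge loop_piece_def case_prod_unfold
    by (intro continuous_map_compose1[OF c] continuous_map_compose1[OF continuous_map_Inl])
qed

lemma quotient_map_norm_line:
  "quotient_map (prod_topology J (Top (Map_C2 X))) (Top (Susp_sigma (Norm_C2 X)))
     (\<lambda>(v, u). collapse_proj (axes S_sigma (Norm_C2 X)) (line v, collapse_proj (hits_pt X) u))"
proof -
  have "quotient_map (prod_topology J (Top (Map_C2 X))) (prod_topology J (Top (Norm_C2 X))) (\<lambda>(v, u). (v, collapse_proj (hits_pt X) u))"
    unfolding Top_Norm
    by (rule quotient_map_prod_right[OF J_locally_compact disjI1[OF J_Hausdorff] quotient_map_collapse])
  from quotient_map_compose[OF this quotient_map_smash_line[OF Top_S(2)]]
  show ?thesis by (simp add: o_def case_prod_unfold)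
qed

lemma continuous_map_norm_piece:
  "continuous_map (prod_topology J (Top (Map_C2 X))) (Top (splitting X)) (\<lambda>(v, u). norm_piece X v u)"
proof -
  note c = quotient_imp_continuous_map[OF quotient_map_collapse]
  have "continuous_map (prod_topology J (Top (Map_C2 X))) (Top (Susp_sigma (Norm_C2 X)))
     (\<lambda>z. collapse_proj (axes S_sigma (Norm_C2 X)) (line (fst z), collapse_proj (hits_pt X) (snd z)))"
    using quotient_imp_continuous_map[OF quotient_map_norm_line[of X]] by (simp add: case_prod_unfold)
  then show ?thesis
    unfolding splitting_def Top_wedge norm_piece_def case_prod_unfold
    by (intro continuous_map_compose1[OF c] continuous_map_compose1[OF continuous_map_Inr])
qed

text \<open>The iterated collapses and products of the wedge are unwound once and for all: openness is tested
  on the pieces.\<close>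

lemma openin_splitting:
  assumes X: "pt X \<in> topspace (Top X)" and U: "U \<subseteq> topspace (Top (splitting X))"
    and loop: "\<And>h. openin (prod_topology J (Top X)) {z \<in> topspace (prod_topology J (Top X)). (\<lambda>(v, x). loop_piece X h v x) z \<in> U}"
    and norm: "openin (prod_topology J (Top (Map_C2 X))) {z \<in> topspace (prod_topology J (Top (Map_C2 X))). (\<lambda>(v, u). norm_piece X v u) z \<in> U}"
  shows "openin (Top (splitting X)) U"
proof -
  let ?L = "smash C2_plus (Susp X)" and ?R = "Susp_sigma (Norm_C2 X)"
  let ?B = "{Inl (pt ?L), Inr (pt ?R)}"
  let ?Co = "coproduct_topology (Top ?L) (Top ?R)"
  define V where "V = {q \<in> topspace ?Co. collapse_proj ?B q \<in> U}"
  have "openin (Top ?L) (Inl -` V)"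
  proof -
    let ?cl = "collapse_proj (axes C2_plus (Susp X))"
    define VL where "VL = {q \<in> topspace (prod_topology (Top C2_plus) (Top (Susp X))). ?cl q \<in> Inl -` V}"
    have slice: "openin (Top (Susp X)) {y. (o', y) \<in> VL}" for o'
    proof (cases o')
      case None
      \<comment> \<open>everything over the disjoint base point is collapsed\<close>
      have "?cl (None, y) = axes C2_plus (Susp X)" if "y \<in> topspace (Top (Susp X))" for y
        using that by (simp add: collapse_proj_eq_base_iff in_axes_iff pt_C2_plus)
      then have "{y. (None, y) \<in> VL} = (if axes C2_plus (Susp X) \<in> Inl -` V then topspace (Top (Susp X)) else {})"
        by (auto simp: VL_def Top_C2_plus)
      then show ?thesis using None by simp
    next
      case (Some h)
      let ?q = "\<lambda>(v, x). collapse_proj (axes S_one X) (line v, x)"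
      have q: "quotient_map (prod_topology J (Top X)) (Top (Susp X)) ?q"
        by (rule quotient_map_smash_line[OF Top_S(1)])
      have sub: "{y. (o', y) \<in> VL} \<subseteq> topspace (Top (Susp X))" by (auto simp: VL_def)
      have "{z \<in> topspace (prod_topology J (Top X)). ?q z \<in> {y. (o', y) \<in> VL}} =
          {z \<in> topspace (prod_topology J (Top X)). (\<lambda>(v, x). loop_piece X h v x) z \<in> U}"
      proof (rule Collect_cong, rule conj_cong[OF refl])
        fix z assume z: "z \<in> topspace (prod_topology J (Top X))"
        obtain v x where vx: "z = (v, x)" by (cases z)
        have "?q z \<in> topspace (Top (Susp X))"
          using z continuous_map_image_subset_topspace[OF quotient_imp_continuous_map[OF q]] by blast
        then have a: "?q z \<in> topspace (Top (Susp X))" "?cl (Some h, ?q z) \<in> topspace (Top ?L)"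
          by (auto simp: Top_smash[of C2_plus] Top_C2_plus)
        then have "?q z \<in> {y. (o', y) \<in> VL} \<longleftrightarrow> Inl (?cl (Some h, ?q z)) \<in> V"
          by (simp add: VL_def Some Top_C2_plus)
        also have "\<dots> \<longleftrightarrow> collapse_proj ?B (Inl (?cl (Some h, ?q z))) \<in> U"
          using a(2) by (auto simp: V_def)
        also have "\<dots> \<longleftrightarrow> (\<lambda>(v, x). loop_piece X h v x) z \<in> U"
          by (simp add: vx loop_piece_def)
        finally show "?q z \<in> {y. (o', y) \<in> VL} \<longleftrightarrow> (\<lambda>(v, x). loop_piece X h v x) z \<in> U" .
      qed
      then show ?thesis
        using loop[of h] by (intro openin_by_quotient[OF q sub]) (simp only:)
    qed
    define VS where "VS o' = {y. (o', y) \<in> VL}" for o'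
    have "openin (prod_topology (Top C2_plus) (Top (Susp X))) (\<Union>o'. {o'} \<times> VS o')"
    proof (rule openin_Union)
      fix S assume "S \<in> range (\<lambda>o'. {o'} \<times> VS o')"
      then obtain o' where "S = {o'} \<times> VS o'" by blast
      then show "openin (prod_topology (Top C2_plus) (Top (Susp X))) S"
        using slice[of o'] by (simp add: openin_prod_Times_iff Top_C2_plus VS_def)
    qed
    moreover have "VL = (\<Union>o'. {o'} \<times> VS o')" by (auto simp: VS_def)
    ultimately have "openin (prod_topology (Top C2_plus) (Top (Susp X))) VL" by simp
    moreover have "Inl -` V \<subseteq> topspace (Top ?L)" by (auto simp: V_def)
    ultimately show ?thesis
      unfolding Top_smash[of C2_plus] by (subst openin_collapse) (simp_all add: VL_def)
  qed
  moreover have "openin (Top ?R) (Inr -` V)"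
  proof -
    let ?q = "\<lambda>(v, u). collapse_proj (axes S_sigma (Norm_C2 X)) (line v, collapse_proj (hits_pt X) u)"
    note q = quotient_map_norm_line[of X]
    have sub: "Inr -` V \<subseteq> topspace (Top ?R)" by (auto simp: V_def)
    have "{z \<in> topspace (prod_topology J (Top (Map_C2 X))). ?q z \<in> Inr -` V} =
        {z \<in> topspace (prod_topology J (Top (Map_C2 X))). (\<lambda>(v, u). norm_piece X v u) z \<in> U}"
    proof (rule Collect_cong, rule conj_cong[OF refl])
      fix z assume z: "z \<in> topspace (prod_topology J (Top (Map_C2 X)))"
      obtain v u where vu: "z = (v, u)" by (cases z)
      have "?q z \<in> topspace (Top ?R)"
        using z continuous_map_image_subset_topspace[OF quotient_imp_continuous_map[OF q]] by blast
      then have "?q z \<in> Inr -` V \<longleftrightarrow> collapse_proj ?B (Inr (?q z)) \<in> U" by (auto simp: V_def)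
      also have "\<dots> \<longleftrightarrow> (\<lambda>(v, u). norm_piece X v u) z \<in> U" by (simp add: vu norm_piece_def)
      finally show "?q z \<in> Inr -` V \<longleftrightarrow> (\<lambda>(v, u). norm_piece X v u) z \<in> U" .
    qed
    then show ?thesis using norm by (intro openin_by_quotient[OF q sub]) (simp only:)
  qed
  ultimately have "openin ?Co V" by (simp add: openin_coproduct_topology)
  then show ?thesis
    using U unfolding splitting_def Top_wedge by (subst openin_collapse) (simp_all add: V_def)
qed

lemma pt_splitting: "pt (splitting X) = {Inl (pt (smash C2_plus (Susp X))), Inr (pt (Susp_sigma (Norm_C2 X)))}"
  by (simp add: splitting_def pt_wedge)

lemma loop_piece_ends: "x \<in> topspace (Top X) \<Longrightarrow> \<bar>v\<bar> \<ge> 1 \<Longrightarrow> loop_piece X h v x = pt (splitting X)"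
  and norm_piece_ends: "u \<in> topspace (Top (Map_C2 X)) \<Longrightarrow> \<bar>v\<bar> \<ge> 1 \<Longrightarrow> norm_piece X v u = pt (splitting X)"
  by (simp_all add: loop_piece_base norm_piece_base)

lemma pt_Map_in: "pt X \<in> topspace (Top X) \<Longrightarrow> (\<lambda>_. pt X) \<in> topspace (Top (Map_C2 X))"
  by (simp add: topspace_Map)

lemma pinch_at_base:
  assumes "pt X \<in> topspace (Top X)" "u \<in> topspace (Top (Map_C2 X))" "v = -1 \<or> v = 1 \<or> u = (\<lambda>_. pt X)"
  shows "pinch_at X v u = pt (splitting X)"
  using assms by (auto simp: pinch_at_def cat3_def loop_piece_base norm_piece_base topspace_Map)

lemma pinch_susp_point:
  assumes X: "pt X \<in> topspace (Top X)" and v: "v \<in> {-1..1}" and u: "u \<in> topspace (Top (Map_C2 X))"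
  shows "pinch X (susp_point X v u) = pinch_at X v u"
proof -
  let ?A = "axes S_sigma (Map_C2 X)"
  have base: "pinch_at X (unline s) u = pt (splitting X)" if "(s, u) \<in> ?A" for s u
    using that X by (intro pinch_at_base) (auto simp: in_axes_S pt_Map unline_def pt_Map_in)
  show ?thesis
  proof (cases "(line v, u) \<in> ?A")
    case True
    then have z: "susp_point X v u = ?A" by (simp add: susp_point_def collapse_proj_def)
    obtain s u' where q: "(SOME q. q \<in> ?A) = (s, u')" by (cases "SOME q. q \<in> ?A") blast
    have "(SOME q. q \<in> ?A) \<in> ?A" using True by (rule someI)
    then have "pinch X (susp_point X v u) = pt (splitting X)"
      unfolding z pinch_def q by (simp add: base)
    moreover have "pinch_at X v u = pt (splitting X)"
      using True v by (intro pinch_at_base[OF X u]) (auto simp: in_axes_S pt_Map line_eq_None abs_if split: if_splits)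
    ultimately show ?thesis by simp
  next
    case False
    then have "\<bar>v\<bar> < 1" using u by (auto simp: in_axes_S line_def split: if_splits)
    then show ?thesis using False by (simp add: susp_point_def collapse_proj_def pinch_def unline_line)
  qed
qed

section \<open>The action\<close>

lemma bit_cases: "(g :: bit) = 0 \<or> g = 1" by (cases g) auto

lemma act_in: "based_C2_space X \<Longrightarrow> x \<in> topspace (Top X) \<Longrightarrow> act X g x \<in> topspace (Top X)"
  using continuous_map_image_subset_topspace by (fastforce simp: based_C2_space_def C2_space_def)

lemma act_pt: "based_C2_space X \<Longrightarrow> act X g (pt X) = pt X"
  and pt_in: "based_C2_space X \<Longrightarrow> pt X \<in> topspace (Top X)"
  and act_0: "based_C2_space X \<Longrightarrow> x \<in> topspace (Top X) \<Longrightarrow> act X 0 x = x"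
  and act_add: "based_C2_space X \<Longrightarrow> x \<in> topspace (Top X) \<Longrightarrow> act X g (act X h x) = act X (g + h) x"
  by (auto simp: based_C2_space_def C2_space_def)

lemma act_Map_in: "based_C2_space X \<Longrightarrow> u \<in> topspace (Top (Map_C2 X)) \<Longrightarrow> act (Map_C2 X) g u \<in> topspace (Top (Map_C2 X))"
  by (simp add: topspace_Map act_Map act_in)

section \<open>Functoriality\<close>

text \<open>Both the action and the maps induced by \<open>f\<close> are built from the same functors, which need only maps
  of sets that preserve the base point.\<close>

definition pointed_map :: "'a based_c2_space \<Rightarrow> 'b based_c2_space \<Rightarrow> ('a \<Rightarrow> 'b) \<Rightarrow> bool" where
  "pointed_map X Y f \<longleftrightarrow> (\<forall>x\<in>topspace (Top X). f x \<in> topspace (Top Y)) \<and> f (pt X) = pt Y"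

lemma smash_map_proj:
  assumes "pointed_map X X' f" "pointed_map Y Y' g"
  shows "smash_map X' Y' f g (collapse_proj (axes X Y) (x, y)) = collapse_proj (axes X' Y') (f x, g y)"
proof -
  have "map_prod f g ` axes X Y \<subseteq> axes X' Y'"
    using assms by (auto simp: pointed_map_def in_axes_iff)
  then show ?thesis unfolding smash_map_def by (simp add: collapse_map_proj)
qed

lemma pointed_map_smash:
  assumes "pointed_map X X' f" "pointed_map Y Y' g"
  shows "pointed_map (smash X Y) (smash X' Y') (smash_map X' Y' f g)"
  unfolding pointed_map_def
proof
  show "\<forall>z\<in>topspace (Top (smash X Y)). smash_map X' Y' f g z \<in> topspace (Top (smash X' Y'))"
    using assms by (auto simp: Top_smash smash_map_proj[OF assms] pointed_map_def intro!: imageI)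
  have "map_prod f g ` axes X Y \<subseteq> axes X' Y'"
    using assms by (auto simp: pointed_map_def in_axes_iff)
  then show "smash_map X' Y' f g (pt (smash X Y)) = pt (smash X' Y')"
    by (simp add: smash_map_def pt_smash collapse_map_def)
qed

lemma wedge_map_proj:
  assumes "pointed_map X X' f" "pointed_map Y Y' g"
  shows "wedge_map X' Y' f g (collapse_proj {Inl (pt X), Inr (pt Y)} q) =
    collapse_proj {Inl (pt X'), Inr (pt Y')} (map_sum f g q)"
  unfolding wedge_map_def by (rule collapse_map_proj) (use assms in \<open>auto simp: pointed_map_def\<close>)

lemma norm_collapse_map_proj:
  assumes "pointed_map (Map_C2 X) (Map_C2 Y) k" "\<And>u. u \<in> hits_pt X \<Longrightarrow> k u \<in> hits_pt Y"
  shows "collapse_map (hits_pt Y) k (collapse_proj (hits_pt X) u) = collapse_proj (hits_pt Y) (k u)"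
    "pointed_map (Norm_C2 X) (Norm_C2 Y) (collapse_map (hits_pt Y) k)"
proof -
  have sub: "k ` hits_pt X \<subseteq> hits_pt Y" using assms(2) by blast
  show p: "collapse_map (hits_pt Y) k (collapse_proj (hits_pt X) u) = collapse_proj (hits_pt Y) (k u)" for u
    by (rule collapse_map_proj[OF sub])
  show "pointed_map (Norm_C2 X) (Norm_C2 Y) (collapse_map (hits_pt Y) k)"
    unfolding pointed_map_def pt_Norm
  proof
    show "\<forall>z\<in>topspace (Top (Norm_C2 X)). collapse_map (hits_pt Y) k z \<in> topspace (Top (Norm_C2 Y))"
      using assms(1) by (auto simp: Top_Norm p pointed_map_def intro!: imageI)
    show "collapse_map (hits_pt Y) k (hits_pt X) = hits_pt Y" using sub by (simp add: collapse_map_def)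
  qed
qed

lemma wedge_map_pieces:
  fixes X :: "'a based_c2_space" and Y :: "'b based_c2_space"
  assumes a: "pointed_map C2_plus C2_plus a" and b: "pointed_map S_one S_one b" and c: "pointed_map S_sigma S_sigma c"
    and f: "pointed_map X Y f"
    and k: "pointed_map (Map_C2 X) (Map_C2 Y) k" "\<And>u. u \<in> hits_pt X \<Longrightarrow> k u \<in> hits_pt Y"
  defines "m \<equiv> wedge_map (smash C2_plus (Susp Y)) (Susp_sigma (Norm_C2 Y))
       (smash_map C2_plus (Susp Y) a (smash_map S_one Y b f))
       (smash_map S_sigma (Norm_C2 Y) c (collapse_map (hits_pt Y) k))"
  shows "a (Some h) = Some h' \<Longrightarrow> b (line v) = line v' \<Longrightarrow> m (loop_piece X h v x) = loop_piece Y h' v' (f x)"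
    and "c (line v) = line v' \<Longrightarrow> m (norm_piece X v u) = norm_piece Y v' (k u)"
    and "m (pt (splitting X)) = pt (splitting Y)"
proof -
  note s1 = pointed_map_smash[OF b f] 
  note s2 = pointed_map_smash[OF a s1]
  note n = norm_collapse_map_proj[OF k]
  note s3 = pointed_map_smash[OF c n(2)]
  show "m (loop_piece X h v x) = loop_piece Y h' v' (f x)" if "a (Some h) = Some h'" "b (line v) = line v'"
    unfolding m_def loop_piece_def
    by (simp add: wedge_map_proj[OF s2 s3] smash_map_proj[OF a s1] smash_map_proj[OF b f] that)
  show "m (norm_piece X v u) = norm_piece Y v' (k u)" if "c (line v) = line v'"
    unfolding m_def norm_piece_def
    by (simp add: wedge_map_proj[OF s2 s3] smash_map_proj[OF c n(2)] n(1) that)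
  have "Inl (pt (smash C2_plus (Susp X))) \<in> {Inl (pt (smash C2_plus (Susp X))), Inr (pt (Susp_sigma (Norm_C2 X)))}" by simp
  then have "pt (splitting X) = collapse_proj {Inl (pt (smash C2_plus (Susp X))), Inr (pt (Susp_sigma (Norm_C2 X)))}
      (Inl (pt (smash C2_plus (Susp X))))"
    unfolding pt_splitting by (simp add: collapse_proj_def)
  also have "m \<dots> = collapse_proj {Inl (pt (smash C2_plus (Susp Y))), Inr (pt (Susp_sigma (Norm_C2 Y)))}
      (Inl (pt (smash C2_plus (Susp Y))))"
    using s2 unfolding m_def by (simp add: wedge_map_proj[OF s2 s3] pointed_map_def)
  also have "\<dots> = pt (splitting Y)" unfolding pt_splitting by (simp add: collapse_proj_def)
  finally show "m (pt (splitting X)) = pt (splitting Y)" .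
qed

lemma pointed_id: "pointed_map X X id" by (simp add: pointed_map_def)

lemma act_C2_plus_pointed: "pointed_map C2_plus C2_plus (act C2_plus g)"
  and act_S_pointed: "pointed_map S_one S_one (act S_one g)" "pointed_map S_sigma S_sigma (act S_sigma g)"
  by (simp_all add: pointed_map_def act_C2_plus Top_C2_plus pt_C2_plus act_S_one)
    (auto simp: Top_S topspace_S S_sigma_def simp del: topspace_Alexandroff_compactification)

lemma act_pointed: "based_C2_space X \<Longrightarrow> pointed_map X X (act X g)"
  by (auto simp: pointed_map_def act_in act_pt)

lemma act_Map_pointed: 
  assumes "based_C2_space X"
  shows "pointed_map (Map_C2 X) (Map_C2 X) (act (Map_C2 X) g)" 
    "u \<in> hits_pt X \<Longrightarrow> act (Map_C2 X) g u \<in> hits_pt X"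
proof -
  show "pointed_map (Map_C2 X) (Map_C2 X) (act (Map_C2 X) g)"
    using assms by (auto simp: pointed_map_def act_Map_in pt_Map act_Map act_pt fun_eq_iff)
  assume u: "u \<in> hits_pt X"
  then obtain h where h: "u h = pt X" by (auto simp: in_hits_pt)
  have "act (Map_C2 X) g u (g + h) = pt X" unfolding act_Map minus_add_cancel h using assms by (rule act_pt)
  then show "act (Map_C2 X) g u \<in> hits_pt X" using u assms by (auto simp: in_hits_pt act_Map_in)
qed

lemma act_splitting_eq:
  "act (splitting X) g = wedge_map (smash C2_plus (Susp X)) (Susp_sigma (Norm_C2 X))
       (smash_map C2_plus (Susp X) (act C2_plus g) (smash_map S_one X (act S_one g) (act X g)))
       (smash_map S_sigma (Norm_C2 X) (act S_sigma g) (collapse_map (hits_pt X) (act (Map_C2 X) g)))"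
  unfolding splitting_def act_wedge wedge_map_def act_smash act_Norm smash_map_def by simp

lemma act_splitting:
  assumes X: "based_C2_space X"
  shows "act (splitting X) g (loop_piece X h v x) = loop_piece X (g + h) v (act X g x)"
    "act (splitting X) g (norm_piece X v u) = norm_piece X (if g = 0 then v else - v) (act (Map_C2 X) g u)"
    "act (splitting X) g (pt (splitting X)) = pt (splitting X)"
  unfolding act_splitting_eq
  by (rule wedge_map_pieces[OF act_C2_plus_pointed act_S_pointed act_pointed[OF X] act_Map_pointed[OF X]];
      simp add: act_C2_plus act_S_one act_S_sigma_line)+

lemma act_susp_point:
  assumes X: "based_C2_space X"
  shows "act (susp_Map X) g (susp_point X v u) = susp_point X (if g = 0 then v else - v) (act (Map_C2 X) g u)"
proof -
  have "act (susp_Map X) g = smash_map S_sigma (Map_C2 X) (act S_sigma g) (act (Map_C2 X) g)"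
    by (simp add: susp_Map_def act_smash smash_map_def)
  then show ?thesis unfolding susp_point_def
    by (simp add: smash_map_proj[OF act_S_pointed(2) act_Map_pointed(1)[OF X]] act_S_sigma_line)
qed

lemma splitting_map_pieces:
  assumes X: "based_C2_space X" and Y: "based_C2_space Y" and f: "based_C2_map X Y f"
  shows "splitting_map Y f (loop_piece X h v x) = loop_piece Y h v (f x)"
    "splitting_map Y f (norm_piece X v u) = norm_piece Y v (f \<circ> u)"
    "susp_Map_map Y f (susp_point X v u) = susp_point Y v (f \<circ> u)"
proof -
  have f': "pointed_map X Y f"
    using f continuous_map_image_subset_topspace[of "Top X" "Top Y" f] by (auto simp: pointed_map_def based_C2_map_def)
  then have m: "pointed_map (Map_C2 X) (Map_C2 Y) ((\<circ>) f)"
    by (auto simp: pointed_map_def topspace_Map pt_Map fun_eq_iff)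
  have h: "f \<circ> u \<in> hits_pt Y" if u: "u \<in> hits_pt X" for u
  proof -
    obtain h where "u h = pt X" using u by (auto simp: in_hits_pt)
    then have "(f \<circ> u) h = pt Y" using f' by (simp add: pointed_map_def)
    then show ?thesis using u f' unfolding in_hits_pt by (auto simp: pointed_map_def topspace_Map)
  qed
  note pieces = wedge_map_pieces[OF pointed_id pointed_id pointed_id f' m h]
  show "splitting_map Y f (loop_piece X h v x) = loop_piece Y h v (f x)"
    unfolding splitting_map_def norm_map_def by (rule pieces(1)) auto
  show "splitting_map Y f (norm_piece X v u) = norm_piece Y v (f \<circ> u)"
    unfolding splitting_map_def norm_map_def by (rule pieces(2)) auto
  show "susp_Map_map Y f (susp_point X v u) = susp_point Y v (f \<circ> u)"
    unfolding susp_Map_map_def susp_point_def by (simp add: smash_map_proj[OF pointed_id m])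
qed

lemma pinch_natural:
  assumes X: "based_C2_space X" and Y: "based_C2_space Y" and f: "based_C2_map X Y f"
    and z: "z \<in> topspace (Top (susp_Map X))"
  shows "splitting_map Y f (pinch X z) = pinch Y (susp_Map_map Y f z)"
proof -
  obtain v u where vu: "v \<in> {-1..1}" "u \<in> topspace (Top (Map_C2 X))" "z = susp_point X v u"
    using topspace_susp_Map[OF z] .
  have "f \<circ> u \<in> topspace (Top (Map_C2 Y))"
    using vu(2) f continuous_map_image_subset_topspace[of "Top X" "Top Y" f] by (auto simp: based_C2_map_def topspace_Map)
  then show ?thesis
    using vu by (simp add: pinch_susp_point pt_in[OF X] pt_in[OF Y] splitting_map_pieces[OF X Y f])
      (simp add: pinch_at_def cat3_def splitting_map_pieces[OF X Y f])
qed

text \<open>The two outer thirds are exchanged by \<open>v \<mapsto> -v\<close>, and \<open>(g u) (1) = g (u 0)\<close> for the generator \<open>g\<close>. The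
  division points are treated separately only because the formula favours one side there.\<close>

lemma pinch_at_act:
  assumes X: "based_C2_space X" and u: "u \<in> topspace (Top (Map_C2 X))"
  shows "pinch_at X (if g = 0 then v else - v) (act (Map_C2 X) g u) = act (splitting X) g (pinch_at X v u)"
proof -
  have in': "act X g (u h) \<in> topspace (Top X)" for h using u by (simp add: topspace_Map act_in[OF X])
  note base = loop_piece_ends norm_piece_ends act_Map_in[OF X u]
  show ?thesis
  proof (cases "g = 0")
    case True
    then show ?thesis by (simp add: pinch_at_def cat3_def act_splitting[OF X] act_Map)
  next
    case False
    then have g: "g = 1" using bit_cases by blast
    have a: "act (Map_C2 X) 1 u 1 = act X 1 (u 0)" "act (Map_C2 X) 1 u 0 = act X 1 (u 1)"
      by (simp_all add: act_Map)
    consider "v = -1/3" | "v = 1/3" | "v < -1/3" | "v > 1/3" | "-1/3 < v" "v < 1/3" by linarith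
    then show ?thesis
    proof cases
      case 1
      then show ?thesis using in' g by (simp add: pinch_at_def cat3_def act_splitting[OF X] a base)
    next
      case 2
      then show ?thesis using in' g u act_splitting(2)[OF X, of 1 1 u, symmetric]
        by (simp add: pinch_at_def cat3_def act_splitting[OF X] a base)
    next
      case 3
      have "pinch_at X (- v) (act (Map_C2 X) 1 u) = loop_piece X 0 (3 * (- v) - 2) (act X 1 (u 1))"
        using 3 by (simp add: pinch_at_def cat3_def a)
      also have "3 * (- v) - 2 = - (3 * v + 2)" by simp
      also have "loop_piece X 0 (- (3 * v + 2)) (act X 1 (u 1)) = act (splitting X) 1 (loop_piece X 1 (- (3 * v + 2)) (u 1))"
        by (simp add: act_splitting[OF X])
      also have "loop_piece X 1 (- (3 * v + 2)) (u 1) = pinch_at X v u"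
        using 3 by (simp add: pinch_at_def cat3_def)
      finally show ?thesis using g by simp
    next
      case 4
      have "pinch_at X (- v) (act (Map_C2 X) 1 u) = loop_piece X 1 (- (3 * (- v) + 2)) (act X 1 (u 0))"
        using 4 by (simp add: pinch_at_def cat3_def a)
      also have "- (3 * (- v) + 2) = 3 * v - 2" by simp
      also have "loop_piece X 1 (3 * v - 2) (act X 1 (u 0)) = act (splitting X) 1 (loop_piece X 0 (3 * v - 2) (u 0))"
        by (simp add: act_splitting[OF X])
      also have "loop_piece X 0 (3 * v - 2) (u 0) = pinch_at X v u"
        using 4 by (simp add: pinch_at_def cat3_def)
      finally show ?thesis using g by simp
    next
      case 5
      then show ?thesis using g by (simp add: pinch_at_def cat3_def act_splitting[OF X])
    qed
  qed
qed

section \<open>The underlying weak equivalence\<close>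

definition pair :: "'a \<Rightarrow> 'a \<Rightarrow> bit \<Rightarrow> 'a" where "pair x y = (\<lambda>h. if h = 1 then x else y)"

lemma pair_simps [simp]: "pair x y 1 = x" "pair x y 0 = y" by (simp_all add: pair_def)

lemma pair_eta: "u = pair (u 1) (u 0)"
  using bit_cases by (force simp: pair_def)

lemma pair_in: "pair x y \<in> topspace (Top (Map_C2 X)) \<longleftrightarrow> x \<in> topspace (Top X) \<and> y \<in> topspace (Top X)"
  unfolding topspace_Map pair_def using bit_cases by (metis one_neq_zero)

lemma pair_eq_iff: "pair x y = pair x' y' \<longleftrightarrow> x = x' \<and> y = y'"
  by (metis pair_simps)

lemma continuous_map_pair: "continuous_map (prod_topology (Top X) (Top X)) (Top (Map_C2 X)) (\<lambda>(x, y). pair x y)"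
  unfolding Top_Map pair_def continuous_map_componentwise_UNIV case_prod_unfold
  by (auto intro: continuous_map_fst continuous_map_snd)

lemma continuous_map_eval: "continuous_map (Top (Map_C2 X)) (Top X) (\<lambda>u. u h)"
  unfolding Top_Map by (rule continuous_map_product_projection) simp

lemma homeomorphic_map_pair: "homeomorphic_map (prod_topology (Top X) (Top X)) (Top (Map_C2 X)) (\<lambda>(x, y). pair x y)"
proof -
  have "continuous_map (Top (Map_C2 X)) (prod_topology (Top X) (Top X)) (\<lambda>u. (u 1, u 0))"
    by (intro continuous_map_pairedI continuous_map_eval)
  then have "homeomorphic_maps (prod_topology (Top X) (Top X)) (Top (Map_C2 X)) (\<lambda>(x, y). pair x y) (\<lambda>u. (u 1, u 0))"
    unfolding homeomorphic_maps_def using continuous_map_pair[of X] by (simp add: pair_eta[symmetric])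
  then show ?thesis using homeomorphic_map_maps by blast
qed

lemma quotient_map_susp_point:
  "quotient_map (prod_topology J (Top (Map_C2 X))) (Top (susp_Map X)) (\<lambda>(v, u). susp_point X v u)"
  using quotient_map_smash_line[OF Top_S(2), of "Map_C2 X"] by (simp add: susp_point_def susp_Map_def)

lemma quotient_map_susp_point_pair:
  "quotient_map (prod_topology J (prod_topology (Top X) (Top X))) (Top (susp_Map X)) (\<lambda>(v, x, y). susp_point X v (pair x y))"
proof -
  have "quotient_map (prod_topology J (prod_topology (Top X) (Top X))) (prod_topology J (Top (Map_C2 X)))
      (\<lambda>(v, q). (v, (\<lambda>(x, y). pair x y) q))"
    by (rule quotient_map_prod_right[OF J_locally_compact disjI1[OF J_Hausdorff] homeomorphic_map_pair[unfolded homeomorphic_map_def, THEN conjunct1]])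
  from quotient_map_compose[OF this quotient_map_susp_point]
  show ?thesis by (simp add: o_def case_prod_unfold)
qed

lemma topspace_loop_piece: "v \<in> {-1..1} \<Longrightarrow> x \<in> topspace (Top X) \<Longrightarrow> loop_piece X h v x \<in> topspace (Top (splitting X))"
  using continuous_map_image_subset_topspace[OF continuous_map_loop_piece[of X h]] by force

lemma topspace_norm_piece: "v \<in> {-1..1} \<Longrightarrow> u \<in> topspace (Top (Map_C2 X)) \<Longrightarrow> norm_piece X v u \<in> topspace (Top (splitting X))"
  using continuous_map_image_subset_topspace[OF continuous_map_norm_piece[of X]] by force

lemma pinched_suspension_splitting:
  assumes X: "pt X \<in> topspace (Top X)"
    and \<phi>: "continuous_map (Top X) unit_interval \<phi>" "\<phi> (pt X) = 0"
    and h: "continuous_map (prod_topology unit_interval (Top X)) (Top X) h"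
     "\<And>x. x \<in> topspace (Top X) \<Longrightarrow> h (0, x) = x" "\<And>t. t \<in> {0..1} \<Longrightarrow> h (t, pt X) = pt X"
     "\<And>x. x \<in> topspace (Top X) \<Longrightarrow> \<phi> x < 1 \<Longrightarrow> h (1, x) = pt X"
  shows "pinched_suspension (Top X) (pt X) (Top (susp_Map X)) (\<lambda>v x y. susp_point X v (pair x y)) (pt (susp_Map X))
     (Top (splitting X)) (\<lambda>v x. loop_piece X 1 (- v) x) (\<lambda>v x y. norm_piece X v (pair x y)) (\<lambda>v x. loop_piece X 0 v x)
     (pt (splitting X)) (pinch X) \<phi> h"
proof -
  let ?JX = "prod_topology J (Top X)" and ?JM = "prod_topology J (Top (Map_C2 X))"
  let ?JXX = "prod_topology J (prod_topology (Top X) (Top X))"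
  have neg: "continuous_map ?JX ?JX (\<lambda>z. (- fst z, snd z))"
    by (intro continuous_map_pairedI continuous_map_into_Icc continuous_intros continuous_map_J_real[OF continuous_map_fst]) auto
  have pr: "continuous_map ?JXX ?JM (\<lambda>z. (fst z, (\<lambda>(x, y). pair x y) (snd z)))"
    by (intro continuous_map_pairedI continuous_map_fst continuous_map_compose1[OF continuous_map_pair] continuous_map_snd)
  have rp: "continuous_map ?JM ?JXX (\<lambda>z. (fst z, snd z 1, snd z 0))"
    by (intro continuous_map_pairedI continuous_map_fst continuous_map_compose1[OF continuous_map_eval[of X 1] continuous_map_snd]
        continuous_map_compose1[OF continuous_map_eval[of X 0] continuous_map_snd])
  have hits: "(\<exists>h. pair x y h = pt X) \<longleftrightarrow> x = pt X \<or> y = pt X" for x y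
    by (auto simp: pair_def)
  have A_cont: "continuous_map ?JX (Top (splitting X)) (\<lambda>(v, x). loop_piece X 1 (- v) x)"
    using continuous_map_compose1[OF continuous_map_loop_piece[of X 1] neg] by (simp add: case_prod_unfold)
  have N_cont: "continuous_map ?JXX (Top (splitting X)) (\<lambda>(v, x, y). norm_piece X v (pair x y))"
    using continuous_map_compose1[OF continuous_map_norm_piece[of X] pr] by (simp add: case_prod_unfold)
  let ?S = "({-1..1::real} \<times> topspace (Top X)) <+> (({-1..1::real} \<times> topspace (Top X) \<times> topspace (Top X)) <+> ({-1..1::real} \<times> topspace (Top X)))"
  let ?R = "case_sum (\<lambda>(v, x). loop_piece X 1 (- v) x) (case_sum (\<lambda>(v, x, y). norm_piece X v (pair x y)) (\<lambda>(v, x). loop_piece X 0 v x))"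
  have pieces: "?R s = pt (splitting X)" if s: "s \<in> ?S" "s' \<in> ?S" "?R s = ?R s'" "s \<noteq> s'" for s s'
  proof -
    have ex: "(\<exists>v x. s = Inl (v, x) \<and> x \<in> topspace (Top X)) \<or>
        (\<exists>v x y. s = Inr (Inl (v, x, y)) \<and> x \<in> topspace (Top X) \<and> y \<in> topspace (Top X)) \<or>
        (\<exists>v x. s = Inr (Inr (v, x)) \<and> x \<in> topspace (Top X))" if "s \<in> ?S" for s
      using that by auto
    from ex[OF s(1)] consider v x where "s = Inl (v, x)" "x \<in> topspace (Top X)"
      | v x y where "s = Inr (Inl (v, x, y))" "pair x y \<in> topspace (Top (Map_C2 X))"
      | v x where "s = Inr (Inr (v, x))" "x \<in> topspace (Top X)" by (auto simp: pair_in)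
    note s_cases = this
    from ex[OF s(2)] consider v x where "s' = Inl (v, x)" "x \<in> topspace (Top X)"
      | v x y where "s' = Inr (Inl (v, x, y))" "pair x y \<in> topspace (Top (Map_C2 X))"
      | v x where "s' = Inr (Inr (v, x))" "x \<in> topspace (Top X)" by (auto simp: pair_in)
    note s'_cases = this
    show ?thesis
    proof (cases rule: s_cases)
      case (1 v x)
      note s1 = this
      show ?thesis
      proof (cases rule: s'_cases)
        case (1 v' x')
        then show ?thesis using loop_piece_eq[OF s1(2) 1(2), of 1 "- v" 1 "- v'"] s(3,4) s1(1) by (auto simp: pair_eq_iff)
      next
        case (2 v' x' y')
        then show ?thesis using loop_piece_eq_norm_piece[OF s1(2), of 1 "- v" v' "pair x' y'"] s(3,4) s1(1) by (auto simp: pair_eq_iff)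
      next
        case (3 v' x')
        then show ?thesis using loop_piece_eq[OF s1(2) 3(2), of 1 "- v" 0 "v'"] s(3,4) s1(1) by (auto simp: pair_eq_iff)
      qed
    next
      case (2 v x y)
      note s1 = this
      show ?thesis
      proof (cases rule: s'_cases)
        case (1 v' x')
        then show ?thesis using loop_piece_eq_norm_piece[OF 1(2), of 1 "- v'" v "pair x y"] s(3,4) s1(1) by (auto simp: pair_eq_iff)
      next
        case (2 v' x' y')
        then show ?thesis using norm_piece_eq[OF s1(2) 2(2), of v v'] s(3,4) s1(1) by (auto simp: pair_eq_iff)
      next
        case (3 v' x')
        then show ?thesis using loop_piece_eq_norm_piece[OF 3(2), of 0 "v'" v "pair x y"] s(3,4) s1(1) by (auto simp: pair_eq_iff)
      qed
    next
      case (3 v x)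
      note s1 = this
      show ?thesis
      proof (cases rule: s'_cases)
        case (1 v' x')
        then show ?thesis using loop_piece_eq[OF s1(2) 1(2), of 0 "v" 1 "- v'"] s(3,4) s1(1) by (auto simp: pair_eq_iff)
      next
        case (2 v' x' y')
        then show ?thesis using loop_piece_eq_norm_piece[OF s1(2), of 0 "v" v' "pair x' y'"] s(3,4) s1(1) by (auto simp: pair_eq_iff)
      next
        case (3 v' x')
        then show ?thesis using loop_piece_eq[OF s1(2) 3(2), of 0 "v" 0 "v'"] s(3,4) s1(1) by (auto simp: pair_eq_iff)
      qed
    qed
  qed
  have E_eq: "fst z = -1 \<or> fst z = 1 \<or> snd z = (pt X, pt X)"
    if z: "z \<in> {-1..1} \<times> topspace (Top X) \<times> topspace (Top X)" "z' \<in> {-1..1} \<times> topspace (Top X) \<times> topspace (Top X)"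
      "(\<lambda>(v, x, y). susp_point X v (pair x y)) z = (\<lambda>(v, x, y). susp_point X v (pair x y)) z'" "z \<noteq> z'" for z z'
  proof -
    obtain v x y v' x' y' where zz: "z = (v, x, y)" "z' = (v', x', y')" by (metis prod_cases3)
    have in1: "pair x y \<in> topspace (Top (Map_C2 X))" using z zz by (simp add: pair_in)
    have "susp_point X v (pair x y) = pt (susp_Map X)"
      using susp_point_eq[OF in1, of v v' "pair x' y'"] z zz by (auto simp: pair_eq_iff)
    then have "1 \<le> \<bar>v\<bar> \<or> pair x y = pair (pt X) (pt X)"
      using susp_point_base[OF in1] by (simp add: pair_def)
    then show ?thesis using z zz by (auto simp: pair_eq_iff abs_if split: if_splits)
  qed
  have cover: "(\<exists>v\<in>{-1..1}. \<exists>x\<in>topspace (Top X). w = loop_piece X 1 (- v) x \<or> w = loop_piece X 0 v x) \<or>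
        (\<exists>v\<in>{-1..1}. \<exists>x\<in>topspace (Top X). \<exists>y\<in>topspace (Top X). w = norm_piece X v (pair x y))"
    if "w \<in> topspace (Top (splitting X))" for w
    using that X
  proof (cases rule: topspace_splitting)
    case (1 h v x)
    consider "h = 0" | "h = 1" using bit_cases by blast
    then show ?thesis
    proof cases
      case 2
      then have "w = loop_piece X 1 (- (- v)) x" "- v \<in> {-1..1}" using 1 by auto
      then show ?thesis using 1(2) by blast
    qed (use 1 in blast)
  next
    case (2 v u)
    then have "w = norm_piece X v (pair (u 1) (u 0))" using pair_eta[of u] by simp
    then show ?thesis using 2(1,2)
      by (intro disjI2 bexI[of _ v] bexI[of _ "u 1"] bexI[of _ "u 0"]) (auto simp: topspace_Map)
  qed
  have opn: "openin (Top (splitting X)) U"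
    if U: "U \<subseteq> topspace (Top (splitting X))"
      and A: "openin ?JX {z \<in> {-1..1} \<times> topspace (Top X). (\<lambda>(v, x). loop_piece X 1 (- v) x) z \<in> U}"
      and N: "openin ?JXX {z \<in> {-1..1} \<times> topspace (Top X) \<times> topspace (Top X). (\<lambda>(v, x, y). norm_piece X v (pair x y)) z \<in> U}"
      and B: "openin ?JX {z \<in> {-1..1} \<times> topspace (Top X). (\<lambda>(v, x). loop_piece X 0 v x) z \<in> U}" for U
  proof (rule openin_splitting[OF X U])
    fix h :: bit
    consider "h = 0" | "h = 1" using bit_cases by blast
    then show "openin ?JX {z \<in> topspace ?JX. (\<lambda>(v, x). loop_piece X h v x) z \<in> U}"
    proof cases
      case 1
      have "topspace ?JX = {-1..1} \<times> topspace (Top X)" by simp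
      then show ?thesis using B unfolding 1 by (simp only:)
    next
      case 2
      have "{z \<in> topspace ?JX. (\<lambda>(v, x). loop_piece X h v x) z \<in> U} = {z \<in> topspace ?JX. (- fst z, snd z) \<in>
          {z \<in> {-1..1} \<times> topspace (Top X). (\<lambda>(v, x). loop_piece X 1 (- v) x) z \<in> U}}"
        using 2 by auto
      then show ?thesis using openin_continuous_map_preimage[OF neg A] by (simp only:)
    qed
  next
    have "{z \<in> topspace ?JM. (\<lambda>(v, u). norm_piece X v u) z \<in> U} = {z \<in> topspace ?JM. (fst z, snd z 1, snd z 0) \<in>
       {z \<in> {-1..1} \<times> topspace (Top X) \<times> topspace (Top X). (\<lambda>(v, x, y). norm_piece X v (pair x y)) z \<in> U}}"
      by (auto simp: topspace_Map simp flip: pair_eta)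
    then show "openin ?JM {z \<in> topspace ?JM. (\<lambda>(v, u). norm_piece X v u) z \<in> U}"
      using openin_continuous_map_preimage[OF rp N] by (simp only:)
  qed
  show ?thesis
  proof (unfold_locales)
    show "pinch X (susp_point X v (pair x y)) = cat3 v (loop_piece X 1 (- clamp (3 * v + 2)) x)
       (norm_piece X (clamp (3 * v)) (pair x y)) (loop_piece X 0 (clamp (3 * v - 2)) y)"
      if "v \<in> {-1..1}" "x \<in> topspace (Top X)" "y \<in> topspace (Top X)" for v x y
    proof -
      have "loop_piece X h (clamp t) x = loop_piece X h t x" "loop_piece X h (- clamp t) x = loop_piece X h (- t) x"
        "norm_piece X (clamp t) u = norm_piece X t u" for h t x u
        by (simp_all add: loop_piece_def norm_piece_def line_clamp)
      then show ?thesis using that by (subst pinch_susp_point[OF X]) (simp_all add: pair_in pinch_at_def del: minus_add_distrib)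
    qed
    show "susp_point X v (pair x y) = pt (susp_Map X)"
      if "v = - 1 \<or> v = 1 \<or> x = pt X \<and> y = pt X" "x \<in> topspace (Top X)" "y \<in> topspace (Top X)" for v x y
    proof -
      have "pair x y \<in> topspace (Top (Map_C2 X))" using that by (simp add: pair_in)
      moreover have "pair (pt X) (pt X) = (\<lambda>_. pt X)" by (simp add: pair_def)
      ultimately show ?thesis using susp_point_base[of "pair x y" X v] that(1) by auto
    qed
    show "loop_piece X 1 (- v) x = pt (splitting X) \<longleftrightarrow> v = - 1 \<or> v = 1 \<or> x = pt X"
      "loop_piece X 0 v x = pt (splitting X) \<longleftrightarrow> v = - 1 \<or> v = 1 \<or> x = pt X"
      if "v \<in> {-1..1}" "x \<in> topspace (Top X)" for v x
      using that by (auto simp: loop_piece_base abs_if split: if_splits)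
    show "norm_piece X v (pair x y) = pt (splitting X) \<longleftrightarrow> v = - 1 \<or> v = 1 \<or> x = pt X \<or> y = pt X"
      if "v \<in> {-1..1}" "x \<in> topspace (Top X)" "y \<in> topspace (Top X)" for v x y
      using that by (subst norm_piece_base) (auto simp: pair_in hits abs_if split: if_splits)
  qed (fact X quotient_map_susp_point_pair A_cont N_cont continuous_map_loop_piece \<phi> h pieces E_eq cover opn)+
qed

lemma continuous_map_pinch:
  assumes X: "pt X \<in> topspace (Top X)"
  shows "continuous_map (Top (susp_Map X)) (Top (splitting X)) (pinch X)"
proof -
  let ?JM = "prod_topology J (Top (Map_C2 X))"
  let ?v = "\<lambda>z. fst z :: real"
  have v: "continuous_map ?JM euclideanreal ?v" by (rule continuous_map_J_real[OF continuous_map_fst])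
  have u: "continuous_map ?JM (Top X) (\<lambda>z. snd z h)" for h
    by (rule continuous_map_compose1[OF continuous_map_eval[of X h] continuous_map_snd])
  have loop: "continuous_map ?JM (Top (splitting X)) (\<lambda>z. loop_piece X h (clamp (f z)) (snd z h'))"
    if "continuous_map ?JM euclideanreal f" for f h h'
    using continuous_map_compose2[OF continuous_map_loop_piece continuous_map_clamp[OF that] u] by simp
  have norm: "continuous_map ?JM (Top (splitting X)) (\<lambda>z. norm_piece X (clamp (f z)) (snd z))"
    if "continuous_map ?JM euclideanreal f" for f
    using continuous_map_compose2[OF continuous_map_norm_piece continuous_map_clamp[OF that] continuous_map_snd] by simp
  have cl: "loop_piece X h (clamp t) x = loop_piece X h t x" "norm_piece X (clamp t) u = norm_piece X t u" for h t x u
    by (simp_all add: loop_piece_def norm_piece_def line_clamp)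
  have "continuous_map ?JM (Top (splitting X)) (\<lambda>z. pinch_at X (fst z) (snd z))"
    unfolding pinch_at_def
  proof (rule continuous_map_cat3[OF v])
    show "continuous_map ?JM (Top (splitting X)) (\<lambda>z. loop_piece X 1 (- (3 * fst z + 2)) (snd z 1))"
      by (rule loop[unfolded cl]) (intro continuous_intros v)
    show "continuous_map ?JM (Top (splitting X)) (\<lambda>z. norm_piece X (3 * fst z) (snd z))"
      by (rule norm[unfolded cl]) (intro continuous_intros v)
    show "continuous_map ?JM (Top (splitting X)) (\<lambda>z. loop_piece X 0 (3 * fst z - 2) (snd z 0))"
      by (rule loop[unfolded cl]) (intro continuous_intros v)
  qed (auto simp: loop_piece_ends norm_piece_ends topspace_Map)
  then have "continuous_map ?JM (Top (splitting X)) (pinch X \<circ> (\<lambda>(v, u). susp_point X v u))"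
    by (rule continuous_map_eq) (auto simp: pinch_susp_point[OF X])
  then show ?thesis by (rule continuous_compose_quotient_map[OF quotient_map_susp_point])
qed

lemma based_C2_map_pinch:
  assumes X: "based_C2_space X"
  shows "based_C2_map (susp_Map X) (splitting X) (pinch X)"
  unfolding based_C2_map_def
proof (intro conjI)
  show "continuous_map (Top (susp_Map X)) (Top (splitting X)) (pinch X)"
    by (rule continuous_map_pinch[OF pt_in[OF X]])
  have "susp_point X 1 (\<lambda>_. pt X) = pt (susp_Map X)"
    using susp_point_base[OF pt_Map_in[OF pt_in[OF X]], of 1] by simp
  then show "pinch X (pt (susp_Map X)) = pt (splitting X)"
    using pinch_susp_point[OF pt_in[OF X], of 1 "\<lambda>_. pt X"] pinch_at_base[OF pt_in[OF X], of "\<lambda>_. pt X" 1]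
      pt_Map_in[OF pt_in[OF X]] by simp
  show "equivariant (susp_Map X) (splitting X) (pinch X)"
    unfolding equivariant_def
  proof (intro allI ballI)
    fix g :: bit and z assume "z \<in> topspace (Top (susp_Map X))"
    then obtain v u where vu: "v \<in> {-1..1}" "u \<in> topspace (Top (Map_C2 X))" "z = susp_point X v u"
      by (rule topspace_susp_Map)
    have "(if g = 0 then v else - v) \<in> {-1..1}" using vu(1) by auto
    then show "pinch X (act (susp_Map X) g z) = act (splitting X) g (pinch X z)"
      using vu by (simp only: act_susp_point[OF X] pinch_susp_point[OF pt_in[OF X]] act_Map_in[OF X] pinch_at_act[OF X])
  qed
qed

lemma pinch_weak_equivalence_underlying:
  assumes X: "based_C2_space X" and w: "well_pointed (Top X) (pt X)"
  shows "weak_equivalence (C2_fixed {0} (susp_Map X)) (C2_fixed {0} (splitting X)) (pinch X)"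
proof -
  have "act (susp_Map X) 0 z = z" if z: "z \<in> topspace (Top (susp_Map X))" for z
  proof -
    obtain v u where vu: "v \<in> {-1..1}" "u \<in> topspace (Top (Map_C2 X))" "z = susp_point X v u"
      using z by (rule topspace_susp_Map)
    have "act (Map_C2 X) 0 u = u" using vu(2) by (auto simp: act_Map act_0[OF X] topspace_Map)
    then show ?thesis by (simp add: vu(3) act_susp_point[OF X])
  qed
  then have 1: "C2_fixed {0} (susp_Map X) = Top (susp_Map X)"
    unfolding C2_fixed_def by (intro subtopology_superset) auto
  have "act (splitting X) 0 w = w" if "w \<in> topspace (Top (splitting X))" for w
    using that pt_in[OF X]
  proof (cases rule: topspace_splitting)
    case (1 h v x)
    then show ?thesis by (simp add: act_splitting[OF X] act_0[OF X])
  next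
    case (2 v u)
    have "act (Map_C2 X) 0 u = u" using 2(2) by (auto simp: act_Map act_0[OF X] topspace_Map)
    then show ?thesis by (simp add: 2(3) act_splitting[OF X])
  qed
  then have 2: "C2_fixed {0} (splitting X) = Top (splitting X)"
    unfolding C2_fixed_def by (intro subtopology_superset) auto
  obtain \<phi> h where "continuous_map (Top X) unit_interval \<phi>" "\<phi> (pt X) = 0"
      "continuous_map (prod_topology unit_interval (Top X)) (Top X) h"
     "\<And>x. x \<in> topspace (Top X) \<Longrightarrow> h (0, x) = x" "\<And>t. t \<in> {0..1} \<Longrightarrow> h (t, pt X) = pt X"
     "\<And>x. x \<in> topspace (Top X) \<Longrightarrow> \<phi> x < 1 \<Longrightarrow> h (1, x) = pt X"
    using w unfolding well_pointed_def by blast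
  from pinched_suspension.pinch_weak_equivalence[OF pinched_suspension_splitting[OF pt_in[OF X] this]]
  show ?thesis unfolding 1 2 .
qed

section \<open>Fixed points\<close>

text \<open>The equivariant map from \<open>C\<^sub>2\<close> to \<open>X\<close> with value \<open>x\<close> at \<open>0\<close>.\<close>

definition diagonal :: "'a based_c2_space \<Rightarrow> 'a \<Rightarrow> bit \<Rightarrow> 'a" where "diagonal X x = (\<lambda>h. act X h x)"

lemma diagonal_in: "based_C2_space X \<Longrightarrow> x \<in> topspace (Top X) \<Longrightarrow> diagonal X x \<in> topspace (Top (Map_C2 X))"
  by (simp add: diagonal_def topspace_Map act_in)

lemma diagonal_fixed: "based_C2_space X \<Longrightarrow> x \<in> topspace (Top X) \<Longrightarrow> act (Map_C2 X) g (diagonal X x) = diagonal X x"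
  by (rule ext) (simp only: diagonal_def act_Map act_add add_minus_cancel)

lemma diagonal_pt: "based_C2_space X \<Longrightarrow> diagonal X (pt X) = (\<lambda>_. pt X)"
  by (simp add: diagonal_def act_pt)

lemma fixed_Map_diagonal:
  assumes X: "based_C2_space X" and u: "u \<in> topspace (Top (Map_C2 X))" "act (Map_C2 X) 1 u = u"
  shows "u = diagonal X (u 0)"
proof
  fix h
  have "u 1 = act X 1 (u 0)" using fun_cong[OF u(2), of 1] by (simp add: act_Map)
  then show "u h = diagonal X (u 0) h"
    using bit_cases[of h] u(1) act_0[OF X] by (auto simp: diagonal_def topspace_Map)
qed

lemma topspace_C2_fixed: "z \<in> topspace (C2_fixed UNIV X) \<longleftrightarrow> z \<in> topspace (Top X) \<and> (\<forall>h. act X h z = z)"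
  by (auto simp: C2_fixed_def)

lemma fixed_susp_Map:
  assumes X: "based_C2_space X" and z: "z \<in> topspace (C2_fixed UNIV (susp_Map X))"
  obtains x where "x \<in> topspace (Top X)" "z = susp_point X 0 (diagonal X x)"
proof -
  have zt: "z \<in> topspace (Top (susp_Map X))" and fix1: "act (susp_Map X) 1 z = z"
    using z by (auto simp: topspace_C2_fixed)
  obtain v u where vu: "v \<in> {-1..1}" "u \<in> topspace (Top (Map_C2 X))" "z = susp_point X v u"
    using zt by (rule topspace_susp_Map)
  have "susp_point X (- v) (act (Map_C2 X) 1 u) = susp_point X v u"
    using fix1 by (simp add: vu(3) act_susp_point[OF X])
  then consider "- v = v" "act (Map_C2 X) 1 u = u" | "z = pt (susp_Map X)"
    using susp_point_eq[OF act_Map_in[OF X vu(2)]] vu(3) by metis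
  then show thesis
  proof cases
    case 1
    then have "v = 0" by simp
    then show thesis using that[of "u 0"] vu(2,3) fixed_Map_diagonal[OF X vu(2) 1(2)] by (simp add: topspace_Map)
  next
    case 2
    then show thesis
      using that[of "pt X"] pt_in[OF X] susp_point_base[OF pt_Map_in[OF pt_in[OF X]], of 0] by (simp add: diagonal_pt[OF X])
  qed
qed

lemma fixed_splitting:
  assumes X: "based_C2_space X" and w: "w \<in> topspace (C2_fixed UNIV (splitting X))"
  obtains x where "x \<in> topspace (Top X)" "w = norm_piece X 0 (diagonal X x)"
proof -
  have wt: "w \<in> topspace (Top (splitting X))" and fix1: "act (splitting X) 1 w = w"
    using w by (auto simp: topspace_C2_fixed)
  have base: thesis if "w = pt (splitting X)"
    using that \<open>\<And>x. x \<in> topspace (Top X) \<Longrightarrow> w = norm_piece X 0 (diagonal X x) \<Longrightarrow> thesis\<close>[of "pt X"] pt_in[OF X]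
      norm_piece_base[OF pt_Map_in[OF pt_in[OF X]], of 0] by (simp add: diagonal_pt[OF X])
  show thesis
    using wt pt_in[OF X]
  proof (cases rule: topspace_splitting)
    case (1 h v x)
    have "loop_piece X (1 + h) v (act X 1 x) = loop_piece X h v x"
      using fix1 by (simp only: 1(3) act_splitting[OF X])
    then have "loop_piece X h v x = pt (splitting X)"
      using loop_piece_eq[OF act_in[OF X 1(2)] 1(2), of "1 + h" v 1 h v] bit_cases[of h] by fastforce
    then show thesis using base 1(3) by simp
  next
    case (2 v u)
    have eq: "norm_piece X (- v) (act (Map_C2 X) 1 u) = norm_piece X v u"
      using fix1 by (simp add: 2(3) act_splitting[OF X])
    from norm_piece_eq[OF act_Map_in[OF X 2(2)] 2(2) this]
    consider "- v = v" "act (Map_C2 X) 1 u = u" | "w = pt (splitting X)"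
      using eq 2(3) by metis
    then show thesis
    proof cases
      case 1
      then have "v = 0" by simp
      then show thesis using that[of "u 0"] 2(2,3) fixed_Map_diagonal[OF X 2(2) 1(2)] by (simp add: topspace_Map)
    qed (rule base)
  qed
qed

lemma norm_piece_diagonal_inj:
  assumes X: "based_C2_space X" and xy: "x \<in> topspace (Top X)" "y \<in> topspace (Top X)"
    and eq: "norm_piece X 0 (diagonal X x) = norm_piece X 0 (diagonal X y)"
  shows "x = y"
proof -
  have pt: "z = pt X" if z: "z \<in> topspace (Top X)" "norm_piece X 0 (diagonal X z) = pt (splitting X)" for z
  proof -
    obtain h where "act X h z = pt X"
      using norm_piece_base[OF diagonal_in[OF X z(1)], of 0] z(2) by (auto simp: diagonal_def)
    then have "act X h (act X h z) = pt X" by (simp add: act_pt[OF X])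
    moreover have "h + h = 0" using bit_cases[of h] by auto
    ultimately show ?thesis by (simp only: act_add[OF X z(1)] act_0[OF X z(1)])
  qed
  have "diagonal X x = diagonal X y \<or> norm_piece X 0 (diagonal X x) = pt (splitting X)"
    using norm_piece_eq[OF diagonal_in[OF X xy(1)] diagonal_in[OF X xy(2)] eq] by blast
  then show ?thesis
  proof
    assume "diagonal X x = diagonal X y"
    then have "act X 0 x = act X 0 y" by (simp add: diagonal_def fun_eq_iff)
    then show ?thesis using act_0[OF X] xy by simp
  next
    assume "norm_piece X 0 (diagonal X x) = pt (splitting X)"
    then show ?thesis using pt xy eq by metis
  qed
qed

lemma norm_piece_image:
  assumes X: "based_C2_space X"
    and N_subset: "N \<subseteq> {(v, u). u \<in> topspace (Top (Map_C2 X)) \<and> \<bar>v\<bar> < 1 \<and> u 0 \<noteq> pt X \<and> act X 1 (u 1) \<noteq> pt X}"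
  shows "u \<in> topspace (Top (Map_C2 X)) \<Longrightarrow>
      norm_piece X v u \<in> (\<lambda>(v, u). norm_piece X v u) ` N \<longleftrightarrow> (v, u) \<in> N"
    and "x \<in> topspace (Top X) \<Longrightarrow> loop_piece X h v x \<notin> (\<lambda>(v, u). norm_piece X v u) ` N"
proof -
  have N: "u \<in> topspace (Top (Map_C2 X)) \<and> \<bar>v\<bar> < 1 \<and> u 0 \<noteq> pt X \<and> act X 1 (u 1) \<noteq> pt X"
    if "(v, u) \<in> N" for v u
    using N_subset that by blast
  have not_pt: "norm_piece X v u \<noteq> pt (splitting X)" if vu: "(v, u) \<in> N" for v u
  proof
    assume "norm_piece X v u = pt (splitting X)"
    then obtain h where "u h = pt X" using N[OF vu] norm_piece_base[of u X v] by auto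
    moreover have "h = 0 \<or> h = 1" by (rule bit_cases)
    ultimately show False using N[OF vu] act_pt[OF X, of 1] by metis
  qed
  show "norm_piece X v u \<in> (\<lambda>(v, u). norm_piece X v u) ` N \<longleftrightarrow> (v, u) \<in> N"
    if u: "u \<in> topspace (Top (Map_C2 X))"
  proof
    assume "norm_piece X v u \<in> (\<lambda>(v, u). norm_piece X v u) ` N"
    then obtain w u' where w: "(w, u') \<in> N" "norm_piece X w u' = norm_piece X v u" by auto
    then have "u' \<in> topspace (Top (Map_C2 X))" using N by blast
    from norm_piece_eq[OF this u w(2)] not_pt[OF w(1)] w(1) show "(v, u) \<in> N" by blast
  qed (rule rev_image_eqI, assumption, simp)
  show "loop_piece X h v x \<notin> (\<lambda>(v, u). norm_piece X v u) ` N" if x: "x \<in> topspace (Top X)"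
  proof
    assume "loop_piece X h v x \<in> (\<lambda>(v, u). norm_piece X v u) ` N"
    then obtain w u where "(w, u) \<in> N" "loop_piece X h v x = norm_piece X w u" by auto
    then show False using loop_piece_eq_norm_piece[OF x, of h v w u] not_pt by metis
  qed
qed

text \<open>An open set of \<open>X\<close> is the trace of an open set of the wedge on the diagonal. If it omits the base
  point, the open box \<open>U \<times> gU\<close> over the interior of the interval does not touch the points that are
  collapsed. Otherwise the complement of \<open>U\<close> omits the base point, and one removes the closed set
  \<open>{0} \<times> C \<times> gC\<close> with \<open>C\<close> that complement.\<close>

lemma norm_piece_diagonal_open:
  assumes X: "based_C2_space X" and U: "openin (Top X) U"
  shows "\<exists>V. openin (Top (splitting X)) V \<and>
     (\<forall>x\<in>topspace (Top X). norm_piece X 0 (diagonal X x) \<in> V \<longleftrightarrow> x \<in> U)"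
proof -
  let ?JX = "prod_topology J (Top X)" and ?JM = "prod_topology J (Top (Map_C2 X))"
  have U': "U \<subseteq> topspace (Top X)" by (rule openin_subset[OF U])
  have ev1: "continuous_map ?JM (Top X) (\<lambda>z. act X 1 (snd z 1))"
  proof (rule continuous_map_compose1[where F = "act X 1"])
    show "continuous_map (Top X) (Top X) (act X 1)" using X by (simp add: based_C2_space_def C2_space_def)
    show "continuous_map ?JM (Top X) (\<lambda>z. snd z 1)"
      by (rule continuous_map_compose1[OF continuous_map_eval[of X 1] continuous_map_snd])
  qed
  have ev0: "continuous_map ?JM (Top X) (\<lambda>z. snd z 0)"
    by (rule continuous_map_compose1[OF continuous_map_eval[of X 0] continuous_map_snd])
  have v: "continuous_map ?JM euclideanreal fst" by (rule continuous_map_J_real[OF continuous_map_fst])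
  have diag: "act X 1 (diagonal X x 1) = x \<and> diagonal X x 0 = x" if "x \<in> topspace (Top X)" for x
    using that act_add[OF X that, of 1 1] act_0[OF X that] by (simp add: diagonal_def)
  show ?thesis
  proof (cases "pt X \<in> U")
    case False
    define N where "N = {z \<in> topspace ?JM. -1 < fst z \<and> fst z < 1 \<and> snd z 0 \<in> U \<and> act X 1 (snd z 1) \<in> U}"
    let ?V = "(\<lambda>(v, u). norm_piece X v u) ` N"
    have N: "N \<subseteq> {(v, u). u \<in> topspace (Top (Map_C2 X)) \<and> \<bar>v\<bar> < 1 \<and> u 0 \<noteq> pt X \<and> act X 1 (u 1) \<noteq> pt X}"
      using False by (auto simp: N_def)
    note in_V = norm_piece_image(1)[OF X N] and not_V = norm_piece_image(2)[OF X N]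
    have "openin (Top (splitting X)) ?V"
    proof (rule openin_splitting[OF pt_in[OF X]])
      show "?V \<subseteq> topspace (Top (splitting X))" by (auto simp: N_def intro!: topspace_norm_piece)
      have "{z \<in> topspace ?JX. (\<lambda>(v, x). loop_piece X h v x) z \<in> ?V} = {}" for h
        using not_V by fastforce
      then show "openin ?JX {z \<in> topspace ?JX. (\<lambda>(v, x). loop_piece X h v x) z \<in> ?V}" for h
        by (simp only: openin_empty)
      have "{z \<in> topspace ?JM. (\<lambda>(v, u). norm_piece X v u) z \<in> ?V} = N"
      proof (intro set_eqI iffI)
        fix z assume "z \<in> {z \<in> topspace ?JM. (\<lambda>(v, u). norm_piece X v u) z \<in> ?V}"
        then show "z \<in> N" using in_V[where u = "snd z" and v = "fst z"] by (auto simp: case_prod_unfold)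
      next
        fix z assume z: "z \<in> N"
        then have "z \<in> topspace ?JM" by (simp add: N_def)
        then show "z \<in> {z \<in> topspace ?JM. (\<lambda>(v, u). norm_piece X v u) z \<in> ?V}" using z by blast
      qed
      moreover have "N = {z \<in> topspace ?JM. fst z \<in> {-1<..<1}} \<inter> {z \<in> topspace ?JM. snd z 0 \<in> U} \<inter>
          {z \<in> topspace ?JM. act X 1 (snd z 1) \<in> U}" by (auto simp: N_def)
      moreover have "openin ?JM {z \<in> topspace ?JM. fst z \<in> {-1<..<1}}"
        by (rule openin_continuous_map_preimage[OF v]) auto
      ultimately show "openin ?JM {z \<in> topspace ?JM. (\<lambda>(v, u). norm_piece X v u) z \<in> ?V}"
        using openin_continuous_map_preimage[OF ev0 U] openin_continuous_map_preimage[OF ev1 U]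
        by (simp only: openin_Int)
    qed
    moreover have "norm_piece X 0 (diagonal X x) \<in> ?V \<longleftrightarrow> x \<in> U" if x: "x \<in> topspace (Top X)" for x
      using in_V[where v = 0, OF diagonal_in[OF X x]] diag[OF x] diagonal_in[OF X x] by (simp add: N_def)
    ultimately show ?thesis by (intro exI[of _ ?V] conjI ballI)
  next
    case True
    define C where "C = {z \<in> topspace ?JM. fst z = 0 \<and> snd z 0 \<notin> U \<and> act X 1 (snd z 1) \<notin> U}"
    let ?D = "(\<lambda>(v, u). norm_piece X v u) ` C"
    let ?V = "topspace (Top (splitting X)) - ?D"
    have C: "C \<subseteq> {(v, u). u \<in> topspace (Top (Map_C2 X)) \<and> \<bar>v\<bar> < 1 \<and> u 0 \<noteq> pt X \<and> act X 1 (u 1) \<noteq> pt X}"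
      using True by (auto simp: C_def)
    note in_D = norm_piece_image(1)[OF X C] and not_D = norm_piece_image(2)[OF X C]
    have "openin (Top (splitting X)) ?V"
    proof (rule openin_splitting[OF pt_in[OF X]])
      have loop_in: "loop_piece X h v x \<in> ?V" if "v \<in> {-1..1}" "x \<in> topspace (Top X)" for h v x
        by (rule DiffI[OF topspace_loop_piece[OF that] not_D[OF that(2)]])
      have "{z \<in> topspace ?JX. (\<lambda>(v, x). loop_piece X h v x) z \<in> ?V} = topspace ?JX" for h
      proof (intro set_eqI iffI)
        fix z assume z: "z \<in> topspace ?JX"
        obtain v x where vx: "z = (v, x)" by (cases z)
        then have "v \<in> {-1..1}" "x \<in> topspace (Top X)" using z by auto
        then show "z \<in> {z \<in> topspace ?JX. (\<lambda>(v, x). loop_piece X h v x) z \<in> ?V}"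
          unfolding vx mem_Collect_eq prod.case by (intro conjI[OF z[unfolded vx]] loop_in)
      qed (unfold mem_Collect_eq, elim conjE)
      then show "openin ?JX {z \<in> topspace ?JX. (\<lambda>(v, x). loop_piece X h v x) z \<in> ?V}" for h
        by (simp only: openin_topspace)
      have eq: "{z \<in> topspace ?JM. (\<lambda>(v, u). norm_piece X v u) z \<in> ?V} = topspace ?JM - C"
      proof (intro set_eqI iffI)
        fix z assume "z \<in> {z \<in> topspace ?JM. (\<lambda>(v, u). norm_piece X v u) z \<in> ?V}"
        then show "z \<in> topspace ?JM - C" by blast
      next
        fix z assume z: "z \<in> topspace ?JM - C"
        obtain v u where vu: "z = (v, u)" by (cases z)
        have "v \<in> {-1..1}" "u \<in> topspace (Top (Map_C2 X))" "(v, u) \<notin> C" using z by (auto simp: vu)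
        then show "z \<in> {z \<in> topspace ?JM. (\<lambda>(v, u). norm_piece X v u) z \<in> ?V}"
          using z in_D[where u = u and v = v] topspace_norm_piece[of v u X] by (simp add: vu)
      qed
      have C_eq: "C = {z \<in> topspace ?JM. fst z \<in> {0}} \<inter> {z \<in> topspace ?JM. snd z 0 \<in> topspace (Top X) - U} \<inter>
          {z \<in> topspace ?JM. act X 1 (snd z 1) \<in> topspace (Top X) - U}"
        using act_in[OF X] by (auto simp: C_def topspace_Map)
      have "closedin ?JM {z \<in> topspace ?JM. fst z \<in> {0}}"
        by (rule closedin_continuous_map_preimage[OF v]) auto
      moreover have "closedin (Top X) (topspace (Top X) - U)" using U by blast
      ultimately have "closedin ?JM C"
        unfolding C_eq
        by (intro closedin_Int closedin_continuous_map_preimage[OF ev0] closedin_continuous_map_preimage[OF ev1])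
      then show "openin ?JM {z \<in> topspace ?JM. (\<lambda>(v, u). norm_piece X v u) z \<in> ?V}"
        unfolding eq by (rule openin_diff[OF openin_topspace])
    qed auto
    moreover have "norm_piece X 0 (diagonal X x) \<in> ?V \<longleftrightarrow> x \<in> U" if x: "x \<in> topspace (Top X)" for x
      using in_D[where v = 0, OF diagonal_in[OF X x]] diag[OF x] diagonal_in[OF X x] topspace_norm_piece[of 0 "diagonal X x" X]
      by (simp add: C_def)
    ultimately show ?thesis by (intro exI[of _ ?V] conjI ballI)
  qed
qed

lemma pinch_weak_equivalence_fixed:
  assumes X: "based_C2_space X"
  shows "weak_equivalence (C2_fixed UNIV (susp_Map X)) (C2_fixed UNIV (splitting X)) (pinch X)"
proof -
  let ?P = "C2_fixed UNIV (susp_Map X)" and ?W = "C2_fixed UNIV (splitting X)"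
  let ?k = "\<lambda>x. susp_point X 0 (diagonal X x)" and ?l = "\<lambda>x. norm_piece X 0 (diagonal X x)"
  note ptX = pt_in[OF X]
  have pinch_k: "pinch X (?k x) = ?l x" if "x \<in> topspace (Top X)" for x
    using pinch_susp_point[OF ptX _ diagonal_in[OF X that], of 0] by (simp add: pinch_at_def cat3_def)
  have k_in: "?k x \<in> topspace ?P" if "x \<in> topspace (Top X)" for x
    using that by (simp add: topspace_C2_fixed susp_point_in diagonal_in[OF X] act_susp_point[OF X] diagonal_fixed[OF X])
  have k_cont: "continuous_map (Top X) ?P ?k"
  proof -
    have "continuous_map (Top X) (Top X) (act X h)" for h
      using X by (simp add: based_C2_space_def C2_space_def)
    then have "continuous_map (Top X) (Top (Map_C2 X)) (diagonal X)"
      unfolding Top_Map continuous_map_componentwise_UNIV diagonal_def by simp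
    then have "continuous_map (Top X) (Top (susp_Map X)) ?k"
      using continuous_map_compose2[OF quotient_imp_continuous_map[OF quotient_map_susp_point],
          where Z = "Top X" and f = "\<lambda>_. 0" and g = "diagonal X"]
      by simp
    then show ?thesis
      using k_in unfolding C2_fixed_def by (auto simp: continuous_map_in_subtopology)
  qed
  have pinch_cont: "continuous_map ?P ?W (pinch X)"
  proof -
    have "continuous_map ?P (Top (splitting X)) (pinch X)"
      unfolding C2_fixed_def by (rule continuous_map_from_subtopology[OF continuous_map_pinch[OF ptX]])
    moreover have "act (splitting X) h (pinch X z) = pinch X z" if z: "z \<in> topspace ?P" for z h
    proof -
      have z': "z \<in> topspace (Top (susp_Map X))" "act (susp_Map X) h z = z" using z by (auto simp: topspace_C2_fixed)
      have "pinch X (act (susp_Map X) h z) = act (splitting X) h (pinch X z)"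
        using based_C2_map_pinch[OF X] z'(1) unfolding based_C2_map_def equivariant_def by blast
      then show ?thesis using z'(2) by simp
    qed
    ultimately show ?thesis unfolding C2_fixed_def[of UNIV "splitting X"]
      by (auto simp: continuous_map_in_subtopology)
  qed
  define \<iota> where "\<iota> w = (SOME x. x \<in> topspace (Top X) \<and> w = ?l x)" for w
  have \<iota>_l: "\<iota> (?l x) = x" if "x \<in> topspace (Top X)" for x
  proof -
    have "\<iota> (?l x) \<in> topspace (Top X) \<and> ?l x = ?l (\<iota> (?l x))"
      unfolding \<iota>_def by (rule someI[of _ x]) (simp add: that)
    then show ?thesis using norm_piece_diagonal_inj[OF X] that by metis
  qed
  have \<iota>_cont: "continuous_map ?W (Top X) \<iota>"
    unfolding continuous_map_def
  proof (intro conjI allI impI)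
    show "\<iota> \<in> topspace ?W \<rightarrow> topspace (Top X)"
    proof (rule Pi_I)
      fix w assume "w \<in> topspace ?W"
      then obtain x where "x \<in> topspace (Top X)" "w = ?l x" by (rule fixed_splitting[OF X])
      then show "\<iota> w \<in> topspace (Top X)" by (simp add: \<iota>_l)
    qed
    fix U assume U: "openin (Top X) U"
    obtain V where V: "openin (Top (splitting X)) V" "\<And>x. x \<in> topspace (Top X) \<Longrightarrow> ?l x \<in> V \<longleftrightarrow> x \<in> U"
      using norm_piece_diagonal_open[OF X U] by blast
    have "\<iota> w \<in> U \<longleftrightarrow> w \<in> V" if w: "w \<in> topspace ?W" for w
      using fixed_splitting[OF X w] \<iota>_l V(2) by metis
    then have eq: "{w \<in> topspace ?W. \<iota> w \<in> U} = V \<inter> {w. \<forall>h\<in>UNIV. act (splitting X) h w = w}"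
      using openin_subset[OF V(1)] by (auto simp: topspace_C2_fixed)
    show "openin ?W {w \<in> topspace ?W. \<iota> w \<in> U}"
      unfolding eq unfolding C2_fixed_def by (rule openin_subtopology_Int[OF V(1)])
  qed
  show ?thesis
  proof (rule homotopy_equivalence_imp_weak_equivalence[OF pinch_cont])
    show "continuous_map ?W ?P (\<lambda>w. ?k (\<iota> w))" by (rule continuous_map_compose1[OF k_cont \<iota>_cont])
    show "homotopic_with (\<lambda>_. True) ?P ?P ((\<lambda>w. ?k (\<iota> w)) \<circ> pinch X) id"
      by (rule homotopic_with_id2) (metis fixed_susp_Map[OF X] pinch_k \<iota>_l)
    show "homotopic_with (\<lambda>_. True) ?W ?W (pinch X \<circ> (\<lambda>w. ?k (\<iota> w))) id"
      by (rule homotopic_with_id2) (metis fixed_splitting[OF X] pinch_k \<iota>_l)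
  qed
qed

section \<open>The splitting\<close>

lemma has_C2_CW_type_well_pointed:
  assumes "has_C2_CW_type TYPE('k) X"
  shows "well_pointed (Top X) (pt X)"
proof -
  obtain K :: "'k based_c2_space" where K: "based_C2_space K" "C2_CW_complex K" "based_C2_homotopy_equivalent X K"
    using assms unfolding has_C2_CW_type_def by blast
  then obtain f g where fg: "based_C2_map X K f" "based_C2_map K X g" "based_C2_homotopic X X (g \<circ> f) id"
    unfolding based_C2_homotopy_equivalent_def by blast
  have "homotopic_with (\<lambda>k. k (pt X) = pt X) (Top X) (Top X) (g \<circ> f) id"
    using fg(3) unfolding based_C2_homotopic_def by (rule homotopic_with_mono) simp
  then show ?thesis
    using well_pointed_homotopy_invariant C2_CW_complex_well_pointed[OF K(2) pt_in[OF K(1)]] fg(1,2)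
    unfolding based_C2_map_def by metis
qed

lemma C2_subgroup_cases: "C2_subgroup H \<Longrightarrow> H = {0} \<or> H = UNIV"
proof (cases "1 \<in> H")
  case True
  assume "C2_subgroup H"
  then have "g \<in> H" for g using True bit_cases[of g] by (auto simp: C2_subgroup_def)
  then show ?thesis by blast
next
  case False
  assume "C2_subgroup H"
  then have "0 \<in> H" by (simp add: C2_subgroup_def)
  moreover have "g = 0" if "g \<in> H" for g using that False bit_cases[of g] by blast
  ultimately show ?thesis by blast
qed

theorem theoremA4:
  shows "\<exists>\<eta> :: 'a based_c2_space \<Rightarrow> (real option \<times> (bit \<Rightarrow> 'a)) set \<Rightarrow> 'a splitting_point.
    (\<forall>X. based_C2_space X \<and> has_C2_CW_type TYPE('k) X \<longrightarrow>
       C2_weak_equivalence (susp_Map X) (splitting X) (\<eta> X)) \<and>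
    (\<forall>X Y f. based_C2_space X \<and> has_C2_CW_type TYPE('k) X \<and>
       based_C2_space Y \<and> has_C2_CW_type TYPE('k) Y \<and> based_C2_map X Y f \<longrightarrow>
       (\<forall>z\<in>topspace (Top (susp_Map X)).
          splitting_map Y f (\<eta> X z) = \<eta> Y (susp_Map_map Y f z)))"
proof (intro exI[of _ pinch] conjI allI impI ballI)
  fix X :: "'a based_c2_space"
  assume "based_C2_space X \<and> has_C2_CW_type TYPE('k) X"
  then have X: "based_C2_space X" and w: "well_pointed (Top X) (pt X)"
    by (auto intro: has_C2_CW_type_well_pointed)
  show "C2_weak_equivalence (susp_Map X) (splitting X) (pinch X)"
    unfolding C2_weak_equivalence_def
  proof (intro conjI allI impI)
    show "based_C2_map (susp_Map X) (splitting X) (pinch X)" by (rule based_C2_map_pinch[OF X])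
    fix H assume "C2_subgroup H"
    then show "weak_equivalence (C2_fixed H (susp_Map X)) (C2_fixed H (splitting X)) (pinch X)"
      using C2_subgroup_cases pinch_weak_equivalence_underlying[OF X w] pinch_weak_equivalence_fixed[OF X] by blast
  qed
next
  fix X Y :: "'a based_c2_space" and f z
  assume "based_C2_space X \<and> has_C2_CW_type TYPE('k) X \<and>
       based_C2_space Y \<and> has_C2_CW_type TYPE('k) Y \<and> based_C2_map X Y f"
    and z: "z \<in> topspace (Top (susp_Map X))"
  then have "based_C2_space X" "based_C2_space Y" "based_C2_map X Y f" by auto
  then show "splitting_map Y f (pinch X z) = pinch Y (susp_Map_map Y f z)"
    using z by (rule pinch_natural)
qed

end
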